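(* Let $\mu>0$ and let $\tilde\nu^{(\mu)}=\nu^{(\mu)}\circ\chi^{-1}$ be the law of the spine. Let $T_0^s$ be a finite tree of height $r$ with $R$ leaves, all at height $r$, and let $\mathcal B^s_{1/r}(T_0^s)=\{T^s\in\mathcal T^s: B_r(T^s)=T_0^s\}$. Then: (i) $\tilde\nu^{(\mu)}\big(\mathcal B^s_{1/r}(T_0^s)\big)=e^{-(r-1)\mu}\frac{\mu^{R-1}}{(R-1)!}$. (ii) Identify $\chi^{-1}(\mathcal B^s_{1/r}(T_0^s))$ with $\mathcal T_\infty^R\times\mathcal T_{\rm fin}^\sigma$, $\sigma=2|T_0^s|-R-1$, via $T\mapsto$ (the $R$ infinite subtrees grafted at the leaves of $T_0^s$; the finite subtrees $T_{(i,n)}$ grafted in each sector $(i,n)$ of each vertex $i$ of $T_0^s$ at heights $1,\dots,r-1$). Then $$\nu^{(\mu)}\big(\cdot\mid\chi^{-1}(\mathcal B^s_{1/r}(T_0^s))\big)=\Big(\int_{\mu\Delta_R}d\omega\prod_{j=1}^R\nu^{(\mu_j)}\Big)\times\prod_{(i,n)}\rho_{(i,n)},\qquad\rho_{(i,n)}=\rho;$$ i.e. conditionally on $B_r(\chi(T))=T_0^s$, the finite branches $T_{(i,n)}$ are i.i.d. with law $\rho$ and independent of the infinite branches, whose joint law is $\int_{\mu\Delta_R}d\omega\prod_{j=1}^R\nu^{(\mu_j)}$.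
   Context: Rooted planar trees (root of degree 1); $D_r(T)$ = vertices at height $r$; $|T|$ = number of edges; $B_r(T)$ = subtree spanned by vertices of height $\le r$. For an infinite tree, a vertex is of infinite type if it has infinitely many descendants; these span the spine $\chi(T)$ (same root, no leaves); $\mathcal T^s=\chi(\mathcal T_\infty)$ is the set of spine trees. A vertex $i$ at height $\ge1$ of degree $\sigma_i$ has $\sigma_i$ sectors $(i,n)$, the angular gaps between consecutive edges at $i$; grafting a tree in a sector identifies its root edge with the edge from $i$ to its parent and inserts the rest in that gap. For $\nu>0$, $\nu^{(\nu)}$ is the Borel probability measure with $\nu^{(\nu)}(\{T:B_s(T)=S\})=e^{-\nu(s-1)}4^{-|S|}2^{L+1}\sum_{R=1}^L\binom LR\frac{\nu^{R-1}}{(R-1)!}$ for finite $S$ of height $s$, $L=|D_s(S)|$ (weak limit of $\nu_N^{(\nu)}(T)\propto e^{-\nu h(T)}$ on trees with $N$ edges). $\rho$ is the critical BGW tree with offspring law $2^{-(n+1)}$, $\rho(T)=2\cdot4^{-|T|}$ on finite trees. $\mu\Delta_R$ is the simplex $\{(\mu_1,\dots,\mu_R):\sum\mu_j=\mu,\mu_j>0\}$ with normalized Lebesgue measure $d\omega$, and $\int_{\mu\Delta_R}d\omega\prod_j\nu^{(\mu_j)}$ is the mixture probability measure on $\mathcal T^R$ given on products of balls $A$ by $\int\prod_j\nu^{(\mu_j)}(A)\,d\omega$. *)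

theory Defs
  imports "HOL-Probability.Probability"
begin

text \<open>Rooted planar trees in Ulam--Harris encoding: a tree is a set of vertex
words (lists of nat); the root is the empty word, the children of a vertex w are
w@[0], w@[1], ... (left to right). The height of a vertex is the length of its word.
The root has degree 1: its only child is [0] (the root edge).\<close>

type_synonym tree = "nat list set"

definition is_tree :: "tree \<Rightarrow> bool" where
  "is_tree T \<longleftrightarrow> [] \<in> T
     \<and> (\<forall>w a. w @ [a] \<in> T \<longrightarrow> w \<in> T)
     \<and> (\<forall>w a b. w @ [b] \<in> T \<and> a < b \<longrightarrow> w @ [a] \<in> T)
     \<and> (\<forall>w\<in>T. finite {a. w @ [a] \<in> T})
     \<and> {a. [a] \<in> T} = {0}"

definition trees :: "tree set" where
  "trees = {T. is_tree T}"

definition edges :: "tree \<Rightarrow> nat" where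
  "edges T = card T - 1"

definition height :: "tree \<Rightarrow> nat" where
  "height T = Max (length ` T)"

definition Dlev :: "nat \<Rightarrow> tree \<Rightarrow> nat list set" where
  "Dlev r T = {w \<in> T. length w = r}"

definition Bball :: "nat \<Rightarrow> tree \<Rightarrow> tree" where
  "Bball r T = {w \<in> T. length w \<le> r}"

definition tball :: "nat \<Rightarrow> tree \<Rightarrow> tree set" where
  "tball s S = {T \<in> trees. Bball s T = S}"

text \<open>measurable space of trees: Borel sets, generated by the balls\<close>
definition tree_space :: "tree measure" where
  "tree_space = sigma trees (range (\<lambda>(s, S). tball s S))"

definition nch :: "tree \<Rightarrow> nat list \<Rightarrow> nat" where
  "nch T w = card {a. w @ [a] \<in> T}"

definition leaves :: "tree \<Rightarrow> nat list set" where
  "leaves T = {w \<in> T. w \<noteq> [] \<and> (\<forall>a. w @ [a] \<notin> T)}"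

definition infv :: "tree \<Rightarrow> nat list set" where
  "infv T = {v \<in> T. infinite {w \<in> T. \<exists>u. w = v @ u}}"

text \<open>relabelling of a prefix-closed vertex set to Ulam--Harris normal form
(order-preserving among siblings)\<close>
fun relab :: "nat list set \<Rightarrow> nat list \<Rightarrow> nat list \<Rightarrow> nat list" where
  "relab V u [] = []"
| "relab V u (a # w) = card {b. b < a \<and> u @ [b] \<in> V} # relab V (u @ [a]) w"

definition normalize :: "nat list set \<Rightarrow> tree" where
  "normalize V = relab V [] ` V"

definition chi :: "tree \<Rightarrow> tree" where
  "chi T = normalize (infv T)"

text \<open>inverse of the relabelling: the vertex of V whose normalized label is the given word\<close>
definition kth_child :: "nat list set \<Rightarrow> nat list \<Rightarrow> nat \<Rightarrow> nat" where
  "kth_child V u k = (LEAST a. u @ [a] \<in> V \<and> card {b. b < a \<and> u @ [b] \<in> V} = k)"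

fun unrank :: "nat list set \<Rightarrow> nat list \<Rightarrow> nat list \<Rightarrow> nat list" where
  "unrank V u [] = u"
| "unrank V u (k # w) = unrank V (u @ [kth_child V u k]) w"

definition spv :: "tree \<Rightarrow> nat list \<Rightarrow> nat list" where
  "spv T i = unrank (infv T) [] i"

text \<open>sectors (i,n) of the vertices i of T0 at heights 1..r-1; n = 0..nch T0 i
(n-th gap between consecutive edges, counted from the parent edge, left to right)\<close>
definition sectors :: "tree \<Rightarrow> nat \<Rightarrow> (nat list \<times> nat) set" where
  "sectors T0 r = {(i, n). i \<in> T0 \<and> 1 \<le> length i \<and> length i < r \<and> n \<le> nch T0 i}"

text \<open>finite tree T_(i,n) grafted into sector (i,n): its root edge is the edge from
i to its parent, the rest are the children of i (in T) strictly between the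
(n-1)-th and the n-th spine child, with all their descendants\<close>
definition sector_branch :: "tree \<Rightarrow> tree \<Rightarrow> nat list \<Rightarrow> nat \<Rightarrow> tree" where
  "sector_branch T0 T i n =
     (let v = spv T i;
          lo = (if n = 0 then 0 else last (spv T (i @ [n - 1])) + 1)
      in {[], [0]} \<union> {0 # (p - lo) # w | p w. v @ (p # w) \<in> T \<and> lo \<le> p
                          \<and> (n < nch T0 i \<longrightarrow> p < last (spv T (i @ [n])))})"

text \<open>infinite tree grafted at the leaf l of T0: subtree of T rooted at (the vertex
corresponding to) l, with root edge identified with the edge from l to its parent\<close>
definition inf_branch :: "tree \<Rightarrow> nat list \<Rightarrow> tree" where
  "inf_branch T l = {[]} \<union> {0 # w | w. spv T l @ w \<in> T}"

text \<open>the law rho of the critical geometric BGW tree on finite trees\<close>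
definition rho :: "tree \<Rightarrow> real" where
  "rho T = 2 * (1/4) ^ edges T"

text \<open>normalized Lebesgue measure on the simplex mu Delta_R, parametrized by the
first R-1 coordinates\<close>
definition simplex_par :: "nat \<Rightarrow> real \<Rightarrow> (nat \<Rightarrow> real) set" where
  "simplex_par R \<mu> = {x \<in> space (PiM {..<R-1} (\<lambda>_. lborel)).
       (\<forall>j<R-1. 0 < x j) \<and> (\<Sum>j<R-1. x j) < \<mu>}"

definition simplex_pt :: "nat \<Rightarrow> real \<Rightarrow> (nat \<Rightarrow> real) \<Rightarrow> (nat \<Rightarrow> real)" where
  "simplex_pt R \<mu> x = (\<lambda>j. if j < R - 1 then x j else \<mu> - (\<Sum>k<R-1. x k))"

definition simplex_integral :: "nat \<Rightarrow> real \<Rightarrow> ((nat \<Rightarrow> real) \<Rightarrow> real) \<Rightarrow> real" where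
  "simplex_integral R \<mu> f =
     (LINT x | uniform_measure (PiM {..<R-1} (\<lambda>_. lborel)) (simplex_par R \<mu>).
        indicator (simplex_par R \<mu>) x * f (simplex_pt R \<mu> x))"

definition is_nu_family :: "(real \<Rightarrow> tree measure) \<Rightarrow> bool" where
  "is_nu_family nu \<longleftrightarrow> (\<forall>\<nu>>0. prob_space (nu \<nu>) \<and> sets (nu \<nu>) = sets tree_space \<and>
     (\<forall>s S. is_tree S \<and> finite S \<and> height S = s \<longrightarrow>
        (let L = card (Dlev s S) in
          measure (nu \<nu>) (tball s S) =
            exp (- \<nu> * (real s - 1)) * (1/4) ^ edges S * 2 ^ (L + 1) *
            (\<Sum>R'=1..L. real (L choose R') * \<nu> ^ (R' - 1) / fact (R' - 1)))))"

end

theory Submission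
  imports Defs "HOL-Library.Sublist"
begin

text \<open>The ball formula extends to the event that \<open>T\<close> continues a finite tree \<open>S\<close> only below a set \<open>U\<close>
  of leaves at a common height \<open>s\<close>: its probability depends only on the number of edges of \<open>S\<close>, on
  \<open>s\<close> and on the number of elements of \<open>U\<close>. Since the masses \<open>4 ^ (- edges)\<close> of the finite trees have
  a finite explicit sum, the events in which some of the continuations are finite can be summed out,
  and the event that exactly \<open>k\<close> prescribed vertices of \<open>U\<close> have infinitely many descendants is seen to
  have a probability proportional to \<open>\<nu> ^ (k - 1) / (k - 1)!\<close>. Prescribing the spine up to height \<open>r\<close>
  and the finite branches amounts to such an event for the tree obtained from \<open>T0\<close> by grafting all
  the branches into their sectors, and the weight factorizes over the sectors. For the infinite
  branches, \<open>(\<Sum> k j - 1)\<close> in the exponent is decoupled by the Dirichlet integral of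
  \<open>\<Prod> m j ^ (k j - 1) / (k j - 1)!\<close> over the simplex.\<close>


section \<open>Plane trees with a root of arbitrary degree\<close>

text \<open>The ball formula only treats trees cut at one height, while finite branches may rise
  above the common height of the ends that continue. To reach that case, masses at height s + 1 must
  be summed back to height s, and here the exact form of the formula enters. Under the linear map
  sending x^k to \<nu>^(k-1)/(k-1)! and 1 to 0, the formula says: a factor 1/4 for each edge, 2(1 +
  x) for each top vertex, and a global factor 2 exp(-\<nu>(s-1)). Summing over the number of
  children of a vertex gives 2/(1 - x), and under the map (1 - x)^(-L) equals exp \<nu> times (1 +
  x)^L. This exp \<nu> is the change of the exponential from s + 1 to s. The finite continuations of
  an end sum to the weight 2, so an end with infinitely many descendants weighs 2(1 + x) - 2 = 2x,
  and a spine with R leaves yields the image of x^R. The factor 2 in \<open>rho\<close> comes from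
  counting: with \<sigma> = 2|T0| - R - 1 sectors, each graft sharing one edge with the spine, the
  remaining powers are 2^(R+1) 4^(-|T0|) 4^\<sigma> = 2^\<sigma>.\<close>

definition ptree :: "nat list set \<Rightarrow> bool" where
  "ptree P \<longleftrightarrow> [] \<in> P \<and> (\<forall>w a. w @ [a] \<in> P \<longrightarrow> w \<in> P)
     \<and> (\<forall>w a b. w @ [b] \<in> P \<and> a < b \<longrightarrow> w @ [a] \<in> P) \<and> (\<forall>w. finite {a. w @ [a] \<in> P})"

definition subt :: "nat list set \<Rightarrow> nat list \<Rightarrow> nat list set" where
  "subt T u = {w. u @ w \<in> T}"

text \<open>Unlike for \<open>leaves\<close>, the root qualifies, as is needed for one-vertex trees
  such as \<open>star 0\<close> or a ball of radius 0.\<close>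

definition ends :: "nat list set \<Rightarrow> nat list set" where
  "ends P = {w \<in> P. \<forall>a. w @ [a] \<notin> P}"

text \<open>With the whole top level as \<open>U\<close> this is a ball, with empty \<open>U\<close>
  the single tree \<open>S\<close>. Ends in \<open>U\<close> may acquire children but are not forced
  to.\<close>

definition pext :: "nat list set \<Rightarrow> nat list set \<Rightarrow> nat list set set" where
  "pext S U = {T. ptree T \<and> S \<subseteq> T \<and> (\<forall>w\<in>T. w \<in> S \<or> (\<exists>u\<in>U. prefix u w))}"

definition graft :: "nat list set \<Rightarrow> nat list set \<Rightarrow> (nat list \<Rightarrow> nat list set) \<Rightarrow> nat list set" where
  "graft S X f = S \<union> {x @ w | x w. x \<in> X \<and> w \<in> f x}"

text \<open>Subtrees at a vertex have roots of any degree; the additional edge brings them back into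
  \<open>is_tree\<close>. As \<open>edges (plant P)\<close> is \<open>card P\<close>, weights of
  planted trees are powers of the vertex number of the unplanted ones.\<close>

definition plant :: "nat list set \<Rightarrow> tree" where
  "plant P = insert [] ((#) 0 ` P)"

lemma in_subt [simp]: "w \<in> subt T u \<longleftrightarrow> u @ w \<in> T"
  by (simp add: subt_def)

lemma subt_Nil [simp]: "subt T [] = T"
  by (simp add: subt_def)

lemma subt_subt: "subt (subt T u) v = subt T (u @ v)"
  by (auto simp: subt_def)

lemma ptree_Nil: "ptree P \<Longrightarrow> [] \<in> P"
  by (simp add: ptree_def)

lemma ptree_snocD: "ptree P \<Longrightarrow> w @ [a] \<in> P \<Longrightarrow> w \<in> P"
  unfolding ptree_def by blast

lemma ptree_sibling: "ptree P \<Longrightarrow> w @ [b] \<in> P \<Longrightarrow> a \<le> b \<Longrightarrow> w @ [a] \<in> P"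
  unfolding ptree_def by (metis le_neq_implies_less)

lemma ptree_finite_children: "ptree P \<Longrightarrow> finite {a. w @ [a] \<in> P}"
  unfolding ptree_def by blast

lemma ptree_appendD: "ptree P \<Longrightarrow> u @ w \<in> P \<Longrightarrow> u \<in> P"
proof (induction w rule: rev_induct)
  case (snoc a w)
  then show ?case using ptree_snocD[of P "u @ w" a] by simp
qed simp

lemma ptree_prefixD: "ptree P \<Longrightarrow> prefix u w \<Longrightarrow> w \<in> P \<Longrightarrow> u \<in> P"
  unfolding prefix_def by (auto dest: ptree_appendD)

lemma ptree_subt: "ptree P \<Longrightarrow> u \<in> P \<Longrightarrow> ptree (subt P u)"
proof -
  assume P: "ptree P" and u: "u \<in> P"
  have "w \<in> subt P u" if "w @ [a] \<in> subt P u" for w a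
    using ptree_snocD[OF P, of "u @ w" a] that by simp
  moreover have "w @ [a] \<in> subt P u" if "w @ [b] \<in> subt P u" "a < b" for w a b
    using ptree_sibling[OF P, of "u @ w" b a] that by simp
  moreover have "finite {a. w @ [a] \<in> subt P u}" for w
    using ptree_finite_children[OF P, of "u @ w"] by simp
  moreover have "[] \<in> subt P u" using u by simp
  ultimately show ?thesis unfolding ptree_def by blast
qed

lemma ptree_children: "ptree P \<Longrightarrow> {a. w @ [a] \<in> P} = {..<nch P w}"
proof -
  assume P: "ptree P"
  let ?A = "{a. w @ [a] \<in> P}"
  have fin: "finite ?A" using P by (rule ptree_finite_children)
  have down: "b \<in> ?A" if "a \<in> ?A" "b \<le> a" for a b
    using ptree_sibling[OF P] that by blast
  have "?A = {..<card ?A}"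
  proof (cases "?A = {}")
    case False
    define m where "m = Max ?A"
    have "m \<in> ?A" unfolding m_def using fin False by (rule Max_in)
    moreover have "a \<le> m" if "a \<in> ?A" for a unfolding m_def using fin that by simp
    ultimately have "?A = {..m}" using down by (intro set_eqI iffI) (blast, metis atMost_iff)
    then show ?thesis by (simp add: lessThan_Suc_atMost)
  qed auto
  then show ?thesis by (simp add: nch_def)
qed

lemma ptree_child_iff: "ptree P \<Longrightarrow> w @ [a] \<in> P \<longleftrightarrow> a < nch P w"
  using ptree_children[of P w] by blast

lemma is_tree_iff: "is_tree T \<longleftrightarrow> ptree T \<and> {a. [a] \<in> T} = {0}"
proof -
  have 1: "\<forall>w. finite {a. w @ [a] \<in> T}"
    if T: "\<forall>w a. w @ [a] \<in> T \<longrightarrow> w \<in> T" "\<forall>w\<in>T. finite {a. w @ [a] \<in> T}"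
  proof
    fix w
    have "w \<notin> T \<Longrightarrow> {a. w @ [a] \<in> T} = {}" using T(1) by blast
    then show "finite {a. w @ [a] \<in> T}" using T(2) by (metis finite.emptyI)
  qed
  show ?thesis
  proof
    assume "is_tree T"
    then show "ptree T \<and> {a. [a] \<in> T} = {0}" unfolding is_tree_def ptree_def
      by (elim conjE) (intro conjI, assumption+, erule (1) 1, assumption)
  next
    assume "ptree T \<and> {a. [a] \<in> T} = {0}"
    then show "is_tree T" unfolding is_tree_def ptree_def
      by (elim conjE) (intro conjI ballI, assumption+, erule spec, assumption)
  qed
qed

lemma is_tree_ptree: "is_tree T \<Longrightarrow> ptree T"
  by (simp add: is_tree_iff)

lemma is_tree_root_edge: "is_tree T \<Longrightarrow> [a] \<in> T \<longleftrightarrow> a = 0"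
  by (auto simp: is_tree_iff)

lemma ptree_level_finite: "ptree P \<Longrightarrow> finite {w \<in> P. length w = n}"
proof (induction n)
  case 0
  have "{w \<in> P. length w = 0} \<subseteq> {[]}" by auto
  then show ?case by (rule finite_subset) simp
next
  case (Suc n)
  have "{w \<in> P. length w = Suc n} \<subseteq> (\<Union>w\<in>{w \<in> P. length w = n}. (\<lambda>a. w @ [a]) ` {a. w @ [a] \<in> P})"
  proof
    fix w assume w: "w \<in> {w \<in> P. length w = Suc n}"
    then obtain v a where "w = v @ [a]" by (cases w rule: rev_cases) auto
    with w show "w \<in> (\<Union>w\<in>{w \<in> P. length w = n}. (\<lambda>a. w @ [a]) ` {a. w @ [a] \<in> P})"
      using ptree_snocD[OF Suc.prems] by auto
  qed
  then show ?case
    by (rule finite_subset) (use Suc ptree_finite_children in auto)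
qed

lemma ptree_Bball_finite: "ptree P \<Longrightarrow> finite (Bball n P)"
proof -
  assume P: "ptree P"
  have "Bball n P = (\<Union>k\<le>n. {w \<in> P. length w = k})" by (auto simp: Bball_def)
  then show ?thesis using ptree_level_finite[OF P] by simp
qed

lemma ptree_Bball: "ptree P \<Longrightarrow> ptree (Bball n P)"
proof -
  assume P: "ptree P"
  have "finite {a. w @ [a] \<in> Bball n P}" for w
    using ptree_finite_children[OF P, of w] by (rule rev_finite_subset) (auto simp: Bball_def)
  moreover have "w @ [a] \<in> Bball n P" if "w @ [b] \<in> Bball n P" "a < b" for w a b
    using ptree_sibling[OF P, of w b a] that by (simp add: Bball_def)
  moreover have "w \<in> Bball n P" if "w @ [a] \<in> Bball n P" for w a
    using ptree_snocD[OF P, of w a] that by (simp add: Bball_def)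
  moreover have "[] \<in> Bball n P" using ptree_Nil[OF P] by (simp add: Bball_def)
  ultimately show ?thesis unfolding ptree_def by blast
qed

lemma ends_subset: "x \<in> ends S \<Longrightarrow> x \<in> S"
  by (simp add: ends_def)

lemma ends_prefix_eq:
  assumes "ptree S" "x \<in> ends S" "y \<in> S" "prefix x y" shows "x = y"
proof (rule ccontr)
  assume "x \<noteq> y"
  then obtain a w where "y = x @ a # w" using assms(4) unfolding prefix_def by (metis append_Nil2 neq_Nil_conv)
  then have "x @ [a] \<in> S" using ptree_appendD[OF assms(1), of "x @ [a]" w] assms(3) by simp
  then show False using assms(2) by (simp add: ends_def)
qed

text \<open>Two prefixes of one word are comparable, and nothing in \<open>S\<close> lies strictly
  below an end. So a word splits in at most one way into an end and a rest, and grafts at different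
  ends do not interfere.\<close>

lemma ends_antichain:
  assumes "ptree S" "x \<in> ends S" "y \<in> ends S" "prefix x w" "prefix y w" shows "x = y"
  using prefix_same_cases[OF assms(4,5)] ends_prefix_eq[OF assms(1,2) ends_subset[OF assms(3)]]
    ends_prefix_eq[OF assms(1,3) ends_subset[OF assms(2)]] by blast

section \<open>Trees that continue a given tree below some of its ends\<close>

lemma pextD:
  assumes "T \<in> pext S U"
  shows "ptree T" "S \<subseteq> T" "w \<in> T \<Longrightarrow> w \<in> S \<or> (\<exists>u\<in>U. prefix u w)"
  using assms by (auto simp: pext_def)

lemma pext_empty: "ptree S \<Longrightarrow> pext S {} = {S}"
  by (auto simp: pext_def)

lemma is_tree_ends_nonempty: "is_tree S \<Longrightarrow> x \<in> ends S \<Longrightarrow> x \<noteq> []"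
  by (auto simp: ends_def is_tree_iff)

lemma pext_is_tree:
  assumes S: "is_tree S" and U: "U \<subseteq> ends S" and T: "T \<in> pext S U"
  shows "is_tree T"
proof -
  have "a = 0" if a: "[a] \<in> T" for a
  proof -
    have "[a] \<in> S \<or> (\<exists>u\<in>U. prefix u [a])" using pextD(3)[OF T a] .
    moreover have "[a] \<in> S" if u: "u \<in> U" "prefix u [a]" for u
    proof -
      have "u \<noteq> []" using is_tree_ends_nonempty[OF S] u(1) U by blast
      then have "u = [a]" using u(2) by (cases u) auto
      then show ?thesis using u(1) U ends_subset by blast
    qed
    ultimately show ?thesis using S by (auto simp: is_tree_iff)
  qed
  moreover have "[0] \<in> T" using pextD(2)[OF T] S by (auto simp: is_tree_iff)
  ultimately show ?thesis using pextD(1)[OF T] by (auto simp: is_tree_iff)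
qed

section \<open>Grafting at ends\<close>

lemma in_graft_below:
  assumes S: "ptree S" and X: "X \<subseteq> ends S" and f: "\<And>x. x \<in> X \<Longrightarrow> ptree (f x)" and x: "x \<in> X"
  shows "x @ w \<in> graft S X f \<longleftrightarrow> w \<in> f x"
proof
  assume "x @ w \<in> graft S X f"
  then consider "x @ w \<in> S" | y v where "y \<in> X" "v \<in> f y" "x @ w = y @ v"
    unfolding graft_def by blast
  then show "w \<in> f x"
  proof cases
    case 1
    then have "x = x @ w" by (intro ends_prefix_eq[OF S]) (use x X in auto)
    then show ?thesis using ptree_Nil[OF f[OF x]] by simp
  next
    case 2
    then have "x = y" using ends_antichain[OF S, of x y "x @ w"] X x by (metis prefixI subsetD)
    then show ?thesis using 2 by simp
  qed
next
  assume "w \<in> f x" then show "x @ w \<in> graft S X f" using x unfolding graft_def by blast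
qed

lemma in_graft_not_below:
  assumes "\<And>x. x \<in> X \<Longrightarrow> \<not> prefix x w" shows "w \<in> graft S X f \<longleftrightarrow> w \<in> S"
  using assms unfolding graft_def by (auto intro: prefixI)

lemma ptree_graft:
  assumes S: "ptree S" and X: "X \<subseteq> ends S" and f: "\<And>x. x \<in> X \<Longrightarrow> ptree (f x)"
  shows "ptree (graft S X f)"
proof -
  have below: "x @ w \<in> graft S X f \<longleftrightarrow> w \<in> f x" if "x \<in> X" for x w
    by (rule in_graft_below[OF S X f that])
  let ?G = "graft S X f"
  have cases: "(\<exists>x\<in>X. \<exists>v. w = x @ v) \<or> (\<forall>a. w @ [a] \<in> ?G \<longleftrightarrow> w @ [a] \<in> S)" for w
  proof (cases "\<exists>x\<in>X. prefix x w")
    case False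
    have "w @ [a] \<in> ?G \<longleftrightarrow> w @ [a] \<in> S" for a
    proof (cases "\<exists>x\<in>X. prefix x (w @ [a])")
      case True
      then obtain x where x: "x \<in> X" "prefix x (w @ [a])" by blast
      then have "x = w @ [a]" using False by (auto simp: prefix_snoc)
      then have "w @ [a] \<in> S" using x X ends_subset by blast
      then show ?thesis by (simp add: graft_def)
    next
      case False
      then show ?thesis by (intro in_graft_not_below) blast
    qed
    then show ?thesis by blast
  qed (auto simp: prefix_def)
  have 1: "[] \<in> ?G" using ptree_Nil[OF S] by (simp add: graft_def)
  have SG: "S \<subseteq> ?G" by (simp add: graft_def)
  have 2: "w \<in> ?G" if "w @ [a] \<in> ?G" for w a
    using cases[of w]
  proof
    assume "\<exists>x\<in>X. \<exists>v. w = x @ v"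
    then obtain x v where x: "x \<in> X" "w = x @ v" by blast
    then show ?thesis using that below[OF x(1)] ptree_snocD[OF f[OF x(1)]] by simp
  next
    assume "\<forall>a. w @ [a] \<in> ?G \<longleftrightarrow> w @ [a] \<in> S"
    then show ?thesis using that ptree_snocD[OF S] SG by blast
  qed
  have 3: "w @ [a] \<in> ?G" if "w @ [b] \<in> ?G" "a < b" for w a b
    using cases[of w]
  proof
    assume "\<exists>x\<in>X. \<exists>v. w = x @ v"
    then obtain x v where x: "x \<in> X" "w = x @ v" by blast
    then show ?thesis using that below[OF x(1)] ptree_sibling[OF f[OF x(1)], of v b a] by simp
  next
    assume "\<forall>a. w @ [a] \<in> ?G \<longleftrightarrow> w @ [a] \<in> S"
    then show ?thesis using that ptree_sibling[OF S, of w b a] SG by auto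
  qed
  have 4: "finite {a. w @ [a] \<in> ?G}" for w
    using cases[of w]
  proof
    assume "\<exists>x\<in>X. \<exists>v. w = x @ v"
    then obtain x v where x: "x \<in> X" "w = x @ v" by blast
    then show ?thesis using below[OF x(1)] ptree_finite_children[OF f[OF x(1)], of v] by simp
  next
    assume "\<forall>a. w @ [a] \<in> ?G \<longleftrightarrow> w @ [a] \<in> S"
    then show ?thesis using ptree_finite_children[OF S, of w] by simp
  qed
  show ?thesis unfolding ptree_def using 1 2 3 4 by blast
qed

lemma graft_in_pext:
  assumes S: "ptree S" and X: "X \<subseteq> ends S" and f: "\<And>x. x \<in> X \<Longrightarrow> ptree (f x)"
  shows "graft S X f \<in> pext S X"
  using ptree_graft[OF assms] by (auto simp: pext_def graft_def intro: prefixI)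

lemma is_tree_graft:
  assumes S: "is_tree S" and X: "X \<subseteq> ends S" and f: "\<And>x. x \<in> X \<Longrightarrow> ptree (f x)"
  shows "is_tree (graft S X f)"
  by (rule pext_is_tree[OF S X graft_in_pext[OF is_tree_ptree[OF S] X f]])

lemma ends_graft:
  assumes S: "ptree S" and X: "X \<subseteq> U" and U: "U \<subseteq> ends S" and f: "\<And>x. x \<in> X \<Longrightarrow> ptree (f x)"
    and V: "\<And>x. x \<in> X \<Longrightarrow> V x \<subseteq> ends (f x)"
  shows "(U - X) \<union> {x @ v | x v. x \<in> X \<and> v \<in> V x} \<subseteq> ends (graft S X f)"
proof -
  have X': "X \<subseteq> ends S" using X U by blast
  have below: "x @ w \<in> graft S X f \<longleftrightarrow> w \<in> f x" if "x \<in> X" for x w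
    by (rule in_graft_below[OF S X' f that])
  have "x @ v \<in> ends (graft S X f)" if x: "x \<in> X" and v: "v \<in> V x" for x v
    using V[OF x] v below[OF x] unfolding ends_def by auto
  moreover have "u \<in> ends (graft S X f)" if u: "u \<in> U - X" for u
  proof -
    have uE: "u \<in> ends S" using u U by blast
    have "u @ [a] \<notin> graft S X f" for a
    proof
      assume a: "u @ [a] \<in> graft S X f"
      then obtain x where x: "x \<in> X" "prefix x (u @ [a])"
        using in_graft_not_below[of X "u @ [a]" S f] uE unfolding ends_def by blast
      then have "x = u"
        using ends_antichain[OF S, of x u "u @ [a]"] X' uE by auto
      then show False using u x by simp
    qed
    then show ?thesis using uE unfolding ends_def graft_def by blast
  qed
  ultimately show ?thesis by blast
qed

text \<open>The refinement step used throughout: prescribing how the subtrees at some ends of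
  \<open>U\<close> begin is again an event of the same shape, for a larger tree. Revealing a number
  of children, a finite subtree, the surroundings of a spine vertex or a ball of an infinite branch
  are all instances.\<close>

lemma pext_graft:
  assumes S: "ptree S" and X: "X \<subseteq> U" and U: "U \<subseteq> ends S" and f: "\<And>x. x \<in> X \<Longrightarrow> ptree (f x)"
  shows "pext (graft S X f) ((U - X) \<union> {x @ v | x v. x \<in> X \<and> v \<in> V x})
       = {T \<in> pext S U. \<forall>x\<in>X. subt T x \<in> pext (f x) (V x)}" (is "?L = ?R")
proof (intro set_eqI iffI)
  have X': "X \<subseteq> ends S" using X U by blast
  have below: "x @ w \<in> graft S X f \<longleftrightarrow> w \<in> f x" if "x \<in> X" for x w
    by (rule in_graft_below[OF S X' f that])
  fix T assume T: "T \<in> ?L"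
  have pT: "ptree T" and ST: "S \<subseteq> T" using pextD(1,2)[OF T] by (auto simp: graft_def)
  have 1: "w \<in> S \<or> (\<exists>u\<in>U. prefix u w)" if "w \<in> T" for w
  proof -
    have "w \<in> graft S X f \<or> (\<exists>u\<in>U - X. prefix u w) \<or> (\<exists>x\<in>X. \<exists>v\<in>V x. prefix (x @ v) w)"
      using pextD(3)[OF T that] by blast
    then show ?thesis using X unfolding graft_def
      by (auto dest: append_prefixD intro: prefixI)
  qed
  have 2: "subt T x \<in> pext (f x) (V x)" if x: "x \<in> X" for x
  proof -
    have xE: "x \<in> ends S" using x X' by blast
    have "ptree (subt T x)" using ptree_subt[OF pT] ST xE ends_subset by blast
    moreover have "f x \<subseteq> subt T x"
      using pextD(2)[OF T] below[OF x] by (auto simp: subset_iff)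
    moreover have "w \<in> f x \<or> (\<exists>v\<in>V x. prefix v w)" if w: "w \<in> subt T x" for w
    proof -
      have "x @ w \<in> T" using w by simp
      from pextD(3)[OF T this] consider "x @ w \<in> graft S X f" | u where "u \<in> U - X" "prefix u (x @ w)"
        | y v where "y \<in> X" "v \<in> V y" "prefix (y @ v) (x @ w)" by blast
      then show ?thesis
      proof cases
        case 1 then show ?thesis using below[OF x] by blast
      next
        case 2
        then have "u = x" using ends_antichain[OF S, of u x "x @ w"] U xE by auto
        then show ?thesis using 2 x by simp
      next
        case 3
        then have "y = x" using ends_antichain[OF S, of y x "x @ w"] X' xE by (auto dest: append_prefixD)
        then show ?thesis using 3 by auto
      qed
    qed
    ultimately show ?thesis by (simp add: pext_def)
  qed
  show "T \<in> ?R" using pT ST 1 2 by (simp add: pext_def)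
next
  fix T assume T: "T \<in> ?R"
  then have TS: "T \<in> pext S U" and sub: "\<And>x. x \<in> X \<Longrightarrow> subt T x \<in> pext (f x) (V x)" by auto
  have "graft S X f \<subseteq> T"
    using pextD(2)[OF TS] pextD(2)[OF sub] unfolding graft_def by fastforce
  moreover have "w \<in> graft S X f \<or> (\<exists>u\<in>(U - X) \<union> {x @ v | x v. x \<in> X \<and> v \<in> V x}. prefix u w)" if w: "w \<in> T" for w
    using pextD(3)[OF TS w]
  proof
    assume "w \<in> S" then show ?thesis by (simp add: graft_def)
  next
    assume "\<exists>u\<in>U. prefix u w"
    then obtain u v where u: "u \<in> U" "w = u @ v" by (auto simp: prefix_def)
    show ?thesis
    proof (cases "u \<in> X")
      case True
      have "v \<in> subt T u" using w u by simp
      from pextD(3)[OF sub[OF True] this] show ?thesis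
      proof
        assume "v \<in> f u"
        then show ?thesis using True u unfolding graft_def by blast
      next
        assume "\<exists>y\<in>V u. prefix y v"
        then obtain y where "y \<in> V u" "prefix y v" by blast
        then have "prefix (u @ y) w" "u @ y \<in> {x @ v | x v. x \<in> X \<and> v \<in> V x}" using True u by auto
        then show ?thesis by blast
      qed
    next
      case False
      then have "u \<in> U - X" "prefix u w" using u by (auto intro: prefixI)
      then show ?thesis by blast
    qed
  qed
  ultimately show "T \<in> ?L" using pextD(1)[OF TS] by (simp add: pext_def)
qed

lemma finite_graft:
  "finite S \<Longrightarrow> finite X \<Longrightarrow> (\<And>x. x \<in> X \<Longrightarrow> finite (f x)) \<Longrightarrow> finite (graft S X f)"
proof -
  assume *: "finite S" "finite X" "\<And>x. x \<in> X \<Longrightarrow> finite (f x)"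
  have "graft S X f = S \<union> (\<Union>x\<in>X. (@) x ` f x)" by (auto simp: graft_def)
  then show ?thesis using * by simp
qed

text \<open>The root of each grafted tree coincides with the end that carries it, so
  \<open>card X\<close> vertices are counted twice on the right. The additive form avoids truncated
  subtraction.\<close>

lemma card_graft:
  assumes S: "ptree S" and X: "X \<subseteq> ends S" and f: "\<And>x. x \<in> X \<Longrightarrow> ptree (f x)"
    and fin: "finite S" "\<And>x. x \<in> X \<Longrightarrow> finite (f x)"
  shows "card (graft S X f) + card X = card S + (\<Sum>x\<in>X. card (f x))"
proof -
  have finX: "finite X" using X fin(1) finite_subset ends_subset by (metis subsetI)
  have eq: "graft S X f = S \<union> (\<Union>x\<in>X. (@) x ` (f x - {[]}))"
  proof -
    have "X \<subseteq> S" using X ends_subset by blast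
    then have "x @ w \<in> S \<or> w \<in> f x - {[]}" if "x \<in> X" "w \<in> f x" for x w
      using that by (cases "w = []") auto
    then show ?thesis unfolding graft_def by blast
  qed
  have dis: "S \<inter> (\<Union>x\<in>X. (@) x ` (f x - {[]})) = {}"
  proof -
    have False if "x \<in> X" "w \<noteq> []" "x @ w \<in> S" for x w
      using ends_prefix_eq[OF S, of x "x @ w"] that X by auto
    then show ?thesis by auto
  qed
  have "card (graft S X f) = card S + card (\<Union>x\<in>X. (@) x ` (f x - {[]}))"
    unfolding eq by (rule card_Un_disjoint) (use fin finX dis in auto)
  also have "card (\<Union>x\<in>X. (@) x ` (f x - {[]})) = (\<Sum>x\<in>X. card ((@) x ` (f x - {[]})))"
  proof (rule card_UN_disjoint)
    show "\<forall>i\<in>X. \<forall>j\<in>X. i \<noteq> j \<longrightarrow> (@) i ` (f i - {[]}) \<inter> (@) j ` (f j - {[]}) = {}"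
    proof (intro ballI impI equals0I)
      fix i j w assume ij: "i \<in> X" "j \<in> X" "i \<noteq> j" "w \<in> (@) i ` (f i - {[]}) \<inter> (@) j ` (f j - {[]})"
      then have "prefix i w" "prefix j w" by (auto intro: prefixI)
      then show False using ends_antichain[OF S, of i j w] ij X by blast
    qed
  qed (use fin finX in auto)
  also have "\<dots> = (\<Sum>x\<in>X. card (f x) - 1)"
    by (intro sum.cong refl) (simp add: card_image inj_on_def ptree_Nil f fin card_Diff_subset)
  finally have *: "card (graft S X f) = card S + (\<Sum>x\<in>X. card (f x) - 1)" .
  have "(\<Sum>x\<in>X. card (f x)) = (\<Sum>x\<in>X. (card (f x) - 1) + 1)"
  proof (rule sum.cong[OF refl])
    fix x assume x: "x \<in> X"
    then have "card (f x) > 0" using fin f ptree_Nil by (metis card_gt_0_iff empty_iff)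
    then show "card (f x) = (card (f x) - 1) + 1" by simp
  qed
  then show ?thesis using * by (simp add: sum_Suc)
qed

lemma pext_Dlev:
  assumes f: "ptree f" "\<And>w. w \<in> f \<Longrightarrow> length w \<le> h"
  shows "pext f (Dlev h f) = {P. ptree P \<and> Bball h P = f}"
proof (intro set_eqI iffI)
  fix P assume P: "P \<in> pext f (Dlev h f)"
  have "w \<in> f" if "w \<in> P" "length w \<le> h" for w
  proof -
    have "w \<in> f \<or> (\<exists>u\<in>Dlev h f. prefix u w)" using pextD(3)[OF P that(1)] .
    moreover have "u = w" if "u \<in> Dlev h f" "prefix u w" for u
      using that \<open>length w \<le> h\<close> unfolding Dlev_def prefix_def by auto
    ultimately show ?thesis by (auto simp: Dlev_def)
  qed
  then show "P \<in> {P. ptree P \<and> Bball h P = f}" using pextD[OF P] f by (auto simp: Bball_def)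
next
  fix P assume P: "P \<in> {P. ptree P \<and> Bball h P = f}"
  then have pP: "ptree P" and fP: "f = Bball h P" by auto
  have "w \<in> f \<or> (\<exists>u\<in>Dlev h f. prefix u w)" if w: "w \<in> P" for w
  proof (cases "length w \<le> h")
    case False
    have "take h w \<in> P" using ptree_prefixD[OF pP take_is_prefix w] .
    then have "take h w \<in> Dlev h f" using False fP by (auto simp: Bball_def Dlev_def)
    then show ?thesis using take_is_prefix by blast
  qed (use w fP in \<open>auto simp: Bball_def\<close>)
  then show "P \<in> pext f (Dlev h f)" using pP fP by (auto simp: pext_def Bball_def)
qed

lemma Dlev_ends: "(\<And>w. w \<in> f \<Longrightarrow> length w \<le> h) \<Longrightarrow> Dlev h f \<subseteq> ends f"
  unfolding Dlev_def ends_def by fastforce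

section \<open>Adding and removing the root edge\<close>

lemma ptree_plant: "ptree P \<Longrightarrow> ptree (plant P)"
proof -
  assume P: "ptree P"
  have "finite {a. w @ [a] \<in> plant P}" for w
  proof (cases w)
    case Nil then show ?thesis by (auto simp: plant_def intro: finite_subset[of _ "{0}"])
  next
    case (Cons b v)
    then have "{a. w @ [a] \<in> plant P} \<subseteq> {a. v @ [a] \<in> P}" by (auto simp: plant_def)
    then show ?thesis using ptree_finite_children[OF P] by (rule finite_subset)
  qed
  moreover have "w \<in> plant P" if "w @ [a] \<in> plant P" for w a
    using that ptree_snocD[OF P] ptree_Nil[OF P] by (cases w) (auto simp: plant_def)
  moreover have "w @ [a] \<in> plant P" if "w @ [b] \<in> plant P" "a < b" for w a b
    using that ptree_sibling[OF P, of _ b a] by (cases w) (force simp: plant_def)+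
  moreover have "[] \<in> plant P" by (simp add: plant_def)
  ultimately show ?thesis unfolding ptree_def by blast
qed

lemma is_tree_plant: "ptree P \<Longrightarrow> is_tree (plant P)"
  using ptree_plant ptree_Nil unfolding is_tree_iff by (auto simp: plant_def)

lemma subt_plant: "subt (plant P) [0] = P"
  by (auto simp: plant_def)

lemma plant_subt: "is_tree T \<Longrightarrow> plant (subt T [0]) = T"
proof -
  assume T: "is_tree T"
  have "w \<in> plant (subt T [0]) \<longleftrightarrow> w \<in> T" for w
  proof (cases w)
    case Nil then show ?thesis using T by (simp add: plant_def is_tree_def)
  next
    case (Cons a v)
    have "a = 0" if "w \<in> T"
      using that Cons ptree_appendD[OF is_tree_ptree[OF T], of "[a]" v] is_tree_root_edge[OF T] by simp
    then show ?thesis using Cons by (auto simp: plant_def)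
  qed
  then show ?thesis by blast
qed

lemma plant_inj: "plant P = plant Q \<Longrightarrow> P = Q"
  by (metis subt_plant)

lemma finite_plant [simp]: "finite (plant P) \<longleftrightarrow> finite P"
  by (auto simp: plant_def finite_image_iff)

lemma edges_plant: "edges (plant P) = card P"
proof (cases "finite P")
  case True
  then have "card (plant P) = Suc (card ((#) 0 ` P))" unfolding plant_def by (subst card_insert_disjoint) auto
  also have "card ((#) 0 ` P) = card P" by (intro card_image) auto
  finally show ?thesis by (simp add: edges_def)
qed (simp add: edges_def)

lemma Bball_plant: "Bball (Suc h) (plant P) = plant (Bball h P)"
  by (auto simp: Bball_def plant_def)

lemma edges_Suc: "finite T \<Longrightarrow> T \<noteq> {} \<Longrightarrow> card T = Suc (edges T)"
  using card_gt_0_iff[of T] by (simp add: edges_def)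

lemma card_Dlev_plant: "card (Dlev (Suc h) (plant P)) = card (Dlev h P)"
proof -
  have "Dlev (Suc h) (plant P) = (#) 0 ` Dlev h P" by (auto simp: Dlev_def plant_def)
  then show ?thesis by (simp add: card_image)
qed

lemma ptreeI:
  assumes "[] \<in> P" "\<And>w a. w @ [a] \<in> P \<Longrightarrow> w \<in> P"
    "\<And>w a b. w @ [b] \<in> P \<Longrightarrow> a < b \<Longrightarrow> w @ [a] \<in> P" "\<And>w. finite {a. w @ [a] \<in> P}"
  shows "ptree P"
  using assms unfolding ptree_def by blast

section \<open>Power series coefficients\<close>

text \<open>\<open>qc a b k\<close> is the coefficient of \<open>x ^ k\<close> in \<open>(1 + x) ^ b / (1 - x) ^ a\<close>.\<close>

fun qc :: "nat \<Rightarrow> nat \<Rightarrow> nat \<Rightarrow> real" where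
  "qc 0 b k = real (b choose k)"
| "qc (Suc a) b k = (\<Sum>i\<le>k. qc a b i)"

lemma qc_nonneg: "qc a b k \<ge> 0"
  by (induction a arbitrary: k) (auto intro: sum_nonneg)

lemma qc_Suc_0: "qc a (Suc b) 0 = qc a b 0"
  by (induction a) auto

text \<open>Multiplication of the series by 1 + x.\<close>

lemma qc_Suc_Suc: "qc a (Suc b) (Suc k) = qc a b (Suc k) + qc a b k"
proof (induction a arbitrary: k)
  case (Suc a)
  have "qc (Suc a) (Suc b) (Suc k) = qc a (Suc b) 0 + (\<Sum>i\<le>k. qc a (Suc b) (Suc i))"
    by (simp only: qc.simps sum.atMost_Suc_shift)
  also have "\<dots> = qc a b 0 + (\<Sum>i\<le>k. qc a b (Suc i)) + (\<Sum>i\<le>k. qc a b i)"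
    by (simp only: Suc qc_Suc_0 sum.distrib add.assoc)
  also have "\<dots> = qc (Suc a) b (Suc k) + qc (Suc a) b k"
    by (simp only: qc.simps sum.atMost_Suc_shift)
  finally show ?case .
qed simp

text \<open>A crude bound, polynomial in \<open>b\<close> for fixed \<open>a\<close> and
  \<open>k\<close>; it only has to lose against 2 ^ c in \<open>qc_decay\<close>.\<close>

lemma qc_le: "qc a b k \<le> real ((b + 1) ^ k * (k + 1) ^ a)"
proof (induction a arbitrary: k)
  case 0
  have "b choose k \<le> (b + 1) ^ k"
  proof (cases "k \<le> b")
    case True
    then have "b choose k \<le> b ^ k" by (rule binomial_le_pow)
    also have "\<dots> \<le> (b + 1) ^ k" by (intro power_mono) auto
    finally show ?thesis .
  qed (simp add: binomial_eq_0)
  then show ?case by (simp flip: of_nat_power add: of_nat_le_iff del: of_nat_add)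
next
  case (Suc a)
  have "qc (Suc a) b k \<le> (\<Sum>i\<le>k. real ((b + 1) ^ k * (k + 1) ^ a))"
    unfolding qc.simps
  proof (rule sum_mono)
    fix i assume "i \<in> {..k}"
    then have "(b + 1) ^ i * (i + 1) ^ a \<le> (b + 1) ^ k * (k + 1) ^ a"
      by (intro mult_mono power_increasing power_mono) auto
    then show "qc a b i \<le> real ((b + 1) ^ k * (k + 1) ^ a)"
      using Suc[of i] of_nat_mono[where 'a=real] order_trans by blast
  qed
  also have "\<dots> = real ((b + 1) ^ k * (k + 1) ^ Suc a)" by (simp add: algebra_simps)
  finally show ?case .
qed

lemma power_times_half_limit: "(\<lambda>n. real n ^ k * (1/2) ^ n) \<longlonglongrightarrow> 0"
proof (cases "k = 0")
  case True
  then show ?thesis using LIMSEQ_realpow_zero[of "1/2"] by simp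
next
  case False
  \<comment> \<open>With x ^ k = 2 the sequence is the \<open>k\<close>-th power of n / x ^ n, a
    known null sequence.\<close>
  define x where "x = root k 2"
  have x: "x > 1" "x ^ k = 2" using False by (auto simp: x_def)
  have "(\<lambda>n. (real n / x ^ n) ^ k) \<longlonglongrightarrow> 0 ^ k"
    using x by (intro tendsto_power lim_n_over_pown) simp
  moreover have "(real n / x ^ n) ^ k = real n ^ k * (1/2) ^ n" for n
    by (simp add: power_divide x(2) flip: power_mult) (simp add: mult.commute[of n k] power_mult x(2))
  ultimately show ?thesis using False by (simp add: zero_power)
qed

lemma qc_decay: "(\<lambda>c. qc a (b + c) k / 2 ^ c) \<longlonglongrightarrow> 0"
proof (rule tendsto_sandwich[where f = "\<lambda>_. 0" and h = "\<lambda>c. real ((k + 1) ^ a) * (real (b + c + 1) ^ k / 2 ^ c)"])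
  show "\<forall>\<^sub>F c in sequentially. qc a (b + c) k / 2 ^ c \<le> real ((k + 1) ^ a) * (real (b + c + 1) ^ k / 2 ^ c)"
    using qc_le[of a "b + c" k for c] by (intro always_eventually) (simp add: field_simps)
  have "(\<lambda>n. real n ^ k * (1/2) ^ n) \<longlonglongrightarrow> 0"
    by (rule power_times_half_limit)
  then have "(\<lambda>c. real (c + (b + 1)) ^ k * (1/2) ^ (c + (b + 1))) \<longlonglongrightarrow> 0"
    by (rule LIMSEQ_ignore_initial_segment)
  then have "(\<lambda>c. real ((k + 1) ^ a) * 2 ^ (b + 1) * (real (c + (b + 1)) ^ k * (1/2) ^ (c + (b + 1)))) \<longlonglongrightarrow> 0"
    by (rule tendsto_mult_right_zero)
  then show "(\<lambda>c. real ((k + 1) ^ a) * (real (b + c + 1) ^ k / 2 ^ c)) \<longlonglongrightarrow> 0"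
    by (simp add: power_add power_divide field_simps)
qed (simp_all add: qc_nonneg)

text \<open>Coefficientwise form of the geometric series: the powers ((1 + x) / 2) ^ c sum to 2 / (1
  - x).\<close>

lemma qc_sums: "(\<lambda>c. qc a (b + c) k / 2 ^ c) sums (2 * qc (Suc a) b k)"
proof -
  \<comment> \<open>The negative remainder of the geometric series. Passing from c to c + 1
    multiplies by (1 + x) / 2, so the difference carries the factor 1 - (1 + x) / 2 = (1 - x) / 2,
    which cancels one denominator and the 2.\<close>
  define f where "f c = - (2 * (qc (Suc a) (b + c) k / 2 ^ c))" for c
  have "f \<longlonglongrightarrow> 0"
    unfolding f_def using tendsto_minus[OF tendsto_mult_right_zero[OF qc_decay[of "Suc a" b k]]] by simp
  then have "(\<lambda>c. f (Suc c) - f c) sums (0 - f 0)" by (rule telescope_sums)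
  moreover have "f (Suc c) - f c = qc a (b + c) k / 2 ^ c" for c
    unfolding f_def
    by (cases k) (simp_all add: qc_Suc_0 qc_Suc_Suc field_simps del: qc.simps(2), simp_all add: field_simps)
  ultimately show ?thesis by (simp add: f_def)
qed

lemma qc_zero_right: "qc (Suc a) 0 k = real ((a + k) choose k)"
proof (induction a arbitrary: k)
  case 0
  have "(\<Sum>i\<le>k. real (0 choose i)) = (\<Sum>i\<le>k. if i = 0 then 1 else 0)"
    by (intro sum.cong) auto
  then show ?case by simp
next
  case (Suc a)
  have "qc (Suc (Suc a)) 0 k = (\<Sum>i\<le>k. real ((a + i) choose i))"
    by (subst qc.simps(2)) (intro sum.cong refl Suc)
  also have "\<dots> = real (Suc (a + k) choose k)"
    by (simp only: sum_choose_lower flip: of_nat_sum)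
  finally show ?case by simp
qed

text \<open>The coefficient is (L + n choose n + 1). It is expanded in the polynomials (n choose j)
  because these have explicit sums against \<nu> ^ n / n!, see
  \<open>choose_exp_sums\<close>.\<close>

lemma qc_vandermonde: "qc L 0 (Suc n) = (\<Sum>j<L. real (L choose Suc j) * real (n choose j))"
proof (cases L)
  case (Suc a)
  have "qc L 0 (Suc n) = real ((L + n) choose Suc n)" using Suc by (simp only: qc_zero_right) simp
  also have "(L + n) choose Suc n = (\<Sum>k\<le>Suc n. (L choose k) * (n choose (Suc n - k)))"
    by (rule vandermonde[symmetric])
  also have "\<dots> = (\<Sum>j\<le>n. (L choose Suc j) * (n choose (n - j)))"
    by (simp add: sum.atMost_Suc_shift binomial_eq_0 del: sum.atMost_Suc)
  also have "\<dots> = (\<Sum>j\<le>n. (L choose Suc j) * (n choose j))"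
    by (intro sum.cong) (auto simp: binomial_symmetric[symmetric])
  also have "\<dots> = (\<Sum>j\<in>{..n} \<union> {..<L}. (L choose Suc j) * (n choose j))"
    by (intro sum.mono_neutral_left) (auto simp: binomial_eq_0)
  also have "\<dots> = (\<Sum>j<L. (L choose Suc j) * (n choose j))"
    by (intro sum.mono_neutral_right) (auto simp: binomial_eq_0)
  finally show ?thesis by simp
qed simp

text \<open>The value at \<open>k = 0\<close> is set to 0, so that the sums over \<open>k \<ge> 1\<close> in the ball formula can run over all \<open>k\<close>.\<close>

definition pw :: "real \<Rightarrow> nat \<Rightarrow> real" where
  "pw \<nu> k = (if k = 0 then 0 else \<nu> ^ (k - 1) / fact (k - 1))"

lemma pw_0 [simp]: "pw \<nu> 0 = 0" by (simp add: pw_def)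

lemma pw_Suc [simp]: "pw \<nu> (Suc k) = \<nu> ^ k / fact k" by (simp add: pw_def)

lemma pw_nonneg: "\<nu> \<ge> 0 \<Longrightarrow> pw \<nu> k \<ge> 0" by (simp add: pw_def)

lemma choose_exp_sums: "(\<lambda>n. real (n choose j) * (\<nu> ^ n / fact n)) sums (\<nu> ^ j / fact j * exp \<nu>)" for \<nu> :: real
proof -
  have "(\<lambda>i. \<nu> ^ j / fact j * (\<nu> ^ i / fact i)) sums (\<nu> ^ j / fact j * exp \<nu>)"
    using exp_converges[of \<nu>] by (intro sums_mult) (simp add: field_simps)
  moreover have "\<nu> ^ j / fact j * (\<nu> ^ i / fact i) = real ((i + j) choose j) * (\<nu> ^ (i + j) / fact (i + j))" for i
    by (subst binomial_fact) (simp_all add: power_add)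
  ultimately have "(\<lambda>i. real ((i + j) choose j) * (\<nu> ^ (i + j) / fact (i + j))) sums (\<nu> ^ j / fact j * exp \<nu>)"
    by (simp only:)
  then show ?thesis by (subst (asm) sums_zero_iff_shift) auto
qed

text \<open>With \<open>pw \<nu> k\<close> in place of x ^ k, the series (1 - x) ^ (- L) becomes exp
  \<nu> times (1 + x) ^ L. This makes the ball formula consistent from one height to the
  next.\<close>

lemma qc_pw_sums: "(\<lambda>k. qc L 0 k * pw \<nu> k) sums (exp \<nu> * (\<Sum>k\<le>L. real (L choose k) * pw \<nu> k))"
proof -
  have "(\<lambda>n. \<Sum>j<L. real (L choose Suc j) * (real (n choose j) * (\<nu> ^ n / fact n)))
      sums (\<Sum>j<L. real (L choose Suc j) * (\<nu> ^ j / fact j * exp \<nu>))"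
    by (intro sums_sum sums_mult choose_exp_sums)
  moreover have "(\<Sum>j<L. real (L choose Suc j) * (real (n choose j) * (\<nu> ^ n / fact n))) = qc L 0 (n + 1) * pw \<nu> (n + 1)" for n
    by (simp add: qc_vandermonde sum_distrib_right sum_divide_distrib mult.assoc)
  moreover have "(\<Sum>j<L. real (L choose Suc j) * (\<nu> ^ j / fact j * exp \<nu>)) = exp \<nu> * (\<Sum>k\<le>L. real (L choose k) * pw \<nu> k)"
    by (simp add: sum.lessThan_Suc_shift sum_distrib_left mult_ac del: sum.lessThan_Suc flip: lessThan_Suc_atMost)
  ultimately have "(\<lambda>n. qc L 0 (n + 1) * pw \<nu> (n + 1)) sums (exp \<nu> * (\<Sum>k\<le>L. real (L choose k) * pw \<nu> k))"
    by (simp only:)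
  then show ?thesis by (subst (asm) sums_zero_iff_shift) auto
qed

lemma suminf_ennreal_swap:
  fixes f :: "nat \<Rightarrow> nat \<Rightarrow> ennreal"
  shows "(\<Sum>i. \<Sum>j. f i j) = (\<Sum>j. \<Sum>i. f i j)"
  using nn_integral_suminf[of "\<lambda>j i. f i j" "count_space UNIV"]
  by (simp add: nn_integral_count_space_nat)

text \<open>The sums over the number of children and over the power of x are exchanged in the
  extended nonnegative reals, where no convergence argument is needed.\<close>

lemma qc_ennreal_sum:
  assumes p: "\<And>k. p k \<ge> 0"
  shows "(\<Sum>c. ennreal ((1/2) ^ c) * (\<Sum>k. ennreal (qc a (b + c) k * p k)))
       = 2 * (\<Sum>k. ennreal (qc (Suc a) b k * p k))"
proof -
  have "(\<Sum>c. ennreal ((1/2) ^ c) * (\<Sum>k. ennreal (qc a (b + c) k * p k)))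
      = (\<Sum>c. \<Sum>k. ennreal (p k) * ennreal (qc a (b + c) k / 2 ^ c))"
    unfolding ennreal_suminf_cmult[symmetric]
    by (intro suminf_cong) (simp add: p qc_nonneg power_divide mult_ac flip: ennreal_mult)
  also have "\<dots> = (\<Sum>k. \<Sum>c. ennreal (p k) * ennreal (qc a (b + c) k / 2 ^ c))"
    by (rule suminf_ennreal_swap)
  also have "\<dots> = (\<Sum>k. ennreal (p k) * ennreal (2 * qc (Suc a) b k))"
    unfolding ennreal_suminf_cmult
    by (intro suminf_cong arg_cong2[where f = "(*)"] refl suminf_ennreal_eq qc_sums) (simp add: qc_nonneg)
  also have "\<dots> = (\<Sum>k. 2 * ennreal (qc (Suc a) b k * p k))"
    by (intro suminf_cong) (simp add: p qc_nonneg ennreal_mult mult_ac del: qc.simps)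
  finally show ?thesis by (simp only: ennreal_suminf_cmult)
qed

section \<open>Total mass of the critical geometric tree law\<close>

lemma finite_imp_finite_children:
  assumes "finite P" shows "finite {a. w @ [a] \<in> P}"
proof (rule finite_surj[OF assms])
  show "{a. w @ [a] \<in> P} \<subseteq> last ` P"
  proof
    fix a assume "a \<in> {a. w @ [a] \<in> P}"
    then have "last (w @ [a]) \<in> last ` P" by blast
    then show "a \<in> last ` P" by simp
  qed
qed

definition fptrees :: "nat list set set" where
  "fptrees = {g. ptree g \<and> finite g}"

text \<open>The rotation correspondence: a plane tree with at least one edge is given by the subtree
  at the first child of the root and the tree that is left after removing it.\<close>

definition rot :: "nat list set \<Rightarrow> nat list set \<Rightarrow> nat list set" where
  "rot h g = insert [] ((#) 0 ` h \<union> {Suc a # w | a w. a # w \<in> g})"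

lemma rot_mem: "[] \<in> rot h g" "0 # w \<in> rot h g \<longleftrightarrow> w \<in> h" "Suc a # w \<in> rot h g \<longleftrightarrow> a # w \<in> g"
  by (auto simp: rot_def)

lemma ptree_rot:
  assumes h: "ptree h" and g: "ptree g" shows "ptree (rot h g)"
proof -
  have 1: "w \<in> rot h g" if "w @ [a] \<in> rot h g" for w a
  proof (cases w)
    case (Cons b v)
    then show ?thesis using that ptree_snocD[OF h, of v a] ptree_snocD[OF g, of "(b - 1) # v" a]
      by (cases b) (auto simp: rot_mem)
  qed (simp add: rot_mem)
  have 2: "w @ [a] \<in> rot h g" if "w @ [b] \<in> rot h g" "a < b" for w a b
  proof (cases w)
    case Nil
    have "b = Suc (b - 1)" using \<open>a < b\<close> by simp
    then obtain b' where "b = Suc b'" by blast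
    then show ?thesis using that Nil ptree_sibling[OF g, of "[]" b' "a - 1"] ptree_Nil[OF h]
      by (cases a) (auto simp: rot_mem)
  next
    case (Cons c v)
    then show ?thesis using that ptree_sibling[OF h, of v b a] ptree_sibling[OF g, of "(c - 1) # v" b a]
      by (cases c) (auto simp: rot_mem)
  qed
  have 3: "finite {a. w @ [a] \<in> rot h g}" for w
  proof (cases w)
    case Nil
    have "{a. w @ [a] \<in> rot h g} \<subseteq> insert 0 (Suc ` {a. [] @ [a] \<in> g})"
    proof
      fix a assume "a \<in> {a. w @ [a] \<in> rot h g}"
      then show "a \<in> insert 0 (Suc ` {a. [] @ [a] \<in> g})" using Nil by (cases a) (auto simp: rot_mem)
    qed
    then show ?thesis using ptree_finite_children[OF g, of "[]"] by (meson finite_imageI finite_insert finite_subset)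
  next
    case (Cons c v)
    then show ?thesis using ptree_finite_children[OF h, of v] ptree_finite_children[OF g, of "(c - 1) # v"]
      by (cases c) (auto simp: rot_mem)
  qed
  show ?thesis by (rule ptreeI[OF rot_mem(1) 1 2 3])
qed

lemma rot_eq: "[] \<in> g \<Longrightarrow> rot h g = insert [] ((#) 0 ` h) \<union> (\<lambda>w. Suc (hd w) # tl w) ` (g - {[]})"
  unfolding rot_def by (force simp: image_iff neq_Nil_conv)

lemma finite_rot: "ptree g \<Longrightarrow> finite h \<Longrightarrow> finite g \<Longrightarrow> finite (rot h g)"
  by (simp add: rot_eq ptree_Nil)

lemma card_rot:
  assumes "ptree g" "finite h" "finite g" shows "card (rot h g) = card h + card g"
proof -
  have g: "[] \<in> g" using assms ptree_Nil by blast
  have "card (rot h g) = card (insert [] ((#) 0 ` h)) + card ((\<lambda>w. Suc (hd w) # tl w) ` (g - {[]}))"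
    unfolding rot_eq[OF g] by (rule card_Un_disjoint) (use assms in auto)
  also have "card (insert [] ((#) 0 ` h)) = Suc (card h)"
    using assms by (subst card_insert_disjoint) (auto simp: card_image)
  also have "card ((\<lambda>w. Suc (hd w) # tl w) ` (g - {[]})) = card (g - {[]})"
    by (intro card_image) (auto simp: inj_on_def list.expand)
  also have "\<dots> = card g - 1" using g assms by simp
  finally show ?thesis using g assms card_gt_0_iff[of g] by auto
qed

lemma rot_bij: "bij_betw (\<lambda>(h, g). rot h g) (fptrees \<times> fptrees) (fptrees - {{[]}})"
proof (rule bij_betwI[where g = "\<lambda>k. (subt k [0], insert [] {a # w | a w. Suc a # w \<in> k})"])
  show "(\<lambda>(h, g). rot h g) \<in> fptrees \<times> fptrees \<rightarrow> fptrees - {{[]}}"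
  proof -
    have "rot h g \<noteq> {[]}" if "ptree h" for h g
      using rot_mem(2)[of "[]" h g] ptree_Nil[OF that] by auto
    then show ?thesis by (auto simp: fptrees_def ptree_rot finite_rot)
  qed
  show "(\<lambda>k. (subt k [0], insert [] {a # w | a w. Suc a # w \<in> k})) \<in> fptrees - {{[]}} \<rightarrow> fptrees \<times> fptrees"
  proof
    fix k assume k: "k \<in> fptrees - {{[]}}"
    then have pk: "ptree k" and fk: "finite k" and nk: "k \<noteq> {[]}" by (auto simp: fptrees_def)
    obtain a w where "a # w \<in> k" using nk ptree_Nil[OF pk] by (metis insertI1 is_singletonI' is_singleton_the_elem neq_Nil_conv singletonD subset_singletonD subsetI insert_absorb insert_subset)
    then have "[a] \<in> k" using ptree_appendD[OF pk, of "[a]" w] by simp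
    then have k0: "[0] \<in> k" using ptree_sibling[OF pk, of "[]" a 0] by simp
    let ?g = "insert [] {a # w | a w. Suc a # w \<in> k}"
    have gm: "[] \<in> ?g" "a # w \<in> ?g \<longleftrightarrow> Suc a # w \<in> k" for a w by auto
    have "finite (subt k [0])"
    proof -
      have "subt k [0] \<subseteq> tl ` k" by (auto intro!: image_eqI[where f = tl and x = "0 # _"])
      then show ?thesis using fk by (meson finite_imageI finite_subset)
    qed
    moreover have "finite ?g"
    proof -
      have "?g \<subseteq> insert [] ((\<lambda>w. (hd w - 1) # tl w) ` k)" by (force simp: image_iff)
      then show ?thesis using fk by (meson finite_imageI finite_insert finite_subset)
    qed
    moreover have "ptree ?g"
    proof -
      have 1: "w \<in> ?g" if "w @ [a] \<in> ?g" for w a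
      proof (cases w)
        case (Cons b v)
        then show ?thesis using that ptree_snocD[OF pk, of "Suc b # v" a] by (simp add: gm)
      qed simp
      have 2: "w @ [a] \<in> ?g" if "w @ [b] \<in> ?g" "a < b" for w a b
      proof (cases w)
        case Nil then show ?thesis using that ptree_sibling[OF pk, of "[]" "Suc b" "Suc a"] by (simp add: gm)
      next
        case (Cons c v)
        then show ?thesis using that ptree_sibling[OF pk, of "Suc c # v" b a] by (simp add: gm)
      qed
      have 3: "finite {a. w @ [a] \<in> ?g}" for w
        using \<open>finite ?g\<close> by (rule finite_imp_finite_children)
      show ?thesis by (rule ptreeI[OF gm(1) 1 2 3])
    qed
    moreover have "ptree (subt k [0])" using ptree_subt[OF pk k0] .
    ultimately show "(subt k [0], ?g) \<in> fptrees \<times> fptrees" unfolding fptrees_def by blast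
  qed
  show "(case (case x of (h, g) \<Rightarrow> rot h g) of k \<Rightarrow> (subt k [0], insert [] {a # w | a w. Suc a # w \<in> k})) = x"
    if "x \<in> fptrees \<times> fptrees" for x
  proof -
    obtain h g where x: "x = (h, g)" "ptree g" using \<open>x \<in> fptrees \<times> fptrees\<close> by (auto simp: fptrees_def)
    have "w \<in> insert [] {a # w | a w. Suc a # w \<in> rot h g} \<longleftrightarrow> w \<in> g" for w
      using ptree_Nil[OF x(2)] by (cases w) (auto simp: rot_mem)
    moreover have "subt (rot h g) [0] = h" by (auto simp: rot_mem)
    ultimately show ?thesis using x by auto
  qed
  show "(case (subt k [0], insert [] {a # w | a w. Suc a # w \<in> k}) of (h, g) \<Rightarrow> rot h g) = k"
    if "k \<in> fptrees - {{[]}}" for k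
  proof -
    have "w \<in> rot (subt k [0]) (insert [] {a # w | a w. Suc a # w \<in> k}) \<longleftrightarrow> w \<in> k" for w
    proof (cases w)
      case Nil then show ?thesis using that ptree_Nil by (auto simp: rot_mem fptrees_def)
    next
      case (Cons a v) then show ?thesis by (cases a) (auto simp: rot_mem)
    qed
    then show ?thesis by auto
  qed
qed

lemma nn_integral_fptrees:
  "(\<integral>\<^sup>+g. v g \<partial>count_space fptrees)
    = v {[]} + (\<integral>\<^sup>+h. (\<integral>\<^sup>+g. v (rot h g) \<partial>count_space fptrees) \<partial>count_space fptrees)"
proof -
  have 1: "{[]} \<in> fptrees" by (auto simp: fptrees_def ptree_def)
  then have F: "fptrees = {{[]}} \<union> (fptrees - {{[]}})" by blast
  have "(\<integral>\<^sup>+g. v g \<partial>count_space fptrees)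
      = (\<integral>\<^sup>+g. v g \<partial>count_space {{[]}}) + (\<integral>\<^sup>+g. v g \<partial>count_space (fptrees - {{[]}}))"
    by (subst F, subst (1 2 3) nn_integral_count_space_indicator, simp, simp, simp)
       (subst nn_integral_add[symmetric], auto intro!: nn_integral_cong simp: indicator_def)
  also have "(\<integral>\<^sup>+g. v g \<partial>count_space {{[]}}) = v {[]}" by (simp add: nn_integral_count_space_finite)
  also have "(\<integral>\<^sup>+g. v g \<partial>count_space (fptrees - {{[]}}))
      = (\<integral>\<^sup>+x. v (case x of (h, g) \<Rightarrow> rot h g) \<partial>count_space (fptrees \<times> fptrees))"
    by (rule nn_integral_bij_count_space[OF rot_bij, symmetric])
  also have "\<dots> = (\<integral>\<^sup>+x. v (case x of (h, g) \<Rightarrow> rot h g) * indicator (fptrees \<times> fptrees) x \<partial>count_space UNIV)"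
    by (simp add: nn_integral_count_space_indicator)
  also have "\<dots> = (\<integral>\<^sup>+h. \<integral>\<^sup>+g. v (rot h g) * indicator (fptrees \<times> fptrees) (h, g) \<partial>count_space UNIV \<partial>count_space UNIV)"
    by (subst nn_integral_fst_count_space[symmetric]) simp
  also have "\<dots> = (\<integral>\<^sup>+h. (\<integral>\<^sup>+g. v (rot h g) * indicator fptrees g \<partial>count_space UNIV) * indicator fptrees h \<partial>count_space UNIV)"
    by (intro nn_integral_cong) (auto simp: indicator_def)
  finally show ?thesis by (simp add: nn_integral_count_space_indicator)
qed

text \<open>Rotation gives y = 1/4 + y^2 for the total mass y, an equation that an infinite y
  satisfies as well. Truncation by size excludes this, because the bound 1/2 reproduces itself: 1/4
  + (1/2)^2 = 1/2.\<close>

lemma catalan_truncated: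
  "(\<integral>\<^sup>+g. ennreal ((1/4) ^ card g) * indicator {g. card g \<le> n} g \<partial>count_space fptrees) \<le> ennreal (1/2)"
proof (induction n)
  case 0
  have "ennreal ((1/4) ^ card g) * indicator {g. card g \<le> 0} g = 0" if "g \<in> fptrees" for g
    using that ptree_Nil by (auto simp: fptrees_def indicator_def card_gt_0_iff)
  then have "(\<integral>\<^sup>+g. ennreal ((1/4) ^ card g) * indicator {g. card g \<le> 0} g \<partial>count_space fptrees)
      = (\<integral>\<^sup>+g. 0 \<partial>count_space fptrees)"
    by (intro nn_integral_cong) (simp del: le_zero_eq)
  then show ?case by simp
next
  case (Suc n)
  let ?w = "\<lambda>n (g :: nat list set). ennreal ((1/4) ^ card g) * indicator {g. card g \<le> n} g"
  let ?Y = "\<lambda>n. \<integral>\<^sup>+g. ?w n g \<partial>count_space fptrees"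
  \<comment> \<open>Both parts have at least one vertex, so the bound \<open>Suc n\<close> on the
    whole bounds each part by \<open>n\<close>.\<close>
  have le: "?w (Suc n) (rot h g) \<le> ?w n h * ?w n g" if hg: "h \<in> fptrees" "g \<in> fptrees" for h g
  proof -
    have "card (rot h g) = card h + card g" "card h \<ge> 1" "card g \<ge> 1"
      using hg ptree_Nil card_rot by (auto simp: fptrees_def Suc_le_eq card_gt_0_iff)
    then show ?thesis
      by (auto simp: indicator_def power_add ennreal_mult)
  qed
  have "?Y (Suc n) \<le> ?w (Suc n) {[]} + (\<integral>\<^sup>+h. (\<integral>\<^sup>+g. ?w n h * ?w n g \<partial>count_space fptrees) \<partial>count_space fptrees)"
    by (subst nn_integral_fptrees) (intro add_mono order_refl nn_integral_mono, use le in auto)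
  also have "\<dots> = ennreal (1/4) + ?Y n * ?Y n"
    by (simp add: nn_integral_cmult nn_integral_multc)
  also have "\<dots> \<le> ennreal (1/4) + ennreal (1/2) * ennreal (1/2)"
    by (intro add_mono mult_mono Suc order_refl) auto
  also have "\<dots> = ennreal (1/4 + 1/2 * (1/2))"
    using ennreal_plus[of "1/4" "1/2 * (1/2)"] ennreal_mult[of "1/2" "1/2"] by (simp only: refl)
  also have "\<dots> = ennreal (1/2)" by (rule arg_cong[where f = ennreal]) simp
  finally show ?case .
qed

lemma catalan_sum: "(\<integral>\<^sup>+g. ennreal ((1/4) ^ card g) \<partial>count_space fptrees) = ennreal (1/2)"
proof -
  let ?w = "\<lambda>n (g :: nat list set). ennreal ((1/4) ^ card g) * indicator {g. card g \<le> n} g"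
  let ?y = "\<integral>\<^sup>+(g :: nat list set). ennreal ((1/4) ^ card g) \<partial>count_space fptrees"
  have sup: "(SUP n. ?w n g) = ennreal ((1/4) ^ card g)" for g :: "nat list set"
    by (rule antisym) (auto intro!: SUP_least SUP_upper2[of "card g"] simp: indicator_def)
  have inc: "incseq (\<lambda>n g. ?w n g)"
    by (auto simp: incseq_def le_fun_def indicator_def)
  have "?y = (\<integral>\<^sup>+g. (SUP n. ?w n g) \<partial>count_space fptrees)" by (simp add: sup)
  also have "\<dots> = (SUP n. \<integral>\<^sup>+g. ?w n g \<partial>count_space fptrees)"
    by (rule nn_integral_monotone_convergence_SUP[OF inc]) simp
  also have "\<dots> \<le> ennreal (1/2)" by (intro SUP_least catalan_truncated)
  finally have le: "?y \<le> ennreal (1/2)" .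
  then obtain x where x: "?y = ennreal x" "x \<ge> 0" "x \<le> 1/2"
  proof (cases ?y rule: ennreal_cases)
    case (real x)
    then have "ennreal x \<le> ennreal (1/2)" using le by (simp only:)
    then have "x \<le> 1/2" by (subst (asm) ennreal_le_iff) auto
    then show ?thesis using real that by blast
  next
    case top
    then have "top \<le> ennreal (1/2)" using le by (simp only:)
    then show ?thesis using ennreal_neq_top top_unique by blast
  qed
  have "?y = ennreal (1/4) + (\<integral>\<^sup>+h. (\<integral>\<^sup>+g. ennreal ((1/4) ^ card h) * ennreal ((1/4) ^ card g) \<partial>count_space fptrees) \<partial>count_space fptrees)"
    by (subst nn_integral_fptrees, intro arg_cong2[where f = "(+)"] nn_integral_cong)
       (auto simp: fptrees_def card_rot power_add ennreal_mult)
  also have "\<dots> = ennreal (1/4) + ?y * ?y"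
    by (simp add: nn_integral_cmult nn_integral_multc)
  finally have "ennreal x = ennreal (1/4 + x * x)"
    using x by (simp add: ennreal_mult ennreal_plus)
  then have "x = 1/4 + x * x" using x by (simp add: ennreal_inj del: ennreal_plus)
  \<comment> \<open>The quadratic has a double root, so no choice between two solutions
    arises.\<close>
  then have "(x - 1/2)\<^sup>2 = 0" by (simp add: power2_eq_square algebra_simps)
  then have "x = 1/2" by simp
  then show ?thesis using x(1) by (simp only:)
qed

section \<open>The law of the ball and of its continuation\<close>

text \<open>Grafting \<open>star c\<close> at an end records only that the end has \<open>c\<close>
  children, which become new ends.\<close>

definition star :: "nat \<Rightarrow> nat list set" where
  "star c = insert [] ((\<lambda>a. [a]) ` {..<c})"

lemma star_mem: "[] \<in> star c" "[a] \<in> star c \<longleftrightarrow> a < c" "w @ [a] \<in> star c \<longleftrightarrow> w = [] \<and> a < c"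
  by (auto simp: star_def)

lemma finite_star [simp]: "finite (star c)"
  by (simp add: star_def)

lemma card_star: "card (star c) = Suc c"
  unfolding star_def by (subst card_insert_disjoint) (auto simp: card_image inj_on_def)

lemma ptree_star: "ptree (star c)"
  by (rule ptreeI) (auto simp: star_mem finite_imp_finite_children)

lemma star_length: "w \<in> star c \<Longrightarrow> length w \<le> 1"
  by (auto simp: star_def)

lemma Dlev_star: "Dlev 1 (star c) = {[a] | a. a < c}"
  by (auto simp: star_def Dlev_def)

lemma ptree_Bball_1: "ptree P \<Longrightarrow> Bball 1 P = star (nch P [])"
proof -
  assume P: "ptree P"
  have "w \<in> Bball 1 P \<longleftrightarrow> w \<in> star (nch P [])" for w
  proof (cases w)
    case (Cons a v)
    then show ?thesis using ptree_child_iff[OF P, of "[]" a] by (cases v) (auto simp: Bball_def star_def)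
  qed (simp add: Bball_def star_def ptree_Nil[OF P])
  then show ?thesis by blast
qed

lemma nch_star: "nch (star c) [] = c"
  by (simp add: nch_def star_mem)

lemma pext_star: "pext (star c) {[a] | a. a < c} = {P. ptree P \<and> nch P [] = c}"
proof -
  have "Bball 1 P = star c \<longleftrightarrow> nch P [] = c" if "ptree P" for P
    unfolding ptree_Bball_1[OF that] using nch_star by metis
  then show ?thesis
    using pext_Dlev[OF ptree_star star_length, of c] unfolding Dlev_star by auto
qed

lemma pext_split_star:
  assumes S: "ptree S" and U: "U \<subseteq> ends S" and x: "x \<in> U"
  shows "pext (graft S {x} (\<lambda>_. star c)) ((U - {x}) \<union> (\<lambda>a. x @ [a]) ` {..<c})
    = {T \<in> pext S U. nch (subt T x) [] = c}"
proof -
  have eq: "{y @ v | y v. y \<in> {x} \<and> v \<in> {[a] | a. a < c}} = (\<lambda>a. x @ [a]) ` {..<c}" by auto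
  have "ptree (subt T x)" if "T \<in> pext S U" for T
    by (rule ptree_subt[OF pextD(1)[OF that]]) (use pextD(2)[OF that] x U ends_subset in blast)
  then show ?thesis
    using pext_graft[OF S _ U, of "{x}" "\<lambda>_. star c" "\<lambda>_. {[a] | a. a < c}"] x ptree_star
    unfolding eq by (auto simp: pext_star)
qed

lemma pext_split_finite:
  assumes S: "ptree S" and U: "U \<subseteq> ends S" and x: "x \<in> U" and g: "ptree g"
  shows "pext (graft S {x} (\<lambda>_. g)) (U - {x}) = {T \<in> pext S U. subt T x = g}"
  using pext_graft[OF S _ U, of "{x}" "\<lambda>_. g" "\<lambda>_. {}"] x g by (simp add: pext_empty)

lemma edges_graft1:
  assumes S: "is_tree S" "finite S" and x: "x \<in> ends S" and g: "ptree g" "finite g"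
  shows "edges (graft S {x} (\<lambda>_. g)) + 1 = edges S + card g"
proof -
  have "card (graft S {x} (\<lambda>_. g)) + 1 = card S + card g"
    using card_graft[OF is_tree_ptree[OF S(1)], of "{x}" "\<lambda>_. g"] x g S(2) by simp
  moreover have "card g > 0" "card S > 0" using S g ptree_Nil is_tree_ptree card_gt_0_iff by blast+
  ultimately show ?thesis by (simp add: edges_def)
qed

text \<open>The image of x ^ b (1 + x) ^ a when x ^ k is replaced by \<open>pw \<nu> k\<close>;
  \<open>gs \<nu> L 0\<close> is the sum in the ball formula.\<close>

definition gs :: "real \<Rightarrow> nat \<Rightarrow> nat \<Rightarrow> real" where
  "gs \<nu> a b = (\<Sum>k\<le>a. real (a choose k) * pw \<nu> (k + b))"

lemma gs_0: "gs \<nu> 0 b = pw \<nu> b"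
  by (simp add: gs_def)

text \<open>One factor 1 + x is split into 1 and x, by Pascal's rule.\<close>

lemma gs_Suc: "gs \<nu> (Suc a) b = gs \<nu> a b + gs \<nu> a (Suc b)"
proof -
  have "gs \<nu> (Suc a) b = pw \<nu> b + (\<Sum>k\<le>a. real (Suc a choose Suc k) * pw \<nu> (Suc k + b))"
    by (simp add: gs_def sum.atMost_Suc_shift del: sum.atMost_Suc)
  also have "\<dots> = pw \<nu> b + (\<Sum>k\<le>a. real (a choose Suc k) * pw \<nu> (Suc k + b)) + gs \<nu> a (Suc b)"
    by (simp add: gs_def sum.distrib algebra_simps add_divide_distrib)
  also have "pw \<nu> b + (\<Sum>k\<le>a. real (a choose Suc k) * pw \<nu> (Suc k + b))
      = (\<Sum>k\<le>Suc a. real (a choose k) * pw \<nu> (k + b))"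
    by (simp add: sum.atMost_Suc_shift del: sum.atMost_Suc)
  also have "\<dots> = gs \<nu> a b" by (simp add: gs_def binomial_eq_0)
  finally show ?thesis .
qed

lemma gs_nonneg: "\<nu> \<ge> 0 \<Longrightarrow> gs \<nu> a b \<ge> 0"
  unfolding gs_def by (intro sum_nonneg mult_nonneg_nonneg pw_nonneg) auto

lemma gs_ball: "(\<Sum>R'=1..L. real (L choose R') * \<nu> ^ (R' - 1) / fact (R' - 1)) = gs \<nu> L 0"
  unfolding gs_def by (rule sum.mono_neutral_cong_left) (auto simp: pw_def)

lemma exp_shift: "exp (- (\<nu> * (real s - 1))) = exp (- (\<nu> * real s)) * exp \<nu>"
  by (simp add: algebra_simps flip: exp_add)

lemma height_eqI:
  assumes "finite S" "\<And>w. w \<in> S \<Longrightarrow> length w \<le> h" "u \<in> S" "length u = h"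
  shows "height S = h"
  unfolding height_def by (rule Max_eqI) (use assms in auto)

lemma length_le_height: "finite S \<Longrightarrow> w \<in> S \<Longrightarrow> length w \<le> height S"
  unfolding height_def by simp

lemma height_pos: "is_tree S \<Longrightarrow> finite S \<Longrightarrow> height S \<ge> 1"
  using length_le_height[of S "[0]"] by (simp add: is_tree_root_edge)

text \<open>For sets of vertex words this expresses infinitude by quantifiers over countable types,
  so that its measurability follows from that of membership.\<close>

lemma infinite_iff_lists: "infinite A \<longleftrightarrow> (\<forall>xs :: 'a list. \<exists>w. w \<notin> set xs \<and> w \<in> A)"
proof
  assume "infinite A"
  show "\<forall>xs. \<exists>w. w \<notin> set xs \<and> w \<in> A"
  proof
    fix xs :: "'a list"
    have "\<not> A \<subseteq> set xs" using \<open>infinite A\<close> finite_subset[OF _ List.finite_set] by metis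
    then show "\<exists>w. w \<notin> set xs \<and> w \<in> A" by blast
  qed
next
  assume *: "\<forall>xs. \<exists>w. w \<notin> set xs \<and> w \<in> A"
  show "infinite A"
  proof
    assume "finite A"
    then obtain xs where "set xs = A" using finite_list by blast
    then show False using * by blast
  qed
qed

section \<open>A single law given by the ball formula\<close>

locale nu_law = prob_space M for M :: "tree measure" +
  fixes \<nu> :: real
  assumes nu_pos: "\<nu> > 0" and sets_M: "sets M = sets tree_space"
    and ball_prob: "\<And>S. is_tree S \<Longrightarrow> finite S \<Longrightarrow> measure M (tball (height S) S)
      = exp (- \<nu> * (real (height S) - 1)) * (1/4) ^ edges S * 2 ^ (card (Dlev (height S) S) + 1)
        * gs \<nu> (card (Dlev (height S) S)) 0"
begin

lemma space_M: "space M = trees"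
  using sets_eq_imp_space_eq[OF sets_M] unfolding tree_space_def
  by (subst (asm) space_measure_of) (auto simp: tball_def)

lemma tball_sets [measurable]: "tball s S \<in> sets M"
proof -
  have "range (\<lambda>(s, S). tball s S) \<subseteq> Pow trees" by (auto simp: tball_def)
  moreover have "tball s S \<in> range (\<lambda>(s, S). tball s S)" by (auto intro: image_eqI[of _ _ "(s, S)"])
  ultimately show ?thesis unfolding sets_M tree_space_def
    by (subst sets_measure_of) (auto intro: sigma_sets.Basic)
qed

text \<open>Whether \<open>w\<close> belongs to a tree is decided by the ball of radius
  \<open>length w\<close>, and there are only countably many finite sets of words.\<close>

lemma measurable_mem [measurable]: "Measurable.pred M (\<lambda>T. w \<in> T)"
proof -
  have "{T \<in> trees. w \<in> T} = (\<Union>S\<in>{S. finite S \<and> w \<in> S}. tball (length w) S)"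
    using ptree_Bball_finite is_tree_ptree by (fastforce simp: tball_def trees_def Bball_def)
  moreover have "countable {S :: tree. finite S \<and> w \<in> S}"
    by (rule countable_subset[OF _ countable_Collect_finite]) auto
  then have "(\<Union>S\<in>{S. finite S \<and> w \<in> S}. tball (length w) S) \<in> sets M"
    by (rule sets.countable_UN') (use tball_sets in blast)
  ultimately show ?thesis unfolding pred_def space_M by (simp only:)
qed

lemma measurable_infinite_subt [measurable]: "Measurable.pred M (\<lambda>T. infinite (subt T u))"
  unfolding infinite_iff_lists by simp

lemma measurable_finite_subt [measurable]: "Measurable.pred M (\<lambda>T. finite (subt T u))"
  using pred_intros_logic(2)[OF measurable_infinite_subt] by simp

lemma pext_sets [measurable]:
  assumes S: "is_tree S" and U: "U \<subseteq> ends S" shows "pext S U \<in> sets M"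
proof -
  have "pext S U = {T \<in> space M. (\<forall>w. w \<in> S \<longrightarrow> w \<in> T) \<and> (\<forall>w. w \<in> T \<longrightarrow> w \<in> S \<or> (\<exists>u\<in>U. prefix u w))}"
    using pext_is_tree[OF S U] is_tree_ptree by (auto simp: space_M trees_def pext_def)
  also have "\<dots> \<in> sets M" by measurable
  finally show ?thesis .
qed

text \<open>The image of (1 + x) ^ b / (1 - x) ^ a when x ^ k is replaced by
  \<open>pw \<nu> k\<close>, with no finiteness claimed.\<close>

definition sm :: "nat \<Rightarrow> nat \<Rightarrow> ennreal" where
  "sm a b = (\<Sum>k. ennreal (qc a b k * pw \<nu> k))"

lemma sm_left_0: "sm 0 b = ennreal (gs \<nu> b 0)"
proof -
  have "sm 0 b = (\<Sum>k\<le>b. ennreal (qc 0 b k * pw \<nu> k))"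
    unfolding sm_def by (rule suminf_finite) (auto simp: binomial_eq_0)
  then show ?thesis using nu_pos by (simp add: gs_def pw_nonneg sum_nonneg)
qed

lemma sm_right_0: "sm a 0 = ennreal (exp \<nu> * gs \<nu> a 0)"
  unfolding sm_def gs_def using nu_pos qc_pw_sums
  by (intro suminf_ennreal_eq) (simp_all add: qc_nonneg pw_nonneg)

lemma sm_step: "(\<Sum>c. ennreal ((1/2) ^ c) * sm a (b + c)) = 2 * sm (Suc a) b"
  unfolding sm_def using nu_pos by (intro qc_ennreal_sum) (simp add: pw_nonneg)

text \<open>The vertices in \<open>A\<close> are replaced one at a time by their children, which join \<open>B\<close>. With
  \<open>pw \<nu> k\<close> as the image of \<open>x ^ k\<close>, a vertex of \<open>B\<close> contributes the factor \<open>2 (1 + x)\<close>, and summing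
  \<open>4 ^ (- c) (2 (1 + x)) ^ c\<close> over the number \<open>c\<close> of children gives the factor \<open>2 / (1 - x)\<close> for a
  vertex of \<open>A\<close>. The last summand is the unknown mass of the finite tree \<open>S\<close> itself.\<close>

lemma mixed_prob:
  assumes base: "\<And>S B. is_tree S \<Longrightarrow> finite S \<Longrightarrow> B \<subseteq> ends S \<Longrightarrow> B \<noteq> {} \<Longrightarrow> \<forall>u\<in>B. length u = Suc s \<Longrightarrow>
      \<forall>w\<in>S - B. length w < Suc s + d \<Longrightarrow>
      emeasure M (pext S B) = ennreal (exp (- \<nu> * real s) * (1/4) ^ edges S * 2 ^ (card B + 1)) * sm 0 (card B)"
    and "finite A" "is_tree S" "finite S" "A \<subseteq> ends S" "B \<subseteq> ends S" "A \<inter> B = {}"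
    "\<forall>u\<in>A. length u = s" "\<forall>u\<in>B. length u = Suc s" "\<forall>w\<in>S - B. length w < Suc s + d"
  shows "emeasure M (pext S (A \<union> B))
    = ennreal (exp (- \<nu> * real s) * (1/4) ^ edges S * 2 ^ (card A + card B + 1)) * sm (card A) (card B)
      + (if B = {} then emeasure M {S} else 0)"
  using assms(2-)
proof (induction A arbitrary: S B rule: finite_induct)
  case empty
  show ?case
  proof (cases "B = {}")
    case True
    then show ?thesis using pext_empty[OF is_tree_ptree[OF empty(1)]]
      by (simp add: sm_left_0 gs_0)
  next
    case False
    then show ?thesis using base[of S B] empty by simp
  qed
next
  case (insert x A)
  note S = insert.prems(1,2)
  have pS: "ptree S" using S is_tree_ptree by blast
  have xE: "x \<in> ends S" and xB: "x \<notin> B" and lx: "length x = s" using insert.prems by auto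
  have finB: "finite B" using insert.prems(4) ends_subset S(2) by (meson finite_subset subsetI subset_trans)
  let ?U = "insert x A \<union> B"
  have U: "?U \<subseteq> ends S" using insert.prems by blast
  define Sc where "Sc c = graft S {x} (\<lambda>_. star c)" for c
  define Bc where "Bc c = B \<union> (\<lambda>a. x @ [a]) ` {..<c}" for c
  define K where "K = exp (- \<nu> * real s) * (1/4) ^ edges S * 2 ^ (card A + card B + 1)"
  have Sc: "is_tree (Sc c)" "finite (Sc c)" for c
    unfolding Sc_def using is_tree_graft[OF S(1), of "{x}" "\<lambda>_. star c"] xE ptree_star S finite_graft[of S "{x}" "\<lambda>_. star c"] by auto
  have Uc: "?U - {x} \<union> (\<lambda>a. x @ [a]) ` {..<c} = A \<union> Bc c" for c
    using insert.hyps(2) xB by (auto simp: Bc_def)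
  have dec: "pext (Sc c) (A \<union> Bc c) = {T \<in> pext S ?U. nch (subt T x) [] = c}" for c
    using pext_split_star[OF pS U, of x c] unfolding Sc_def Uc by simp
  have endsc: "A \<union> Bc c \<subseteq> ends (Sc c)" for c
  proof -
    have "{y @ v | y v. y \<in> {x} \<and> v \<in> {[a] | a. a < c}} = (\<lambda>a. x @ [a]) ` {..<c}" by auto
    moreover have "{[a] | a. a < c} \<subseteq> ends (star c)" by (auto simp: ends_def star_def)
    ultimately show ?thesis
      using ends_graft[OF pS _ U, of "{x}" "\<lambda>_. star c" "\<lambda>_. {[a] | a. a < c}"] ptree_star
      unfolding Sc_def Uc[symmetric] by simp
  qed
  have disj: "B \<inter> (\<lambda>a. x @ [a]) ` {..<c} = {}" for c
  proof -
    have "x @ [a] \<notin> S" for a using xE by (simp add: ends_def)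
    then show ?thesis using insert.prems(4) ends_subset by blast
  qed
  have cardBc: "card (Bc c) = card B + c" for c
    unfolding Bc_def using finB disj by (subst card_Un_disjoint) (auto simp: card_image inj_on_def)
  have edg: "edges (Sc c) = edges S + c" for c
    using edges_graft1[OF S xE ptree_star finite_star, of c] by (simp add: Sc_def card_star)
  have IH: "emeasure M (pext (Sc c) (A \<union> Bc c))
      = ennreal (exp (- \<nu> * real s) * (1/4) ^ edges (Sc c) * 2 ^ (card A + card (Bc c) + 1)) * sm (card A) (card (Bc c))
        + (if Bc c = {} then emeasure M {Sc c} else 0)" for c
  proof (rule insert.IH)
    show "is_tree (Sc c)" "finite (Sc c)" by (fact Sc)+
    show "A \<subseteq> ends (Sc c)" "Bc c \<subseteq> ends (Sc c)" using endsc[of c] by blast+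
    have "x @ [a] \<notin> S" for a using xE by (simp add: ends_def)
    then show "A \<inter> Bc c = {}" using insert.prems(3,5) ends_subset by (fastforce simp: Bc_def)
    show "\<forall>u\<in>A. length u = s" using insert.prems by blast
    show "\<forall>u\<in>Bc c. length u = Suc s" using insert.prems(7) lx by (auto simp: Bc_def)
    show "\<forall>w\<in>Sc c - Bc c. length w < Suc s + d"
    proof
      fix w assume w: "w \<in> Sc c - Bc c"
      then have "w \<in> S - B \<or> (\<exists>v\<in>star c. w = x @ v)" by (auto simp: Sc_def Bc_def graft_def)
      then show "length w < Suc s + d"
      proof
        assume "w \<in> S - B"
        then show ?thesis using insert.prems(8) by blast
      next
        assume "\<exists>v\<in>star c. w = x @ v"
        then have "w = x" using w by (auto simp: star_def Bc_def)
        then show ?thesis using lx by simp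
      qed
    qed
  qed
  have "pext S ?U = (\<Union>c. pext (Sc c) (A \<union> Bc c))" by (auto simp: dec)
  then have "emeasure M (pext S ?U) = (\<Sum>c. emeasure M (pext (Sc c) (A \<union> Bc c)))"
    using pext_sets[OF Sc(1) endsc]
    by (simp add: suminf_emeasure[symmetric] image_subset_iff disjoint_family_on_def dec)
      (subst suminf_emeasure, auto simp: disjoint_family_on_def)
  also have "\<dots> = (\<Sum>c. ennreal K * (ennreal ((1/2) ^ c) * sm (card A) (card B + c))
        + (if c = 0 then (if B = {} then emeasure M {S} else 0) else 0))"
  proof (rule suminf_cong)
    fix c
    \<comment> \<open>Each of the c children adds one edge and one end of the next level, a factor
      1/4 times 2.\<close>
    have "ennreal (exp (- \<nu> * real s) * (1/4) ^ edges (Sc c) * 2 ^ (card A + card (Bc c) + 1))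
        = ennreal (K * (1/2) ^ c)"
      unfolding edg cardBc K_def
      by (intro arg_cong[where f = ennreal]) (simp add: power_add power_divide flip: power_mult_distrib, simp add: field_simps flip: power_mult_distrib)
    also have "\<dots> = ennreal K * ennreal ((1/2) ^ c)"
      by (subst ennreal_mult) (auto simp: K_def)
    finally have 1: "ennreal (exp (- \<nu> * real s) * (1/4) ^ edges (Sc c) * 2 ^ (card A + card (Bc c) + 1))
        = ennreal K * ennreal ((1/2) ^ c)" .
    \<comment> \<open>The additional mass can only come from c = 0 with \<open>B\<close> empty, and
      grafting \<open>star 0\<close> leaves \<open>S\<close> unchanged.\<close>
    have "Bc c = {} \<longleftrightarrow> c = 0 \<and> B = {}" by (auto simp: Bc_def)
    moreover have "Sc 0 = S" using xE ends_subset by (auto simp: Sc_def star_def graft_def)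
    ultimately have 2: "(if Bc c = {} then emeasure M {Sc c} else 0)
        = (if c = 0 then (if B = {} then emeasure M {S} else 0) else 0)" by auto
    show "emeasure M (pext (Sc c) (A \<union> Bc c)) = ennreal K * (ennreal ((1/2) ^ c) * sm (card A) (card B + c))
        + (if c = 0 then (if B = {} then emeasure M {S} else 0) else 0)"
      using IH[of c] unfolding 1 2 unfolding cardBc mult.assoc .
  qed
  also have "\<dots> = ennreal K * (\<Sum>c. ennreal ((1/2) ^ c) * sm (card A) (card B + c))
      + (if B = {} then emeasure M {S} else 0)"
    by (subst suminf_add[symmetric], simp, simp, subst suminf_finite[of "{0}" "\<lambda>c. if c = 0 then _ else _"])
       (auto simp: ennreal_suminf_cmult)
  also have "ennreal K * (\<Sum>c. ennreal ((1/2) ^ c) * sm (card A) (card B + c)) = ennreal (2 * K) * sm (Suc (card A)) (card B)"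
    unfolding sm_step by (simp add: ennreal_mult K_def mult_ac)
  also have "2 * K = exp (- \<nu> * real s) * (1/4) ^ edges S * 2 ^ (card (insert x A) + card B + 1)"
    using insert.hyps by (simp add: K_def)
  finally show ?case using insert.hyps by simp
qed

section \<open>Finite trees are null, and the ball formula extends to taller trees\<close>

lemma pext_eq_tball:
  assumes S: "is_tree S" and len: "\<And>w. w \<in> S \<Longrightarrow> length w \<le> h"
  shows "pext S (Dlev h S) = tball h S"
  using pext_Dlev[OF is_tree_ptree[OF S] len] pext_is_tree[OF S Dlev_ends[OF len]] is_tree_ptree
  by (auto simp: tball_def trees_def)

text \<open>As no other vertex reaches the height of \<open>B\<close>, the set \<open>B\<close> is
  the whole top level and the event is a ball.\<close>

lemma full_prob:
  assumes S: "is_tree S" "finite S" and B: "B \<subseteq> ends S" "B \<noteq> {}" "\<forall>u\<in>B. length u = s"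
    and len: "\<forall>w\<in>S - B. length w < s"
  shows "emeasure M (pext S B) = ennreal (exp (- \<nu> * (real s - 1)) * (1/4) ^ edges S * 2 ^ (card B + 1) * gs \<nu> (card B) 0)"
proof -
  have le: "length w \<le> s" if "w \<in> S" for w using that B(3) len by (cases "w \<in> B") (auto intro: less_imp_le)
  have BS: "B \<subseteq> S" using B(1) ends_subset by blast
  have BD: "B = Dlev s S"
  proof
    show "B \<subseteq> Dlev s S" using BS B(3) by (simp add: Dlev_def subset_iff)
    show "Dlev s S \<subseteq> B"
    proof
      fix w assume w: "w \<in> Dlev s S"
      show "w \<in> B"
      proof (rule ccontr)
        assume "w \<notin> B"
        then have "w \<in> S - B" using w by (simp add: Dlev_def)
        then show False using w len by (force simp: Dlev_def)
      qed
    qed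
  qed
  obtain u where "u \<in> B" using B(2) by blast
  then have "height S = s" using height_eqI[OF S(2) le, of u] BS B(3) by blast
  then show ?thesis
    using ball_prob[OF S] pext_eq_tball[OF S(1) le] by (simp add: BD emeasure_eq_measure)
qed

text \<open>The ball formula is consistent from one height to the next without any mass for the
  trees that stop, so finite trees carry no mass.\<close>

lemma finite_null:
  assumes S: "is_tree S" "finite S" shows "emeasure M {S} = 0"
proof -
  define s where "s = height S"
  define L where "L = card (Dlev s S)"
  have len: "length w \<le> s" if "w \<in> S" for w using length_le_height[OF S(2) that] by (simp add: s_def)
  have finD: "finite (Dlev s S)" using S by (simp add: Dlev_def)
  define x where "x = exp (- \<nu> * (real s - 1)) * (1/4) ^ edges S * 2 ^ (L + 1) * gs \<nu> L 0"
  have "emeasure M (pext S (Dlev s S)) = ennreal x"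
    using ball_prob[OF S] pext_eq_tball[OF S(1) len] by (simp add: s_def L_def x_def emeasure_eq_measure)
  \<comment> \<open>The same ball computed from the balls one level higher. By
    \<open>qc_pw_sums\<close> the main term is again \<open>x\<close>, so the additional mass of
    \<open>S\<close> must vanish.\<close>
  moreover have "emeasure M (pext S (Dlev s S \<union> {}))
    = ennreal (exp (- \<nu> * real s) * (1/4) ^ edges S * 2 ^ (card (Dlev s S) + card ({} :: nat list set) + 1)) * sm (card (Dlev s S)) (card ({} :: nat list set))
      + (if ({} :: nat list set) = {} then emeasure M {S} else 0)"
  proof (rule mixed_prob[where d = 0])
    show "emeasure M (pext S B) = ennreal (exp (- \<nu> * real s) * (1/4) ^ edges S * 2 ^ (card B + 1)) * sm 0 (card B)"
      if "is_tree S" "finite S" "B \<subseteq> ends S" "B \<noteq> {}" "\<forall>u\<in>B. length u = Suc s" "\<forall>w\<in>S - B. length w < Suc s + 0" for S B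
      using full_prob[of S B "Suc s"] that nu_pos by (simp add: sm_left_0 ennreal_mult gs_nonneg)
    show "Dlev s S \<subseteq> ends S" using Dlev_ends[OF len] by blast
    show "\<forall>w\<in>S - {}. length w < Suc s + 0" using len by (auto simp: less_Suc_eq_le)
  qed (use S finD in \<open>auto simp: Dlev_def\<close>)
  moreover have "ennreal (exp (- \<nu> * real s) * (1/4) ^ edges S * 2 ^ (L + 1)) * sm L 0 = ennreal x"
    unfolding sm_right_0 using nu_pos gs_nonneg[of \<nu> L 0]
    by (subst ennreal_mult[symmetric])
       (auto intro!: arg_cong[where f = ennreal] simp: x_def exp_shift)
  ultimately have "ennreal x = ennreal x + emeasure M {S}" by (simp add: L_def)
  then have "ennreal x + emeasure M {S} - ennreal x = ennreal x - ennreal x" by simp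
  then show ?thesis by simp
qed

text \<open>Induction on the excess \<open>d\<close> by which the fixed part of \<open>S\<close> may
  rise above the ends in \<open>U\<close>. Revealing the children of all these ends raises them by
  one level while the fixed part stays, until the event is a ball.\<close>

lemma pext_prob_aux:
  assumes "is_tree S" "finite S" "U \<subseteq> ends S" "\<forall>u\<in>U. length u = s" "\<forall>w\<in>S - U. length w < s + d"
  shows "emeasure M (pext S U) = ennreal (exp (- \<nu> * (real s - 1)) * (1/4) ^ edges S * 2 ^ (card U + 1) * gs \<nu> (card U) 0)"
  using assms
proof (induction d arbitrary: S U s)
  case 0
  show ?case
  proof (cases "U = {}")
    case True
    \<comment> \<open>Without ends the formula has to give 0, and it does because
      \<open>pw \<nu> 0\<close> is 0.\<close>
    then show ?thesis using finite_null[of S] 0 pext_empty[OF is_tree_ptree] by (simp add: gs_0)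
  next
    case False
    then show ?thesis using full_prob[of S U s] 0 by simp
  qed
next
  case (Suc d)
  have finU: "finite U" using Suc.prems ends_subset by (meson finite_subset subsetI subset_trans)
  have "emeasure M (pext S (U \<union> {}))
    = ennreal (exp (- \<nu> * real s) * (1/4) ^ edges S * 2 ^ (card U + card ({} :: nat list set) + 1)) * sm (card U) (card ({} :: nat list set))
      + (if ({} :: nat list set) = {} then emeasure M {S} else 0)"
  proof (rule mixed_prob[where d = d])
    show "emeasure M (pext S B) = ennreal (exp (- \<nu> * real s) * (1/4) ^ edges S * 2 ^ (card B + 1)) * sm 0 (card B)"
      if "is_tree S" "finite S" "B \<subseteq> ends S" "B \<noteq> {}" "\<forall>u\<in>B. length u = Suc s" "\<forall>w\<in>S - B. length w < Suc s + d" for S B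
      using Suc.IH[of S B "Suc s"] that nu_pos by (simp add: sm_left_0 ennreal_mult gs_nonneg)
    show "\<forall>w\<in>S - {}. length w < Suc s + d"
    proof
      fix w assume "w \<in> S - {}"
      then show "length w < Suc s + d" using Suc.prems(4,5) by (cases "w \<in> U") auto
    qed
  qed (use Suc.prems finU in auto)
  also have "\<dots> = ennreal (exp (- \<nu> * real s) * (1/4) ^ edges S * 2 ^ (card U + 1)) * sm (card U) 0"
    using finite_null[OF Suc.prems(1,2)] by simp
  also have "\<dots> = ennreal (exp (- \<nu> * (real s - 1)) * (1/4) ^ edges S * 2 ^ (card U + 1) * gs \<nu> (card U) 0)"
    unfolding sm_right_0 using nu_pos gs_nonneg[of \<nu> "card U" 0]
    by (subst ennreal_mult[symmetric])
       (auto intro!: arg_cong[where f = ennreal] simp: exp_shift)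
  finally show ?case by simp
qed

lemma pext_prob:
  assumes "is_tree S" "finite S" "U \<subseteq> ends S" "\<forall>u\<in>U. length u = s"
  shows "measure M (pext S U) = exp (- \<nu> * (real s - 1)) * (1/4) ^ edges S * 2 ^ (card U + 1) * gs \<nu> (card U) 0"
proof -
  have "length w < s + Suc (height S)" if "w \<in> S" for w
    using length_le_height[OF assms(2) that] by simp
  then show ?thesis
    using pext_prob_aux[OF assms, of "Suc (height S)"] nu_pos gs_nonneg[of \<nu> "card U" 0]
    by (auto simp: emeasure_eq_measure ennreal_inj)
qed

text \<open>Ends in \<open>A\<close> are free, those in \<open>F\<close> die out, those in
  \<open>B\<close> survive. With x ^ k standing for \<open>pw \<nu> k\<close> they weigh 2 (1 + x),
  2 and 2 x.\<close>

definition ev :: "tree \<Rightarrow> nat list set \<Rightarrow> nat list set \<Rightarrow> nat list set \<Rightarrow> tree set" where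
  "ev S A F B = {T \<in> pext S (A \<union> F \<union> B). (\<forall>u\<in>F. finite (subt T u)) \<and> (\<forall>u\<in>B. infinite (subt T u))}"

lemma ev_sets [measurable]:
  assumes S: "is_tree S" "finite S" and U: "A \<union> F \<union> B \<subseteq> ends S" shows "ev S A F B \<in> sets M"
proof -
  have "ev S A F B = {T \<in> space M. T \<in> pext S (A \<union> F \<union> B) \<and> (\<forall>u. u \<in> F \<longrightarrow> finite (subt T u)) \<and> (\<forall>u. u \<in> B \<longrightarrow> infinite (subt T u))}"
    using pext_is_tree[OF S(1) U] by (auto simp: ev_def space_M trees_def)
  moreover have [measurable]: "pext S (A \<union> F \<union> B) \<in> sets M" using pext_sets[OF S(1) U] .
  ultimately show ?thesis by simp
qed

text \<open>A finite subtree \<open>g\<close> put at an end of \<open>F\<close> adds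
  \<open>card g - 1\<close> edges and removes the end. Its weights 4 (1/4) ^ card g sum to 4/2 = 2
  by \<open>catalan_sum\<close>, the factor that this end keeps. These subtrees have unbounded
  height, hence the need for \<open>pext_prob\<close> in trees taller than \<open>s\<close>.\<close>

lemma ev_prob_no_infinite:
  assumes "finite F" "is_tree S" "finite S" "A \<union> F \<subseteq> ends S" "A \<inter> F = {}" "\<forall>u\<in>A \<union> F. length u = s"
  shows "measure M (ev S A F {}) = exp (- \<nu> * (real s - 1)) * (1/4) ^ edges S * 2 ^ (card A + card F + 1) * gs \<nu> (card A) 0"
  using assms
proof (induction F arbitrary: S rule: finite_induct)
  case empty
  then show ?case using pext_prob[of S A s] by (simp add: ev_def)
next
  case (insert x F)
  note S = insert.prems(1,2)
  have pS: "ptree S" using S is_tree_ptree by blast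
  let ?U = "A \<union> insert x F"
  have xE: "x \<in> ends S" and U: "?U \<subseteq> ends S" using insert.prems by auto
  have Ux: "?U - {x} = A \<union> F" using insert by auto
  define Sg where "Sg g = graft S {x} (\<lambda>_. g)" for g
  define K where "K = exp (- \<nu> * (real s - 1)) * (1/4) ^ edges S * 2 ^ (card A + card F + 1) * gs \<nu> (card A) 0"
  have K0: "K \<ge> 0" using nu_pos by (simp add: K_def gs_nonneg)
  have Sg: "is_tree (Sg g)" "finite (Sg g)" "A \<union> F \<subseteq> ends (Sg g)" if "g \<in> fptrees" for g
  proof -
    show "is_tree (Sg g)" "finite (Sg g)" unfolding Sg_def
      using is_tree_graft[OF S(1), of "{x}" "\<lambda>_. g"] xE that S finite_graft[of S "{x}" "\<lambda>_. g"]
      by (auto simp: fptrees_def)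
    show "A \<union> F \<subseteq> ends (Sg g)"
      using ends_graft[OF pS _ U, of "{x}" "\<lambda>_. g" "\<lambda>_. {}"] that
      unfolding Sg_def Ux by (auto simp: fptrees_def)
  qed
  have dec: "ev (Sg g) A F {} = {T \<in> ev S A (insert x F) {}. subt T x = g}" if g: "g \<in> fptrees" for g
    using pext_split_finite[OF pS U, of x g] g unfolding Ux Sg_def ev_def
    by (auto simp: fptrees_def)
  have IH: "emeasure M (ev (Sg g) A F {}) = ennreal (4 * K) * ennreal ((1/4) ^ card g)" if g: "g \<in> fptrees" for g
  proof -
    have "measure M (ev (Sg g) A F {}) = exp (- \<nu> * (real s - 1)) * (1/4) ^ edges (Sg g) * 2 ^ (card A + card F + 1) * gs \<nu> (card A) 0"
      by (rule insert.IH) (use Sg[OF g] insert.prems in auto)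
    also have "\<dots> = 4 * K * (1/4) ^ card g"
    proof -
      have "edges (Sg g) + 1 = edges S + card g"
        using edges_graft1[OF S xE] g by (simp add: Sg_def fptrees_def)
      then have "(1/4) ^ (edges (Sg g) + 1) = ((1/4) ^ (edges S + card g) :: real)" by (simp only:)
      then have "(1/4) ^ edges (Sg g) = 4 * ((1/4) ^ edges S * (1/4) ^ card g :: real)"
        by (simp add: power_add)
      then show ?thesis by (simp only: K_def mult_ac)
    qed
    finally show ?thesis using K0 by (simp add: emeasure_eq_measure ennreal_mult)
  qed
  have "ev S A (insert x F) {} = (\<Union>g\<in>fptrees. ev (Sg g) A F {})"
  proof -
    have "subt T x \<in> fptrees" if "T \<in> ev S A (insert x F) {}" for T
    proof -
      have T: "T \<in> pext S ?U" "finite (subt T x)" using that by (auto simp: ev_def)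
      have "x \<in> T" using pextD(2)[OF T(1)] xE ends_subset by blast
      then show ?thesis using T pextD(1)[OF T(1)] ptree_subt by (simp add: fptrees_def)
    qed
    then show ?thesis using dec by auto
  qed
  moreover have "countable fptrees"
    by (rule countable_subset[OF _ countable_Collect_finite]) (auto simp: fptrees_def)
  moreover have "disjoint_family_on (\<lambda>g. ev (Sg g) A F {}) fptrees"
    using dec by (auto simp: disjoint_family_on_def)
  ultimately have "emeasure M (ev S A (insert x F) {}) = (\<integral>\<^sup>+g. emeasure M (ev (Sg g) A F {}) \<partial>count_space fptrees)"
    using ev_sets Sg by (subst emeasure_UN_countable[symmetric]) auto
  also have "\<dots> = (\<integral>\<^sup>+g. ennreal (4 * K) * ennreal ((1/4) ^ card g) \<partial>count_space fptrees)"
    by (intro nn_integral_cong) (simp add: IH)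
  also have "\<dots> = ennreal (4 * K) * ennreal (1/2)"
    by (simp only: nn_integral_cmult catalan_sum borel_measurable_count_space)
  also have "\<dots> = ennreal (2 * K)" using K0 by (subst ennreal_mult[symmetric]) auto
  finally have "measure M (ev S A (insert x F) {}) = 2 * K" using K0 by (simp add: measure_def)
  then show ?case using insert.hyps by (simp add: K_def)
qed

text \<open>A surviving end is a free end minus one that dies out: 2 (1 + x) - 2 = 2 x, which is
  \<open>gs_Suc\<close>.\<close>

lemma ev_prob:
  assumes "finite B" "is_tree S" "finite S" "A \<union> F \<union> B \<subseteq> ends S" "A \<inter> F = {}" "(A \<union> F) \<inter> B = {}"
    "\<forall>u\<in>A \<union> F \<union> B. length u = s"
  shows "measure M (ev S A F B)
    = exp (- \<nu> * (real s - 1)) * (1/4) ^ edges S * 2 ^ (card A + card F + card B + 1) * gs \<nu> (card A) (card B)"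
  using assms
proof (induction B arbitrary: A F rule: finite_induct)
  case empty
  have "finite F" using empty.prems(2,3) ends_subset by (meson finite_subset subsetI subset_trans Un_subset_iff)
  then show ?case using ev_prob_no_infinite[of F S A s] empty.prems by simp
next
  case (insert x B)
  note S = insert.prems(1,2)
  have fin: "finite (A \<union> F \<union> insert x B)"
    using insert.prems(2,3) ends_subset by (meson finite_subset subsetI subset_trans)
  have xn: "x \<notin> A" "x \<notin> F" using insert.prems by auto
  have 1: "measure M (ev S (insert x A) F B)
    = exp (- \<nu> * (real s - 1)) * (1/4) ^ edges S * 2 ^ (card (insert x A) + card F + card B + 1) * gs \<nu> (card (insert x A)) (card B)"
    by (rule insert.IH) (use insert.prems insert.hyps xn in auto)
  have 2: "measure M (ev S A (insert x F) B)
    = exp (- \<nu> * (real s - 1)) * (1/4) ^ edges S * 2 ^ (card A + card (insert x F) + card B + 1) * gs \<nu> (card A) (card B)"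
    by (rule insert.IH) (use insert.prems insert.hyps xn in auto)
  have "ev S (insert x A) F B = ev S A (insert x F) B \<union> ev S A F (insert x B)"
    by (auto simp: ev_def)
  moreover have "ev S A (insert x F) B \<inter> ev S A F (insert x B) = {}"
    by (auto simp: ev_def)
  moreover have "ev S A (insert x F) B \<in> sets M" "ev S A F (insert x B) \<in> sets M"
    using insert.prems by (auto intro!: ev_sets)
  ultimately have "measure M (ev S (insert x A) F B) = measure M (ev S A (insert x F) B) + measure M (ev S A F (insert x B))"
    using finite_measure_Union by metis
  then show ?case using 1 2 xn fin insert.hyps by (simp add: gs_Suc algebra_simps)
qed

end

section \<open>Enumerating a finite set of naturals\<close>

text \<open>For the vertices of infinite type, \<open>relab\<close> applies \<open>rank\<close> and
  \<open>unrank\<close> applies \<open>kth\<close> to the set of spine children at each vertex. The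
  passage between a tree and its spine thus reduces to this pair of inverse maps.\<close>

definition rank :: "nat set \<Rightarrow> nat \<Rightarrow> nat" where
  "rank A a = card {b. b < a \<and> b \<in> A}"

definition kth :: "nat set \<Rightarrow> nat \<Rightarrow> nat" where
  "kth A n = (LEAST a. a \<in> A \<and> rank A a = n)"

lemma rank_less: "a \<in> A \<Longrightarrow> a < b \<Longrightarrow> rank A a < rank A b"
  unfolding rank_def by (rule psubset_card_mono) auto

lemma rank_inj: "inj_on (rank A) A"
  by (rule inj_onI) (metis less_irrefl linorder_neqE_nat rank_less)

lemma kth_rank: "a \<in> A \<Longrightarrow> kth A (rank A a) = a"
  unfolding kth_def using rank_inj by (intro Least_equality) (auto dest: inj_onD)

lemma rank_less_card: "finite A \<Longrightarrow> a \<in> A \<Longrightarrow> rank A a < card A"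
  unfolding rank_def by (rule psubset_card_mono) auto

lemma rank_image: "finite A \<Longrightarrow> rank A ` A = {..<card A}"
  by (rule card_subset_eq) (auto simp: rank_less_card card_image rank_inj)

lemma kth_mem: "finite A \<Longrightarrow> n < card A \<Longrightarrow> kth A n \<in> A \<and> rank A (kth A n) = n"
proof -
  assume "finite A" "n < card A"
  then have "n \<in> rank A ` A" by (simp add: rank_image)
  then obtain a where "a \<in> A" "n = rank A a" by blast
  then show ?thesis using kth_rank by simp
qed

lemma kth_less: "finite A \<Longrightarrow> m < n \<Longrightarrow> n < card A \<Longrightarrow> kth A m < kth A n"
  using kth_mem[of A m] kth_mem[of A n] rank_less[of "kth A n" A "kth A m"]
  by (metis less_trans linorder_neqE_nat order.asym)

lemma kth_eqI:
  assumes A: "A = f ` {..<k}" and f: "\<And>m n. m < n \<Longrightarrow> n < k \<Longrightarrow> f m < (f n :: nat)"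
  shows "card A = k" "n < k \<Longrightarrow> kth A n = f n"
proof -
  have less_iff: "f m < f n \<longleftrightarrow> m < n" if "m < k" "n < k" for m n
    using f that by (metis less_irrefl linorder_neqE_nat order.asym)
  then have inj: "inj_on f {..<k}" by (intro inj_onI) (metis lessThan_iff linorder_neqE_nat less_irrefl)
  show "card A = k" using A inj by (simp add: card_image)
  assume n: "n < k"
  have "{b. b < f n \<and> b \<in> A} = f ` {..<n}" using A less_iff n by auto
  moreover have "inj_on f {..<n}" using inj n by (auto simp: inj_on_def)
  ultimately have "rank A (f n) = n" by (simp add: rank_def card_image)
  then show "kth A n = f n" using kth_rank[of "f n" A] A n by auto
qed

section \<open>The neighbourhood of one spine vertex\<close>

text \<open>The root edge of a sector tree is identified with the parent edge, so its vertex
  \<open>[0]\<close> is the spine vertex itself and the children of \<open>[0]\<close> are those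
  inserted in the sector.\<close>

definition dg :: "(nat \<Rightarrow> tree) \<Rightarrow> nat \<Rightarrow> nat" where
  "dg g n = nch (g n) [0]"

text \<open>The 1 for each earlier sector is the spine child that closes it.\<close>

definition lo :: "(nat \<Rightarrow> tree) \<Rightarrow> nat \<Rightarrow> nat" where
  "lo g n = (\<Sum>m<n. dg g m + 1)"

definition ps :: "(nat \<Rightarrow> tree) \<Rightarrow> nat \<Rightarrow> nat" where
  "ps g n = lo g n + dg g n"

text \<open>A vertex with \<open>k\<close> spine children and the trees \<open>g 0, \<dots>, g k\<close> in its sectors;
  \<open>ps g n\<close> is the position of the \<open>n\<close>-th spine child among all the children.\<close>

definition block :: "(nat \<Rightarrow> tree) \<Rightarrow> nat \<Rightarrow> nat list set" where
  "block g k = insert [] ({[ps g n] | n. n < k} \<union> {(lo g n + p) # w | n p w. n \<le> k \<and> 0 # p # w \<in> g n})"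

definition ports :: "(nat \<Rightarrow> tree) \<Rightarrow> nat \<Rightarrow> nat list set" where
  "ports g k = (\<lambda>n. [ps g n]) ` {..<k}"

text \<open>These are the children of infinite type, that is, the positions of the spine children of
  the root.\<close>

definition ik :: "nat list set \<Rightarrow> nat set" where
  "ik P = {a. infinite (subt P [a])}"

text \<open>\<open>sector_branch\<close> as seen from the spine vertex, depending only on the
  subtree there; \<open>sector_branch_sec\<close> makes the connection.\<close>

definition sec :: "nat list set \<Rightarrow> nat \<Rightarrow> nat \<Rightarrow> tree" where
  "sec P k n = (let l = (if n = 0 then 0 else kth (ik P) (n - 1) + 1) in
     {[], [0]} \<union> {0 # (p - l) # w | p w. p # w \<in> P \<and> l \<le> p \<and> (n < k \<longrightarrow> p < kth (ik P) n)})"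

lemma lo_0 [simp]: "lo g 0 = 0" by (simp add: lo_def)

lemma lo_Suc: "lo g (Suc n) = Suc (ps g n)" by (simp add: lo_def ps_def)

lemma lo_le_ps: "lo g n \<le> ps g n" by (simp add: ps_def)

lemma lo_mono: "m \<le> n \<Longrightarrow> lo g m \<le> lo g n"
  unfolding lo_def by (rule sum_mono2) auto

lemma ps_less_lo: "m < n \<Longrightarrow> ps g m < lo g n"
  using lo_mono[of "Suc m" n g] by (simp add: lo_Suc)

lemma ps_less: "m < n \<Longrightarrow> ps g m < ps g n"
  using ps_less_lo lo_le_ps order_less_le_trans by blast

lemma position_unique:
  assumes "lo g n \<le> a" "a \<le> ps g n" "lo g m \<le> a" "a \<le> ps g m" shows "m = n"
  using ps_less_lo[of m n g] ps_less_lo[of n m g] assms by (cases m n rule: linorder_cases) auto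

text \<open>The intervals from \<open>lo g n\<close> to \<open>ps g n\<close> tile the positions.
  Each ends in a spine child except the last one, for \<open>n = k\<close>; so \<open>ps g k\<close>
  is the number of all children and nothing lies at or beyond it.\<close>

lemma position_cases:
  obtains (sector) n where "n \<le> k" "lo g n \<le> a" "a < ps g n"
    | (port) n where "n < k" "a = ps g n"
    | (beyond) "ps g k \<le> a"
proof -
  have "(\<exists>n\<le>k. lo g n \<le> a \<and> a < ps g n) \<or> (\<exists>n<k. a = ps g n) \<or> ps g k \<le> a"
  proof (induction k)
    case 0
    then show ?case by (cases "a < ps g 0") auto
  next
    case (Suc k)
    then consider "\<exists>n\<le>k. lo g n \<le> a \<and> a < ps g n" | "\<exists>n<k. a = ps g n" | "a = ps g k"
      | "lo g (Suc k) \<le> a" by (fastforce simp: lo_Suc)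
    then show ?case
    proof cases
      case 4 then show ?thesis by (cases "a < ps g (Suc k)") auto
    qed (auto simp: less_Suc_eq le_Suc_eq)
  qed
  then show ?thesis using that by blast
qed

lemma degree_bound: "is_tree (g n) \<Longrightarrow> 0 # p # w \<in> g n \<Longrightarrow> p < dg g n"
  using ptree_appendD[of "g n" "[0, p]" w] ptree_child_iff[of "g n" "[0]" p]
  by (simp add: is_tree_ptree dg_def)

lemma tree_cases:
  assumes "is_tree T" "w \<in> T" obtains "w = []" | "w = [0]" | p v where "w = 0 # p # v"
proof (cases w)
  case (Cons a v)
  then have "[a] \<in> T" using assms ptree_appendD[OF is_tree_ptree, of T "[a]" v] by simp
  then have "a = 0" using is_tree_root_edge[OF assms(1)] by simp
  then show ?thesis using Cons that by (cases v) auto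
qed (use that in blast)

lemma finite_ik: "ptree P \<Longrightarrow> finite (ik P)"
proof -
  assume P: "ptree P"
  have "ik P \<subseteq> {a. [] @ [a] \<in> P}"
  proof
    fix a assume "a \<in> ik P"
    then obtain w where "w \<in> subt P [a]" unfolding ik_def by (metis finite.emptyI mem_Collect_eq ex_in_conv)
    then show "a \<in> {a. [] @ [a] \<in> P}" using ptree_appendD[OF P, of "[a]" w] by simp
  qed
  then show ?thesis using ptree_finite_children[OF P] finite_subset by blast
qed

section \<open>The block and its sectors determine each other\<close>

context
  fixes g :: "nat \<Rightarrow> tree" and k :: nat
  assumes g: "\<And>n. n \<le> k \<Longrightarrow> is_tree (g n) \<and> finite (g n)"
begin

lemma block_sector:
  assumes "n \<le> k" "lo g n \<le> a" "a < ps g n"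
  shows "a # w \<in> block g k \<longleftrightarrow> 0 # (a - lo g n) # w \<in> g n"
proof
  assume "a # w \<in> block g k"
  then consider m where "m < k" "a = ps g m" | m p where "m \<le> k" "a = lo g m + p" "0 # p # w \<in> g m"
    unfolding block_def by auto
  then show "0 # (a - lo g n) # w \<in> g n"
  proof cases
    case 1
    then have "m = n" using position_unique[of g n a m] assms lo_le_ps by simp
    then show ?thesis using 1 assms by simp
  next
    case 2
    then have "p < dg g m" using degree_bound g by blast
    then have "m = n" using position_unique[of g n a m] assms 2 by (simp add: ps_def)
    then show ?thesis using 2 by simp
  qed
next
  assume *: "0 # (a - lo g n) # w \<in> g n"
  have "a # w = (lo g n + (a - lo g n)) # w" using assms by simp
  then show "a # w \<in> block g k" unfolding block_def using * assms(1) by blast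
qed

lemma block_port:
  assumes "n < k" shows "ps g n # w \<in> block g k \<longleftrightarrow> w = []"
proof
  assume "ps g n # w \<in> block g k"
  then consider "w = []" | m p where "m \<le> k" "ps g n = lo g m + p" "0 # p # w \<in> g m"
    unfolding block_def by auto
  then show "w = []"
  proof cases
    case 2
    then have p: "p < dg g m" using degree_bound g by blast
    then have "m = n" using position_unique[of g n "ps g n" m] 2 lo_le_ps[of g n] by (simp add: ps_def)
    then show ?thesis using 2 p by (simp add: ps_def)
  qed
next
  assume "w = []" then show "ps g n # w \<in> block g k" using assms unfolding block_def by blast
qed

lemma block_beyond:
  assumes "ps g k \<le> a" shows "a # w \<notin> block g k"
proof
  assume "a # w \<in> block g k"
  then consider m where "m < k" "a = ps g m" | m p where "m \<le> k" "a = lo g m + p" "0 # p # w \<in> g m"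
    unfolding block_def by auto
  then show False
  proof cases
    case 1 then show ?thesis using ps_less[of m k g] assms by simp
  next
    case 2
    then have "a < ps g m" using degree_bound g by (auto simp: ps_def)
    moreover have "ps g m \<le> ps g k" using 2 ps_less[of m k g] by (cases "m = k") auto
    ultimately show ?thesis using assms by simp
  qed
qed

lemma block_single: "[a] \<in> block g k \<longleftrightarrow> a < ps g k"
proof (cases rule: position_cases[of k g a])
  case (sector n)
  then have "[0] @ [a - lo g n] \<in> g n"
    using ptree_child_iff[of "g n" "[0]" "a - lo g n"] g is_tree_ptree by (simp add: ps_def dg_def less_diff_conv2 add.commute)
  moreover have "ps g n \<le> ps g k" using sector ps_less[of n k g] by (cases "n = k") auto
  ultimately show ?thesis using block_sector[OF sector] sector by simp
next
  case (port n)
  then show ?thesis using block_port[of n "[]"] ps_less[of n k g] by simp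
next
  case beyond
  then show ?thesis using block_beyond[of a "[]"] by simp
qed

lemma finite_block: "finite (block g k)"
proof -
  have "block g k \<subseteq> insert [] ((\<lambda>n. [ps g n]) ` {..<k} \<union> (\<Union>n\<le>k. (\<lambda>v. (lo g n + hd (tl v)) # tl (tl v)) ` g n))"
  proof
    fix w assume "w \<in> block g k"
    then consider "w = []" | m where "m < k" "w = [ps g m]" | m p v where "m \<le> k" "w = (lo g m + p) # v" "0 # p # v \<in> g m"
      unfolding block_def by auto
    then show "w \<in> insert [] ((\<lambda>n. [ps g n]) ` {..<k} \<union> (\<Union>n\<le>k. (\<lambda>v. (lo g n + hd (tl v)) # tl (tl v)) ` g n))"
      by cases (auto intro!: image_eqI[where x = "0 # _ # _"] bexI)
  qed
  then show ?thesis by (rule finite_subset) (use g in auto)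
qed

lemma ptree_block: "ptree (block g k)"
proof (rule ptreeI)
  show "[] \<in> block g k" by (simp add: block_def)
  show "finite {a. w @ [a] \<in> block g k}" for w
    using finite_block by (rule finite_imp_finite_children)
  show "w \<in> block g k" if "w @ [a] \<in> block g k" for w a
  proof (cases w)
    case Nil then show ?thesis by (simp add: block_def)
  next
    case (Cons b v)
    have b: "b # (v @ [a]) \<in> block g k" using that Cons by simp
    show ?thesis
    proof (cases rule: position_cases[of k g b])
      case (sector n)
      then have "(0 # (b - lo g n) # v) @ [a] \<in> g n" using b block_sector by simp
      then show ?thesis using Cons block_sector[OF sector] ptree_snocD[OF is_tree_ptree] g sector(1) by blast
    next
      case (port n) then show ?thesis using b block_port by simp
    next
      case beyond then show ?thesis using b block_beyond by blast
    qed
  qed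
  show "w @ [a] \<in> block g k" if "w @ [b] \<in> block g k" "a < b" for w a b
  proof (cases w)
    case Nil then show ?thesis using that by (simp add: block_single)
  next
    case (Cons c v)
    have c: "c # (v @ [b]) \<in> block g k" using that Cons by simp
    show ?thesis
    proof (cases rule: position_cases[of k g c])
      case (sector n)
      then have "(0 # (c - lo g n) # v) @ [b] \<in> g n" using c block_sector by simp
      then have "(0 # (c - lo g n) # v) @ [a] \<in> g n"
        using ptree_sibling[OF is_tree_ptree, of "g n" "0 # (c - lo g n) # v" b a] g sector(1) \<open>a < b\<close> by simp
      then show ?thesis using Cons block_sector[OF sector, of "v @ [a]"] by simp
    next
      case (port n) then show ?thesis using c block_port by simp
    next
      case beyond then show ?thesis using c block_beyond by blast
    qed
  qed
qed

lemma ports_ends: "ports g k \<subseteq> ends (block g k)"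
  unfolding ports_def ends_def using block_port by auto

text \<open>Both trees contain the root and \<open>[0]\<close>, so only words of length at least two
  have to be compared.\<close>

lemma sec_eqI:
  assumes n: "n \<le> k" and l: "l = (if n = 0 then 0 else kth (ik P) (n - 1) + 1)"
  shows "sec P k n = g n \<longleftrightarrow> (\<forall>q w. 0 # q # w \<in> g n \<longleftrightarrow> (l + q) # w \<in> P \<and> (n < k \<longrightarrow> l + q < kth (ik P) n))"
proof -
  have gn: "is_tree (g n)" using g n by blast
  then have nil: "[] \<in> g n" "[0] \<in> g n" by (auto simp: is_tree_root_edge ptree_Nil is_tree_ptree)
  have mem: "0 # q # w \<in> sec P k n \<longleftrightarrow> (l + q) # w \<in> P \<and> (n < k \<longrightarrow> l + q < kth (ik P) n)" for q w
  proof
    assume "0 # q # w \<in> sec P k n"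
    then obtain p where p: "q = p - l" "p # w \<in> P" "l \<le> p" "n < k \<longrightarrow> p < kth (ik P) n"
      unfolding sec_def Let_def l by blast
    then have "p = l + q" by simp
    then show "(l + q) # w \<in> P \<and> (n < k \<longrightarrow> l + q < kth (ik P) n)" using p by blast
  next
    assume *: "(l + q) # w \<in> P \<and> (n < k \<longrightarrow> l + q < kth (ik P) n)"
    have "0 # q # w = 0 # ((l + q) - l) # w" "l \<le> l + q" by simp_all
    then show "0 # q # w \<in> sec P k n" using * unfolding sec_def Let_def l[symmetric] by blast
  qed
  show ?thesis
  proof
    assume "sec P k n = g n" then show "\<forall>q w. 0 # q # w \<in> g n \<longleftrightarrow> (l + q) # w \<in> P \<and> (n < k \<longrightarrow> l + q < kth (ik P) n)"
      using mem by simp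
  next
    assume *: "\<forall>q w. 0 # q # w \<in> g n \<longleftrightarrow> (l + q) # w \<in> P \<and> (n < k \<longrightarrow> l + q < kth (ik P) n)"
    show "sec P k n = g n"
    proof (intro set_eqI iffI)
      fix w assume w: "w \<in> sec P k n"
      then consider "w = []" | "w = [0]" | q v where "w = 0 # q # v" unfolding sec_def Let_def by auto
      then show "w \<in> g n" using nil w mem * by cases auto
    next
      fix w assume w: "w \<in> g n"
      from tree_cases[OF gn w] show "w \<in> sec P k n"
        using w mem * by cases (auto simp: sec_def Let_def)
    qed
  qed
qed

text \<open>Away from the ports \<open>P\<close> agrees with the finite block, so its infinite
  children are exactly the ports, and the cuts made by \<open>sec\<close> fall at the ports.\<close>

lemma pext_block_imp_sec:
  assumes P: "P \<in> pext (block g k) (ports g k)" and inf: "\<And>n. n < k \<Longrightarrow> infinite (subt P [ps g n])"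
  shows "card (ik P) = k" "\<And>n. n < k \<Longrightarrow> kth (ik P) n = ps g n" "\<And>n. n \<le> k \<Longrightarrow> sec P k n = g n"
proof -
  have mem: "a # w \<in> P \<longleftrightarrow> a # w \<in> block g k" if a: "\<And>n. n < k \<Longrightarrow> a \<noteq> ps g n" for a w
    using pextD(2)[OF P] pextD(3)[OF P, of "a # w"] a by (auto simp: ports_def)
  have ik: "ik P = ps g ` {..<k}"
  proof (intro set_eqI iffI)
    fix a assume a: "a \<in> ik P"
    show "a \<in> ps g ` {..<k}"
    proof (rule ccontr)
      assume "a \<notin> ps g ` {..<k}"
      then have "a \<noteq> ps g n" if "n < k" for n using that by blast
      then have "(#) a ` subt P [a] \<subseteq> block g k" using mem[of a] by auto
      then have "finite ((#) a ` subt P [a])" using finite_block finite_subset by blast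
      then have "finite (subt P [a])" by (simp add: finite_image_iff)
      then show False using a by (simp add: ik_def)
    qed
  qed (use inf in \<open>auto simp: ik_def\<close>)
  show "card (ik P) = k" using kth_eqI(1)[OF ik ps_less] by simp
  show kth: "\<And>n. n < k \<Longrightarrow> kth (ik P) n = ps g n" using kth_eqI(2)[OF ik ps_less] by simp
  fix n assume n: "n \<le> k"
  have l: "lo g n = (if n = 0 then 0 else kth (ik P) (n - 1) + 1)"
    using kth[of "n - 1"] n by (cases n) (auto simp: lo_Suc)
  show "sec P k n = g n"
    unfolding sec_eqI[OF n l]
  proof (intro allI iffI)
    fix q w assume q: "0 # q # w \<in> g n"
    then have less: "lo g n + q < ps g n" using degree_bound g n by (auto simp: ps_def)
    then have "(lo g n + q) # w \<in> block g k" using block_sector[OF n, of "lo g n + q"] q by simp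
    then show "(lo g n + q) # w \<in> P \<and> (n < k \<longrightarrow> lo g n + q < kth (ik P) n)"
      using pextD(2)[OF P] less kth by auto
  next
    fix q w assume q: "(lo g n + q) # w \<in> P \<and> (n < k \<longrightarrow> lo g n + q < kth (ik P) n)"
    have np: "lo g n + q \<noteq> ps g m" if "m < k" for m
    proof
      assume e: "lo g n + q = ps g m"
      show False
      proof (cases "n < k")
        case True
        then have "m = n" using position_unique[of g n "ps g m" m] q kth[OF True] e lo_le_ps[of g m] by simp
        then show ?thesis using q e kth True by simp
      next
        case False
        then show ?thesis using n e that ps_less_lo[of m k g] by simp
      qed
    qed
    have "lo g n + q < ps g n"
    proof (cases "n < k")
      case True then show ?thesis using q kth by simp
    next
      case False
      then have "n = k" using n by simp
      then show ?thesis using q mem[OF np] block_beyond[of "lo g n + q" w] by (meson not_le)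
    qed
    then show "0 # q # w \<in> g n" using block_sector[OF n, of "lo g n + q" w] mem[OF np] q by simp
  qed
qed

text \<open>The converse. The positions of the infinite children are not given; they are recovered
  from the sector trees, whose degrees at \<open>[0]\<close> are the gaps between consecutive
  infinite children.\<close>

lemma sec_imp_pext_block:
  assumes P: "ptree P" and card: "card (ik P) = k" and sec: "\<And>n. n \<le> k \<Longrightarrow> sec P k n = g n"
  shows "P \<in> pext (block g k) (ports g k)" "\<And>n. n < k \<Longrightarrow> infinite (subt P [ps g n])"
proof -
  let ?K = "kth (ik P)"
  define l where "l n = (if n = 0 then 0 else ?K (n - 1) + 1)" for n
  note fin = finite_ik[OF P]
  have mem: "0 # q # w \<in> g n \<longleftrightarrow> (l n + q) # w \<in> P \<and> (n < k \<longrightarrow> l n + q < ?K n)" if "n \<le> k" for n q w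
    using sec[OF that] sec_eqI[OF that l_def[of n]] by blast
  have inf: "infinite (subt P [?K n])" if "n < k" for n
    using kth_mem[OF fin, of n] card that by (simp add: ik_def)
  have inP: "[?K n] \<in> P" if n: "n < k" for n
  proof -
    obtain w where "w \<in> subt P [?K n]" using inf[OF n] by (metis finite.emptyI ex_in_conv)
    then show ?thesis using ptree_appendD[OF P, of "[?K n]" w] by simp
  qed
  have deg: "?K n = l n + dg g n" if n: "n < k" for n
  proof -
    have "l n \<le> ?K n" using kth_less[OF fin, of "n - 1" n] n card by (auto simp: l_def Suc_le_eq)
    have "[0] @ [q] \<in> g n \<longleftrightarrow> l n + q < ?K n" for q
    proof -
      have "[l n + q] \<in> P" if "l n + q < ?K n"
        using ptree_sibling[OF P, of "[]" "?K n" "l n + q"] inP[OF n] that by simp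
      moreover have "[0, q] \<in> g n \<longleftrightarrow> [l n + q] \<in> P \<and> (n < k \<longrightarrow> l n + q < ?K n)"
        using mem[of n q "[]"] n by (meson less_imp_le)
      ultimately show ?thesis using n by (metis append_Cons append_Nil)
    qed
    then have "{q. [0] @ [q] \<in> g n} = {q. l n + q < ?K n}" by (simp only:)
    also have "\<dots> = {..<?K n - l n}" by (auto simp: less_diff_conv add.commute)
    finally have "dg g n = ?K n - l n" unfolding dg_def nch_def by simp
    then show ?thesis using \<open>l n \<le> ?K n\<close> by simp
  qed
  have l: "l n = lo g n" if "n \<le> k" for n
    using that
  proof (induction n)
    case (Suc n)
    then have "?K n = ps g n" using deg[of n] by (simp add: ps_def)
    then show ?case by (simp add: l_def lo_Suc)
  qed (simp add: l_def)
  have K: "?K n = ps g n" if "n < k" for n using deg[OF that] l[of n] that by (simp add: ps_def)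
  show "\<And>n. n < k \<Longrightarrow> infinite (subt P [ps g n])" using inf K by simp
  have "block g k \<subseteq> P"
  proof
    fix w assume "w \<in> block g k"
    then consider "w = []" | m where "m < k" "w = [ps g m]" | m p v where "m \<le> k" "w = (lo g m + p) # v" "0 # p # v \<in> g m"
      unfolding block_def by auto
    then show "w \<in> P"
    proof cases
      case 1 then show ?thesis using ptree_Nil[OF P] by simp
    next
      case 2 then show ?thesis using inP K by simp
    next
      case 3 then show ?thesis using mem[of m p v] l by simp
    qed
  qed
  moreover have "w \<in> block g k \<or> (\<exists>u\<in>ports g k. prefix u w)" if w: "w \<in> P" for w
  proof (cases w)
    case Nil then show ?thesis by (simp add: block_def)
  next
    case (Cons a v)
    show ?thesis
    proof (cases rule: position_cases[of k g a])
      case (sector n)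
      then have "0 # (a - lo g n) # v \<in> g n" using mem[of n "a - lo g n" v] l[of n] K[of n] w Cons by simp
      then show ?thesis using block_sector[OF sector] Cons by simp
    next
      case (port n)
      then have "[a] \<in> ports g k" "prefix [a] w" using Cons by (auto simp: ports_def)
      then show ?thesis by blast
    next
      case beyond
      then have "lo g k \<le> a" using lo_le_ps[of g k] by simp
      then have "0 # (a - lo g k) # v \<in> g k" using mem[of k "a - lo g k" v] l[of k] w Cons by simp
      then have "a - lo g k < dg g k" using degree_bound g by blast
      then show ?thesis using beyond \<open>lo g k \<le> a\<close> by (simp add: ps_def)
    qed
  qed
  ultimately show "P \<in> pext (block g k) (ports g k)" using P by (simp add: pext_def)
qed

end

section \<open>The size of the block\<close>

lemma strip_image:
  "(\<lambda>v. (c + hd (tl v)) # tl (tl v)) ` {v \<in> X. \<exists>p w. v = (0 :: nat) # p # w} = {(c + p) # w | p w. 0 # p # w \<in> X}"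
  for c :: nat
proof (intro set_eqI iffI)
  fix x assume "x \<in> {(c + p) # w | p w. 0 # p # w \<in> X}"
  then obtain p w where "x = (c + p) # w" "0 # p # w \<in> X" by blast
  then show "x \<in> (\<lambda>v. (c + hd (tl v)) # tl (tl v)) ` {v \<in> X. \<exists>p w. v = (0 :: nat) # p # w}"
    by (intro image_eqI[of _ _ "0 # p # w"]) auto
qed auto

lemma block_Suc:
  "block g (Suc k) = insert [ps g k] (block g k \<union> (\<lambda>v. (lo g (Suc k) + hd (tl v)) # tl (tl v)) ` {v \<in> g (Suc k). \<exists>p w. v = 0 # p # w})"
  (is "_ = ?R")
proof
  show "block g (Suc k) \<subseteq> ?R"
  proof
    fix w assume "w \<in> block g (Suc k)"
    then consider "w = []" | m where "m < Suc k" "w = [ps g m]"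
      | m p v where "m \<le> Suc k" "w = (lo g m + p) # v" "0 # p # v \<in> g m"
      unfolding block_def by auto
    then show "w \<in> ?R"
    proof cases
      case 3
      then show ?thesis
        by (cases "m = Suc k") (auto simp: block_def intro!: image_eqI[where x = "0 # p # v"])
    qed (auto simp: block_def less_Suc_eq)
  qed
  have "block g k \<subseteq> block g (Suc k)" unfolding block_def by (auto simp: less_Suc_eq le_Suc_eq)
  moreover have "[ps g k] \<in> block g (Suc k)" unfolding block_def by blast
  moreover have "(\<lambda>v. (lo g (Suc k) + hd (tl v)) # tl (tl v)) ` {v \<in> g (Suc k). \<exists>p w. v = 0 # p # w} \<subseteq> block g (Suc k)"
    unfolding strip_image block_def by blast
  ultimately show "?R \<subseteq> block g (Suc k)" by blast
qed

lemma tree_nontrivial_part: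
  assumes T: "is_tree T" "finite T"
  shows "{v \<in> T. \<exists>p w. v = 0 # p # w} = T - {[], [0]}" "card (T - {[], [0]}) + 2 = card T"
proof -
  show "{v \<in> T. \<exists>p w. v = 0 # p # w} = T - {[], [0]}" by (auto elim: tree_cases[OF T(1)])
  have "{[], [0]} \<subseteq> T" using T by (auto simp: is_tree_root_edge ptree_Nil is_tree_ptree)
  then have "card (T - {[], [0]}) = card T - card {[], [0 :: nat]}" "card {[], [0 :: nat]} \<le> card T"
    using T(2) card_mono[of T "{[], [0]}"] by (simp_all only: card_Diff_subset finite.intros)
  then show "card (T - {[], [0]}) + 2 = card T" by simp
qed

text \<open>Each of the k + 1 sector trees contributes all its vertices but \<open>[]\<close> and
  \<open>[0]\<close>, and the root and k spine children are added: 1 + k - 2 (k + 1) = - (k +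
  1).\<close>

lemma card_block:
  assumes "\<And>n. n \<le> k \<Longrightarrow> is_tree (g n) \<and> finite (g n)"
  shows "card (block g k) + k + 1 = (\<Sum>n\<le>k. card (g n))"
  using assms
proof (induction k)
  case 0
  have "block g 0 = insert [] ((\<lambda>v. hd (tl v) # tl (tl v)) ` {v \<in> g 0. \<exists>p w. v = 0 # p # w})"
    using strip_image[of 0 "g 0"] unfolding block_def by simp
  also have "card \<dots> = Suc (card ((\<lambda>v. hd (tl v) # tl (tl v)) ` {v \<in> g 0. \<exists>p w. v = 0 # p # w}))"
    using 0 by (subst card_insert_disjoint) auto
  also have "card ((\<lambda>v. hd (tl v) # tl (tl v)) ` {v \<in> g 0. \<exists>p w. v = 0 # p # w}) = card {v \<in> g 0. \<exists>p w. v = 0 # p # w}"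
    by (rule card_image) (auto simp: inj_on_def)
  finally show ?case using tree_nontrivial_part[of "g 0"] 0 by simp
next
  case (Suc k)
  let ?h = "\<lambda>v. (lo g (Suc k) + hd (tl v)) # tl (tl v)"
  let ?N = "{v \<in> g (Suc k). \<exists>p w. v = 0 # p # w}"
  have IH: "card (block g k) + k + 1 = (\<Sum>n\<le>k. card (g n))" using Suc by simp
  have gk: "\<And>n. n \<le> k \<Longrightarrow> is_tree (g n) \<and> finite (g n)" using Suc.prems by simp
  have fin: "finite (block g k)" using finite_block[OF gk] .
  have disj1: "block g k \<inter> ?h ` ?N = {}"
  proof -
    have "ps g k \<le> lo g (Suc k) + p" for p by (simp add: lo_Suc)
    then show ?thesis using block_beyond[OF gk] by fastforce
  qed
  have disj2: "[ps g k] \<notin> block g k \<union> ?h ` ?N"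
    using block_beyond[OF gk, where a = "ps g k" and w = "[]"] by (auto simp: lo_Suc)
  have "card (block g (Suc k)) = Suc (card (block g k \<union> ?h ` ?N))"
    unfolding block_Suc using disj2 fin Suc.prems[of "Suc k"] by (subst card_insert_disjoint) auto
  also have "card (block g k \<union> ?h ` ?N) = card (block g k) + card (?h ` ?N)"
    using disj1 fin Suc.prems[of "Suc k"] by (intro card_Un_disjoint) auto
  also have "card (?h ` ?N) = card ?N" by (rule card_image) (auto simp: inj_on_def)
  finally have "card (block g (Suc k)) = Suc (card (block g k) + card ?N)" .
  moreover have "card ?N + 2 = card (g (Suc k))" using tree_nontrivial_part[of "g (Suc k)"] Suc.prems[of "Suc k"] by simp
  ultimately show ?case using IH by simp
qed

section \<open>The spine\<close>

lemma infv_iff: "ptree T \<Longrightarrow> v \<in> infv T \<longleftrightarrow> infinite (subt T v)"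
proof -
  assume T: "ptree T"
  have "{w \<in> T. \<exists>u. w = v @ u} = (@) v ` subt T v" by auto
  then have "infinite {w \<in> T. \<exists>u. w = v @ u} \<longleftrightarrow> infinite (subt T v)"
    by (simp add: finite_image_iff inj_on_def)
  moreover have "v \<in> T" if inf: "infinite (subt T v)"
  proof -
    obtain w where "w \<in> subt T v" using infinite_imp_nonempty[OF inf] by blast
    then show ?thesis using ptree_appendD[OF T] by simp
  qed
  ultimately show ?thesis unfolding infv_def by blast
qed

lemma infinite_subt_child: "infinite (subt T (v @ [a])) \<Longrightarrow> infinite (subt T v)"
proof
  assume "infinite (subt T (v @ [a]))" "finite (subt T v)"
  moreover have "(#) a ` subt T (v @ [a]) \<subseteq> subt T v" by auto
  ultimately show False by (metis finite_imageD finite_subset inj_on_Cons1 list.inject inj_onI)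
qed

lemma unrank_snoc: "unrank V u (w @ [k]) = unrank V u w @ [kth {a. unrank V u w @ [a] \<in> V} k]"
  by (induction w arbitrary: u) (simp_all add: kth_child_def kth_def rank_def)

lemma relab_snoc: "relab V u (w @ [a]) = relab V u w @ [rank {b. u @ w @ [b] \<in> V} a]"
  by (induction w arbitrary: u) (simp_all add: rank_def)

lemma spv_Nil [simp]: "spv T [] = []"
  by (simp add: spv_def)

lemma spv_snoc: "ptree T \<Longrightarrow> spv T (i @ [k]) = spv T i @ [kth (ik (subt T (spv T i))) k]"
  by (simp add: spv_def unrank_snoc infv_iff ik_def subt_subt)

lemma relab_infv_snoc: "ptree T \<Longrightarrow> relab (infv T) [] (w @ [a]) = relab (infv T) [] w @ [rank (ik (subt T w)) a]"
  by (simp add: relab_snoc infv_iff ik_def subt_subt)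

lemma spv_relab: "ptree T \<Longrightarrow> infinite (subt T w) \<Longrightarrow> spv T (relab (infv T) [] w) = w"
proof (induction w rule: rev_induct)
  case (snoc a w)
  then show ?case using infinite_subt_child[of T w a]
    by (simp add: relab_infv_snoc spv_snoc kth_rank ik_def subt_subt)
qed simp

lemma ptree_subt_infinite: "ptree T \<Longrightarrow> infinite (subt T v) \<Longrightarrow> ptree (subt T v)"
  using infv_iff[of T v] ptree_subt by (auto simp: infv_def)

text \<open>\<open>spv\<close> is total and has arbitrary values on words outside the spine;
  demanding that relabelling returns \<open>i\<close> excludes these.\<close>

lemma in_chi_iff: "ptree T \<Longrightarrow> i \<in> chi T \<longleftrightarrow> infinite (subt T (spv T i)) \<and> relab (infv T) [] (spv T i) = i"
  unfolding chi_def normalize_def using spv_relab by (force simp: infv_iff image_iff)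

lemma Nil_in_chi: "ptree T \<Longrightarrow> infinite T \<Longrightarrow> [] \<in> chi T"
  by (simp add: in_chi_iff)

text \<open>This turns the relabelled image \<open>chi T\<close> into a recursion along words, in
  which only the number of infinite children at \<open>spv T i\<close> matters.\<close>

lemma snoc_in_chi:
  assumes T: "ptree T"
  shows "i @ [k] \<in> chi T \<longleftrightarrow> i \<in> chi T \<and> k < card (ik (subt T (spv T i)))"
proof -
  let ?A = "ik (subt T (spv T i))"
  have fin: "finite ?A" if "infinite (subt T (spv T i))" using finite_ik[OF ptree_subt_infinite[OF T that]] .
  have mem: "infinite (subt T (spv T i @ [a])) \<longleftrightarrow> a \<in> ?A" for a by (simp add: ik_def subt_subt)
  have "i @ [k] \<in> chi T \<longleftrightarrow> kth ?A k \<in> ?A \<and> relab (infv T) [] (spv T i) = i \<and> rank ?A (kth ?A k) = k"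
    by (simp add: in_chi_iff[OF T] spv_snoc[OF T] relab_infv_snoc[OF T] mem)
  also have "\<dots> \<longleftrightarrow> infinite (subt T (spv T i)) \<and> relab (infv T) [] (spv T i) = i \<and> k < card ?A"
  proof
    assume *: "kth ?A k \<in> ?A \<and> relab (infv T) [] (spv T i) = i \<and> rank ?A (kth ?A k) = k"
    then have inf: "infinite (subt T (spv T i))" using infinite_subt_child mem by blast
    then show "infinite (subt T (spv T i)) \<and> relab (infv T) [] (spv T i) = i \<and> k < card ?A"
      using rank_less_card[OF fin] * by metis
  next
    assume *: "infinite (subt T (spv T i)) \<and> relab (infv T) [] (spv T i) = i \<and> k < card ?A"
    then show "kth ?A k \<in> ?A \<and> relab (infv T) [] (spv T i) = i \<and> rank ?A (kth ?A k) = k"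
      using kth_mem[OF fin] by blast
  qed
  also have "\<dots> \<longleftrightarrow> i \<in> chi T \<and> k < card ?A" by (auto simp: in_chi_iff[OF T])
  finally show ?thesis .
qed

lemma sector_branch_sec:
  "ptree T \<Longrightarrow> sector_branch T0 T i n = sec (subt T (spv T i)) (nch T0 i) n"
  unfolding sector_branch_def sec_def Let_def by (simp add: spv_snoc)

section \<open>Counting vertices and sectors level by level\<close>

lemma Dlev_Suc:
  assumes "ptree T" shows "Dlev (Suc d) T = (\<lambda>(i, k). i @ [k]) ` (SIGMA i:Dlev d T. {..<nch T i})"
proof (intro set_eqI iffI)
  fix w assume w: "w \<in> Dlev (Suc d) T"
  then obtain i k where ik: "w = i @ [k]" by (cases w rule: rev_cases) (auto simp: Dlev_def)
  then have "i \<in> Dlev d T" "k < nch T i"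
    using w ptree_snocD[OF assms, of i k] ptree_child_iff[OF assms, of i k] by (auto simp: Dlev_def)
  then show "w \<in> (\<lambda>(i, k). i @ [k]) ` (SIGMA i:Dlev d T. {..<nch T i})" using ik by force
next
  fix w assume "w \<in> (\<lambda>(i, k). i @ [k]) ` (SIGMA i:Dlev d T. {..<nch T i})"
  then show "w \<in> Dlev (Suc d) T"
    using ptree_child_iff[OF assms] by (auto simp: Dlev_def)
qed

lemma finite_Dlev: "ptree T \<Longrightarrow> finite (Dlev d T)"
  unfolding Dlev_def by (rule ptree_level_finite)

lemma card_Dlev_Suc: "ptree T \<Longrightarrow> card (Dlev (Suc d) T) = (\<Sum>i\<in>Dlev d T. nch T i)"
  unfolding Dlev_Suc by (subst card_image) (auto simp: inj_on_def finite_Dlev)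

lemma Bball_Suc: "Bball (Suc d) T = Bball d T \<union> Dlev (Suc d) T"
  by (auto simp: Bball_def Dlev_def)

lemma card_Bball_Suc: "ptree T \<Longrightarrow> card (Bball (Suc d) T) = card (Bball d T) + (\<Sum>i\<in>Dlev d T. nch T i)"
  unfolding Bball_Suc card_Dlev_Suc[symmetric]
  by (rule card_Un_disjoint) (auto simp: ptree_Bball_finite finite_Dlev, auto simp: Bball_def Dlev_def)

lemma sectors_Suc: "1 \<le> d \<Longrightarrow> sectors T (Suc d) = sectors T d \<union> (SIGMA i:Dlev d T. {..nch T i})"
  by (auto simp: sectors_def Dlev_def)

lemma sectors_disjoint: "sectors T d \<inter> (SIGMA i:Dlev d T. {..nch T i}) = {}"
  by (auto simp: sectors_def Dlev_def)

lemma finite_sectors: "ptree T \<Longrightarrow> finite (sectors T d)"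
proof -
  assume T: "ptree T"
  have "sectors T d \<subseteq> (SIGMA i:Bball d T. {..nch T i})" by (auto simp: sectors_def Bball_def)
  then show ?thesis by (rule finite_subset) (use ptree_Bball_finite[OF T] in auto)
qed

lemma sectors_1: "sectors T (Suc 0) = {}"
  by (auto simp: sectors_def)

lemma Dlev_1: "is_tree T \<Longrightarrow> Dlev (Suc 0) T = {[0]}"
  by (auto simp: Dlev_def length_Suc_conv is_tree_root_edge)

lemma tree_Bball_1: "is_tree T \<Longrightarrow> Bball (Suc 0) T = {[], [0]}"
proof -
  assume T: "is_tree T"
  have "Bball 0 T = {[]}" using ptree_Nil[OF is_tree_ptree[OF T]] by (auto simp: Bball_def)
  then show ?thesis by (auto simp: Bball_Suc Dlev_1[OF T])
qed

text \<open>A vertex with k children has k + 1 sectors, so a level adds as many sectors as it has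
  children and vertices together. At the full height this is \<sigma> = 2|T0| - R - 1, because the
  number of vertices exceeds that of edges by 1.\<close>

lemma card_sectors:
  assumes T: "is_tree T" and d: "1 \<le> d"
  shows "card (sectors T d) + card (Dlev d T) + 3 = 2 * card (Bball d T)"
  using d
proof (induction d rule: dec_induct)
  case base
  then show ?case by (simp add: sectors_1 Dlev_1[OF T] tree_Bball_1[OF T])
next
  case (step d)
  have pT: "ptree T" using T is_tree_ptree by blast
  have "card (sectors T (Suc d)) = card (sectors T d) + card (SIGMA i:Dlev d T. {..nch T i})"
    unfolding sectors_Suc[OF step(1)]
    by (rule card_Un_disjoint) (use finite_sectors[OF pT] finite_Dlev[OF pT] sectors_disjoint in auto)
  also have "card (SIGMA i:Dlev d T. {..nch T i}) = (\<Sum>i\<in>Dlev d T. nch T i) + card (Dlev d T)"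
    using finite_Dlev[OF pT] by (simp add: sum_Suc)
  finally show ?case using step by (simp add: card_Bball_Suc[OF pT] card_Dlev_Suc[OF pT])
qed

section \<open>Grafting the prescribed finite branches along the spine, by induction on the
  height\<close>

definition spine_event :: "tree \<Rightarrow> nat \<Rightarrow> (nat list \<times> nat \<Rightarrow> tree) \<Rightarrow> tree \<Rightarrow> bool" where
  "spine_event T0 d t T \<longleftrightarrow> infinite T \<and> Bball d (chi T) = Bball d T0
     \<and> (\<forall>(i, n)\<in>sectors T0 d. sector_branch T0 T i n = t (i, n))"

text \<open>\<open>S\<close> is the tree \<open>T0\<close>, cut at height \<open>d\<close>, with the tree \<open>t q\<close> grafted into every sector \<open>q\<close>
  below height \<open>d\<close>; \<open>\<phi> i\<close> is the vertex of \<open>S\<close> that corresponds to the vertex \<open>i\<close> of \<open>T0\<close>.\<close>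

definition spine_core :: "tree \<Rightarrow> nat \<Rightarrow> (nat list \<times> nat \<Rightarrow> tree) \<Rightarrow> tree \<Rightarrow> (nat list \<Rightarrow> nat list) \<Rightarrow> bool" where
  "spine_core T0 d t S \<phi> \<longleftrightarrow> is_tree S \<and> finite S \<and> \<phi> ` Dlev d T0 \<subseteq> ends S \<and> inj_on \<phi> (Dlev d T0)
     \<and> (\<forall>i\<in>Dlev d T0. length (\<phi> i) = d)
     \<and> card S + 2 * card (sectors T0 d) = card (Bball d T0) + (\<Sum>q\<in>sectors T0 d. card (t q))
     \<and> (\<forall>T. is_tree T \<longrightarrow>
          (T \<in> pext S (\<phi> ` Dlev d T0) \<and> (\<forall>i\<in>Dlev d T0. infinite (subt T (\<phi> i))) \<longleftrightarrow> spine_event T0 d t T)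
        \<and> (spine_event T0 d t T \<longrightarrow> (\<forall>i\<in>Dlev d T0. spv T i = \<phi> i)))"

lemma infinite_tree_ik:
  assumes T: "is_tree T" "infinite T" shows "ik T = {0}"
proof -
  have "infinite (subt T [0])" using plant_subt[OF T(1)] finite_plant T(2) by metis
  moreover have "a = 0" if "infinite (subt T [a])" for a
  proof -
    have "[a] \<in> infv T" using infv_iff[OF is_tree_ptree[OF T(1)]] that by simp
    then show ?thesis using T(1) by (auto simp: infv_def is_tree_root_edge)
  qed
  ultimately show ?thesis by (auto simp: ik_def)
qed

lemma kth_singleton: "kth {a} 0 = a"
proof -
  have "{b. b < a \<and> b \<in> {a}} = {}" by auto
  then have "rank {a} a = 0" unfolding rank_def by (simp only: card.empty)
  then show ?thesis using kth_rank[of a "{a}"] by simp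
qed

text \<open>At height 1 there are no sectors yet, and the root edge begins the spine of every
  infinite tree.\<close>

lemma spine_core_1:
  assumes T0: "is_tree T0" shows "spine_core T0 (Suc 0) t {[], [0]} (\<lambda>i. i)"
proof -
  have S: "is_tree {[], [0]}"
  proof -
    have "ptree {[]}" by (auto simp: ptree_def)
    from is_tree_plant[OF this] show ?thesis by (simp add: plant_def insert_commute)
  qed
  have 1: "T \<in> pext {[], [0]} {[0]} \<and> (infinite (subt T [0]) \<longleftrightarrow> infinite T)" if T: "is_tree T" for T
  proof -
    have "w \<in> {[], [0]} \<or> (\<exists>u\<in>{[0]}. prefix u w)" if "w \<in> T" for w
      using tree_cases[OF T that] by cases auto
    then have "T \<in> pext {[], [0]} {[0]}" using T is_tree_ptree[OF T] ptree_Nil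
      by (auto simp: pext_def is_tree_root_edge)
    moreover have "infinite (subt T [0]) \<longleftrightarrow> infinite T" using plant_subt[OF T] finite_plant by metis
    ultimately show ?thesis by blast
  qed
  have 2: "Bball (Suc 0) (chi T) = {[], [0]} \<and> spv T [0] = [0]" if T: "is_tree T" "infinite T" for T
  proof -
    note pT = is_tree_ptree[OF T(1)]
    have "[k] \<in> chi T \<longleftrightarrow> k = 0" for k
      using snoc_in_chi[OF pT, of "[]" k] Nil_in_chi[OF pT T(2)] by (simp add: infinite_tree_ik[OF T])
    then have "w \<in> Bball (Suc 0) (chi T) \<longleftrightarrow> w \<in> {[], [0]}" for w
      using Nil_in_chi[OF pT T(2)] by (cases w) (auto simp: Bball_def)
    moreover have "spv T [0] = [0]"
      using spv_snoc[OF pT, of "[]" 0] by (simp add: infinite_tree_ik[OF T] kth_singleton)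
    ultimately show ?thesis by blast
  qed
  show ?thesis unfolding spine_core_def spine_event_def
    using S 1 2 by (auto simp: Dlev_1[OF T0] tree_Bball_1[OF T0] sectors_1 ends_def)
qed

lemma Bball_chi_Suc:
  assumes T: "ptree T" and T0: "ptree T0"
  shows "Bball (Suc d) (chi T) = Bball (Suc d) T0 \<longleftrightarrow>
     Bball d (chi T) = Bball d T0 \<and> (\<forall>i\<in>Dlev d T0. card (ik (subt T (spv T i))) = nch T0 i)"
proof (intro iffI conjI ballI)
  assume *: "Bball (Suc d) (chi T) = Bball (Suc d) T0"
  have mem: "w \<in> chi T \<longleftrightarrow> w \<in> T0" if "length w \<le> Suc d" for w
    using * that by (auto simp: Bball_def set_eq_iff)
  then show "Bball d (chi T) = Bball d T0" by (auto simp: Bball_def)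
  fix i assume i: "i \<in> Dlev d T0"
  then have "i \<in> chi T" using mem by (auto simp: Dlev_def)
  then have "k < card (ik (subt T (spv T i))) \<longleftrightarrow> k < nch T0 i" for k
    using mem[of "i @ [k]"] i snoc_in_chi[OF T, of i k] ptree_child_iff[OF T0, of i k] by (simp add: Dlev_def)
  then show "card (ik (subt T (spv T i))) = nch T0 i" by (metis less_irrefl linorder_neqE_nat)
next
  assume *: "Bball d (chi T) = Bball d T0 \<and> (\<forall>i\<in>Dlev d T0. card (ik (subt T (spv T i))) = nch T0 i)"
  have mem: "w \<in> chi T \<longleftrightarrow> w \<in> T0" if "length w \<le> d" for w
    using * that by (auto simp: Bball_def set_eq_iff)
  have "w \<in> chi T \<longleftrightarrow> w \<in> T0" if w: "length w = Suc d" for w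
  proof -
    obtain i k where ik: "w = i @ [k]" "length i = d" using w by (cases w rule: rev_cases) auto
    have "w \<in> chi T \<longleftrightarrow> i \<in> T0 \<and> k < card (ik (subt T (spv T i)))"
      using snoc_in_chi[OF T] mem[of i] ik by simp
    also have "\<dots> \<longleftrightarrow> i \<in> T0 \<and> k < nch T0 i" using * ik by (auto simp: Dlev_def)
    also have "\<dots> \<longleftrightarrow> w \<in> T0" using ptree_child_iff[OF T0, of i k] ptree_snocD[OF T0, of i k] ik by auto
    finally show ?thesis .
  qed
  then show "Bball (Suc d) (chi T) = Bball (Suc d) T0" using mem by (auto simp: Bball_def le_Suc_eq)
qed

text \<open>Every end \<open>\<phi> i\<close> is expanded by the block of \<open>i\<close>, whose
  ports become the ends for the children of \<open>i\<close>. By the two block lemmas, this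
  condition says exactly that the next spine level and the sectors at height \<open>d\<close> are as
  prescribed.\<close>

lemma spine_core_Suc:
  assumes T0: "is_tree T0" and d: "1 \<le> d" and core: "spine_core T0 d t S \<phi>"
    and nch: "\<And>i. i \<in> Dlev d T0 \<Longrightarrow> nch T0 i \<ge> 1"
    and t: "\<And>q. q \<in> sectors T0 (Suc d) \<Longrightarrow> is_tree (t q) \<and> finite (t q)"
  shows "\<exists>S' \<phi>'. spine_core T0 (Suc d) t S' \<phi>'"
proof -
  let ?D = "Dlev d T0"
  let ?k = "\<lambda>i. nch T0 i"
  let ?g = "\<lambda>i n. t (i, n)"
  note pT0 = is_tree_ptree[OF T0]
  have S: "is_tree S" "finite S" and U: "\<phi> ` ?D \<subseteq> ends S" and inj: "inj_on \<phi> ?D"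
    and len: "\<And>i. i \<in> ?D \<Longrightarrow> length (\<phi> i) = d"
    and cardS: "card S + 2 * card (sectors T0 d) = card (Bball d T0) + (\<Sum>q\<in>sectors T0 d. card (t q))"
    and ev: "\<And>T. is_tree T \<Longrightarrow> T \<in> pext S (\<phi> ` ?D) \<and> (\<forall>i\<in>?D. infinite (subt T (\<phi> i))) \<longleftrightarrow> spine_event T0 d t T"
    and spv: "\<And>T i. is_tree T \<Longrightarrow> spine_event T0 d t T \<Longrightarrow> i \<in> ?D \<Longrightarrow> spv T i = \<phi> i"
    using core unfolding spine_core_def by blast+
  note pS = is_tree_ptree[OF S(1)]
  \<comment> \<open>A graft is indexed by vertices of \<open>S\<close>, so the vertex
    \<open>i\<close> of \<open>T0\<close> has to be recovered from \<open>\<phi> i\<close>.\<close>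
  define \<psi> where "\<psi> = the_inv_into ?D \<phi>"
  have \<psi>: "\<psi> (\<phi> i) = i" if "i \<in> ?D" for i using the_inv_into_f_f[OF inj that] by (simp add: \<psi>_def)
  have g: "is_tree (?g i n) \<and> finite (?g i n)" if "i \<in> ?D" "n \<le> ?k i" for i n
    using t[of "(i, n)"] that d by (auto simp: sectors_Suc)
  have pb: "ptree (block (?g i) (?k i))" and fb: "finite (block (?g i) (?k i))"
    and pe: "ports (?g i) (?k i) \<subseteq> ends (block (?g i) (?k i))"
    and cb: "card (block (?g i) (?k i)) + ?k i + 1 = (\<Sum>n\<le>?k i. card (?g i n))" if "i \<in> ?D" for i
    using ptree_block[of "?k i" "?g i"] finite_block[of "?k i" "?g i"] ports_ends[of "?k i" "?g i"]
      card_block[of "?k i" "?g i"] g[OF that] by blast+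
  define f where "f x = block (?g (\<psi> x)) (?k (\<psi> x))" for x
  define V where "V x = ports (?g (\<psi> x)) (?k (\<psi> x))" for x
  define S' where "S' = graft S (\<phi> ` ?D) f"
  define \<phi>' where "\<phi>' j = \<phi> (butlast j) @ [ps (?g (butlast j)) (last j)]" for j
  have f: "ptree (f x)" "finite (f x)" "V x \<subseteq> ends (f x)" if x: "x \<in> \<phi> ` ?D" for x
  proof -
    obtain i where i: "i \<in> ?D" "x = \<phi> i" using x by blast
    show "ptree (f x)" "finite (f x)" "V x \<subseteq> ends (f x)"
      using pb[OF i(1)] fb[OF i(1)] pe[OF i(1)] by (simp_all only: f_def V_def i(2) \<psi>[OF i(1)])
  qed
  have U': "(\<phi> ` ?D - \<phi> ` ?D) \<union> {x @ v | x v. x \<in> \<phi> ` ?D \<and> v \<in> V x} = \<phi>' ` Dlev (Suc d) T0"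
  proof -
    let ?h = "\<lambda>(i, k). \<phi> i @ [ps (?g i) k]"
    have V: "V (\<phi> i) = (\<lambda>k. [ps (?g i) k]) ` {..<?k i}" if "i \<in> ?D" for i
      unfolding V_def \<psi>[OF that] ports_def ..
    have "{x @ v | x v. x \<in> \<phi> ` ?D \<and> v \<in> V x} = ?h ` (SIGMA i:?D. {..<?k i})"
    proof (intro set_eqI iffI)
      fix y assume "y \<in> {x @ v | x v. x \<in> \<phi> ` ?D \<and> v \<in> V x}"
      then obtain i v where i: "i \<in> ?D" "v \<in> V (\<phi> i)" "y = \<phi> i @ v" by blast
      then obtain k where "k < ?k i" "v = [ps (?g i) k]" using V[OF i(1)] by auto
      then show "y \<in> ?h ` (SIGMA i:?D. {..<?k i})"
        using i by (intro image_eqI[of _ _ "(i, k)"]) auto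
    next
      fix y assume "y \<in> ?h ` (SIGMA i:?D. {..<?k i})"
      then obtain i k where i: "i \<in> ?D" "k < ?k i" "y = \<phi> i @ [ps (?g i) k]" by auto
      then have "[ps (?g i) k] \<in> V (\<phi> i)" using V by simp
      then show "y \<in> {x @ v | x v. x \<in> \<phi> ` ?D \<and> v \<in> V x}" using i by blast
    qed
    also have "\<dots> = \<phi>' ` Dlev (Suc d) T0"
      unfolding Dlev_Suc[OF pT0] image_image by (rule image_cong) (auto simp: \<phi>'_def)
    finally show ?thesis by (simp only: Diff_cancel Un_empty_left)
  qed
  have 1: "is_tree S'" unfolding S'_def by (rule is_tree_graft[OF S(1) U f(1)])
  have 2: "finite S'" unfolding S'_def by (rule finite_graft) (use S finite_Dlev[OF pT0] f in auto)
  have 3: "\<phi>' ` Dlev (Suc d) T0 \<subseteq> ends S'"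
    unfolding U'[symmetric] S'_def by (rule ends_graft[OF pS subset_refl U f(1) f(3)])
  have 4: "inj_on \<phi>' (Dlev (Suc d) T0)"
  proof (rule inj_onI)
    fix x y assume xy: "x \<in> Dlev (Suc d) T0" "y \<in> Dlev (Suc d) T0" "\<phi>' x = \<phi>' y"
    obtain i k j l where ik: "x = i @ [k]" "i \<in> ?D" and jl: "y = j @ [l]" "j \<in> ?D"
      using xy(1,2) by (auto simp: Dlev_Suc[OF pT0])
    have "\<phi> i = \<phi> j" "ps (?g i) k = ps (?g j) l" using xy(3) ik jl by (auto simp: \<phi>'_def)
    then have "i = j" using inj ik jl by (auto dest: inj_onD)
    moreover have "k = l" using \<open>ps (?g i) k = ps (?g j) l\<close> \<open>i = j\<close> ps_less
      by (metis less_irrefl linorder_neqE_nat)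
    ultimately show "x = y" using ik jl by simp
  qed
  have 5: "length (\<phi>' j) = Suc d" if "j \<in> Dlev (Suc d) T0" for j
    using that len by (auto simp: \<phi>'_def Dlev_Suc[OF pT0])
  have 6: "card S' + 2 * card (sectors T0 (Suc d)) = card (Bball (Suc d) T0) + (\<Sum>q\<in>sectors T0 (Suc d). card (t q))"
  proof -
    note finD = finite_Dlev[OF pT0, of d]
    have "card S' + card (\<phi> ` ?D) = card S + (\<Sum>x\<in>\<phi> ` ?D. card (f x))"
      unfolding S'_def by (rule card_graft[OF pS U f(1) S(2) f(2)])
    also have "card (\<phi> ` ?D) = card ?D" by (rule card_image[OF inj])
    also have "(\<Sum>x\<in>\<phi> ` ?D. card (f x)) = (\<Sum>i\<in>?D. card (block (?g i) (?k i)))"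
      by (simp add: sum.reindex[OF inj] f_def \<psi>)
    finally have a: "card S' + card ?D = card S + (\<Sum>i\<in>?D. card (block (?g i) (?k i)))" .
    have "(\<Sum>i\<in>?D. card (block (?g i) (?k i))) + (\<Sum>i\<in>?D. ?k i) + card ?D
        = (\<Sum>i\<in>?D. card (block (?g i) (?k i)) + ?k i + 1)"
      by (simp add: sum.distrib sum_Suc)
    also have "\<dots> = (\<Sum>i\<in>?D. \<Sum>n\<le>?k i. card (?g i n))" by (intro sum.cong refl cb)
    also have "\<dots> = (\<Sum>q\<in>(SIGMA i:?D. {..?k i}). card (t q))"
      using finD by (simp add: sum.Sigma case_prod_beta')
    finally have b: "(\<Sum>i\<in>?D. card (block (?g i) (?k i))) + (\<Sum>i\<in>?D. ?k i) + card ?D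
        = (\<Sum>q\<in>(SIGMA i:?D. {..?k i}). card (t q))" .
    have finS: "finite (SIGMA i:?D. {..?k i})" using finD by auto
    have c: "(\<Sum>q\<in>sectors T0 (Suc d). card (t q)) = (\<Sum>q\<in>sectors T0 d. card (t q)) + (\<Sum>q\<in>(SIGMA i:?D. {..?k i}). card (t q))"
      unfolding sectors_Suc[OF d] by (rule sum.union_disjoint[OF finite_sectors[OF pT0] finS sectors_disjoint])
    have "card (sectors T0 (Suc d)) = card (sectors T0 d) + card (SIGMA i:?D. {..?k i})"
      unfolding sectors_Suc[OF d] by (rule card_Un_disjoint[OF finite_sectors[OF pT0] finS sectors_disjoint])
    also have "card (SIGMA i:?D. {..?k i}) = (\<Sum>i\<in>?D. ?k i) + card ?D"
      using finD by (simp add: sum_Suc)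
    finally have e: "card (sectors T0 (Suc d)) = card (sectors T0 d) + ((\<Sum>i\<in>?D. ?k i) + card ?D)" .
    show ?thesis using a b c e cardS card_Bball_Suc[OF pT0, of d] by linarith
  qed
  have 7: "(T \<in> pext S' (\<phi>' ` Dlev (Suc d) T0) \<and> (\<forall>j\<in>Dlev (Suc d) T0. infinite (subt T (\<phi>' j))) \<longleftrightarrow> spine_event T0 (Suc d) t T)
      \<and> (spine_event T0 (Suc d) t T \<longrightarrow> (\<forall>j\<in>Dlev (Suc d) T0. spv T j = \<phi>' j))" if T: "is_tree T" for T
  proof -
    note pT = is_tree_ptree[OF T]
    let ?loc = "\<lambda>P i. card (ik P) = ?k i \<and> (\<forall>n\<le>?k i. sec P (?k i) n = ?g i n)"
    have locI: "?loc P i \<and> infinite P \<and> (\<forall>n<?k i. kth (ik P) n = ps (?g i) n)"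
      if i: "i \<in> ?D" and P: "P \<in> pext (block (?g i) (?k i)) (ports (?g i) (?k i))"
        "\<forall>n<?k i. infinite (subt P [ps (?g i) n])" for P i
    proof -
      \<comment> \<open>Here \<open>nch T0 i \<ge> 1\<close> enters: a port makes the subtree at
        \<open>\<phi> i\<close> infinite, as the event at height \<open>d\<close> requires.\<close>
      have "infinite (subt P ([] @ [ps (?g i) 0]))" using P(2) nch[OF i] by simp
      from infinite_subt_child[OF this] have "infinite P" by simp
      then show ?thesis using pext_block_imp_sec[of "?k i" "?g i" P] g[OF i] P by blast
    qed
    have locD: "P \<in> pext (block (?g i) (?k i)) (ports (?g i) (?k i)) \<and> (\<forall>n<?k i. infinite (subt P [ps (?g i) n]))"
      if i: "i \<in> ?D" and P: "ptree P" "?loc P i" for P i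
      using sec_imp_pext_block[of "?k i" "?g i" P] g[OF i] P by blast
    have A: "T \<in> pext S' (\<phi>' ` Dlev (Suc d) T0) \<and> (\<forall>j\<in>Dlev (Suc d) T0. infinite (subt T (\<phi>' j)))
      \<longleftrightarrow> T \<in> pext S (\<phi> ` ?D) \<and> (\<forall>i\<in>?D. subt T (\<phi> i) \<in> pext (block (?g i) (?k i)) (ports (?g i) (?k i))
          \<and> (\<forall>n<?k i. infinite (subt (subt T (\<phi> i)) [ps (?g i) n])))"
      (is "_ \<longleftrightarrow> ?R")
    proof -
      have "T \<in> pext S' (\<phi>' ` Dlev (Suc d) T0) \<longleftrightarrow> T \<in> pext S (\<phi> ` ?D) \<and> (\<forall>x\<in>\<phi> ` ?D. subt T x \<in> pext (f x) (V x))"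
        unfolding U'[symmetric] S'_def by (subst pext_graft[OF pS subset_refl U f(1)]) simp_all
      moreover have "(\<forall>x\<in>\<phi> ` ?D. subt T x \<in> pext (f x) (V x)) \<longleftrightarrow>
          (\<forall>i\<in>?D. subt T (\<phi> i) \<in> pext (block (?g i) (?k i)) (ports (?g i) (?k i)))"
        by (simp add: f_def V_def \<psi>)
      moreover have "(\<forall>j\<in>Dlev (Suc d) T0. infinite (subt T (\<phi>' j))) \<longleftrightarrow>
          (\<forall>i\<in>?D. \<forall>n<?k i. infinite (subt (subt T (\<phi> i)) [ps (?g i) n]))"
      proof -
        have "(\<forall>j\<in>Dlev (Suc d) T0. infinite (subt T (\<phi>' j))) \<longleftrightarrow>
            (\<forall>i\<in>?D. \<forall>n<?k i. infinite (subt T (\<phi>' (i @ [n]))))"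
          unfolding Dlev_Suc[OF pT0] by auto
        then show ?thesis by (simp add: \<phi>'_def subt_subt)
      qed
      ultimately show ?thesis by blast
    qed
    \<comment> \<open>\<open>spv T i\<close> is known to be \<open>\<phi> i\<close> only on the
      event at height \<open>d\<close>, so that event is established before the local conditions are
      translated.\<close>
    have B: "?R \<longleftrightarrow> spine_event T0 d t T \<and> (\<forall>i\<in>?D. ?loc (subt T (spv T i)) i)"
    proof
      assume R: ?R
      then have "\<forall>i\<in>?D. ?loc (subt T (\<phi> i)) i \<and> infinite (subt T (\<phi> i))" using locI by blast
      then show "spine_event T0 d t T \<and> (\<forall>i\<in>?D. ?loc (subt T (spv T i)) i)"
        using R ev[OF T] spv[OF T] by metis
    next
      assume L: "spine_event T0 d t T \<and> (\<forall>i\<in>?D. ?loc (subt T (spv T i)) i)"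
      then have "T \<in> pext S (\<phi> ` ?D)" "\<And>i. i \<in> ?D \<Longrightarrow> infinite (subt T (\<phi> i))" using ev[OF T] by blast+
      moreover have "?loc (subt T (\<phi> i)) i" if "i \<in> ?D" for i using L spv[OF T _ that] that by metis
      ultimately show ?R using locD ptree_subt_infinite[OF pT] by blast
    qed
    have C: "spine_event T0 d t T \<and> (\<forall>i\<in>?D. ?loc (subt T (spv T i)) i) \<longleftrightarrow> spine_event T0 (Suc d) t T"
    proof -
      have "(\<forall>(i, n)\<in>sectors T0 (Suc d). sector_branch T0 T i n = t (i, n)) \<longleftrightarrow>
          (\<forall>(i, n)\<in>sectors T0 d. sector_branch T0 T i n = t (i, n)) \<and>
          (\<forall>i\<in>?D. \<forall>n\<le>?k i. sec (subt T (spv T i)) (?k i) n = ?g i n)"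
        unfolding sectors_Suc[OF d] ball_Un by (auto simp: sector_branch_sec[OF pT])
      then show ?thesis unfolding spine_event_def Bball_chi_Suc[OF pT pT0] by blast
    qed
    have D: "spv T j = \<phi>' j" if ev': "spine_event T0 (Suc d) t T" and j: "j \<in> Dlev (Suc d) T0" for j
    proof -
      obtain i n where j: "j = i @ [n]" "i \<in> ?D" "n < ?k i" using j by (auto simp: Dlev_Suc[OF pT0])
      have "spine_event T0 d t T" using iffD2[OF C ev'] by (rule conjunct1)
      then have "spv T i = \<phi> i" using spv[OF T _ j(2)] by simp
      moreover have "kth (ik (subt T (\<phi> i))) n = ps (?g i) n"
      proof -
        have ?R by (rule iffD2[OF trans[OF B C] ev'])
        then have "subt T (\<phi> i) \<in> pext (block (?g i) (?k i)) (ports (?g i) (?k i))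
          \<and> (\<forall>n<?k i. infinite (subt (subt T (\<phi> i)) [ps (?g i) n]))"
          by (elim conjE bspec[OF _ j(2)])
        then show ?thesis using locI[OF j(2)] j(3) by simp
      qed
      ultimately show ?thesis using j by (simp add: spv_snoc[OF pT] \<phi>'_def)
    qed
    show ?thesis by (intro conjI impI ballI D trans[OF A trans[OF B C]])
  qed
  have "spine_core T0 (Suc d) t S' \<phi>'"
    unfolding spine_core_def using 1 2 3 4 5 6 7 by blast
  then show ?thesis by blast
qed

lemma spine_core_exists:
  assumes T0: "is_tree T0" and d: "1 \<le> d"
    and nch: "\<And>i. i \<in> T0 \<Longrightarrow> 1 \<le> length i \<Longrightarrow> length i < d \<Longrightarrow> nch T0 i \<ge> 1"
    and t: "\<And>q. q \<in> sectors T0 d \<Longrightarrow> is_tree (t q) \<and> finite (t q)"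
  shows "\<exists>S \<phi>. spine_core T0 d t S \<phi>"
  using d nch t
proof (induction d rule: dec_induct)
  case base
  show ?case using spine_core_1[OF T0] by auto
next
  case (step d)
  have "\<exists>S \<phi>. spine_core T0 d t S \<phi>"
    by (rule step.IH) (use step.prems sectors_Suc[OF step(1)] in auto)
  then obtain S \<phi> where "spine_core T0 d t S \<phi>" by blast
  then show ?case
    by (rule spine_core_Suc[OF T0 step(1)]) (use step.prems step(1) in \<open>auto simp: Dlev_def\<close>)
qed

section \<open>The Dirichlet integral over the simplex\<close>

lemma measurable_pw [measurable]: "(\<lambda>x. pw x k) \<in> borel_measurable borel"
  by (cases k) (simp_all add: pw_def)

lemma DERIV_pow_fact: "DERIV (\<lambda>y. y ^ Suc i / fact (Suc i)) y :> y ^ i / fact i" for y :: real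
  by (rule DERIV_cong[OF DERIV_cdivide[OF DERIV_pow]]) (simp del: of_nat_Suc)

text \<open>An explicit primitive reduces the Beta integral to the fundamental theorem of calculus;
  it is built by integrating by parts \<open>j\<close> times.\<close>

lemma beta_primitive:
  fixes m :: real
  shows "\<exists>F. (\<forall>y. DERIV F y :> y ^ i / fact i * ((m - y) ^ j / fact j)) \<and> F 0 = 0 \<and> F m = m ^ (i + j + 1) / fact (i + j + 1)"
proof (induction j arbitrary: i)
  case 0
  show ?case using DERIV_pow_fact[of i] by (intro exI[of _ "\<lambda>y. y ^ Suc i / fact (Suc i)"]) simp
next
  case (Suc j)
  obtain F where F: "\<And>y. DERIV F y :> y ^ Suc i / fact (Suc i) * ((m - y) ^ j / fact j)" "F 0 = 0"
    "F m = m ^ (Suc i + j + 1) / fact (Suc i + j + 1)" using Suc[of "Suc i"] by blast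
  \<comment> \<open>The boundary term vanishes at 0 and at \<open>m\<close>, since both exponents
    are positive, so \<open>G\<close> takes its end values from \<open>F\<close>.\<close>
  define G where "G y = y ^ Suc i / fact (Suc i) * ((m - y) ^ Suc j / fact (Suc j)) + F y" for y
  have "DERIV (\<lambda>y. m - y) y :> - 1" for y by (auto intro!: derivative_eq_intros)
  from DERIV_chain2[OF DERIV_pow_fact this]
  have pow': "DERIV (\<lambda>y. (m - y) ^ Suc j / fact (Suc j)) y :> (m - y) ^ j / fact j * - 1" for y .
  have cancel: "u + v * - 1 * w + w * v = u" for u v w :: real by simp
  have "DERIV G y :> y ^ i / fact i * ((m - y) ^ Suc j / fact (Suc j))" for y
    unfolding G_def
    by (rule DERIV_cong[OF DERIV_add[OF DERIV_mult[OF DERIV_pow_fact pow'] F(1)]]) (rule cancel)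
  moreover have "G 0 = 0" "G m = m ^ (i + Suc j + 1) / fact (i + Suc j + 1)"
    using F(2,3) by (simp_all add: G_def)
  ultimately show ?case by blast
qed

text \<open>As functions of their first argument, the \<open>pw y k\<close> form a convolution
  semigroup in \<open>k\<close>. This is what decouples a sum of exponents.\<close>

lemma beta_nn_integral:
  assumes m: "m > 0" and ab: "a \<ge> 1" "b \<ge> 1"
  shows "(\<integral>\<^sup>+y. (if 0 < y \<and> y < m then ennreal (pw y a * pw (m - y) b) else 0) \<partial>lborel) = ennreal (pw m (a + b))"
proof -
  obtain i j where ij: "a = Suc i" "b = Suc j" using ab by (metis One_nat_def Suc_le_D)
  obtain F where F: "\<And>y. DERIV F y :> y ^ i / fact i * ((m - y) ^ j / fact j)" "F 0 = 0"
    "F m = m ^ (i + j + 1) / fact (i + j + 1)" using beta_primitive[of i m j] by blast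
  let ?f = "\<lambda>y. y ^ i / fact i * ((m - y) ^ j / fact j)"
  have hb: "has_bochner_integral lborel (\<lambda>y. ?f y * indicator {0..m} y) (F m - F 0)"
    by (rule has_bochner_integral_FTC_Icc_real) (use m F(1) in \<open>auto intro!: continuous_intros\<close>)
  have "(\<integral>\<^sup>+y. ennreal (?f y * indicator {0..m} y) \<partial>lborel) = ennreal (F m - F 0)"
    using hb by (subst nn_integral_eq_integral)
      (auto simp: indicator_def m less_imp_le has_bochner_integral_iff)
  moreover have "(\<integral>\<^sup>+y. (if 0 < y \<and> y < m then ennreal (pw y a * pw (m - y) b) else 0) \<partial>lborel)
      = (\<integral>\<^sup>+y. ennreal (?f y * indicator {0..m} y) \<partial>lborel)"
  proof (rule nn_integral_cong_AE)
    have "AE y in lborel. y \<noteq> 0" "AE y in lborel. y \<noteq> m" by (rule AE_lborel_singleton)+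
    then show "AE y in lborel. (if 0 < y \<and> y < m then ennreal (pw y a * pw (m - y) b) else 0)
        = ennreal (?f y * indicator {0..m} y)"
      by eventually_elim (auto simp: ij indicator_def)
  qed
  ultimately show ?thesis using F by (simp add: ij)
qed

definition in_simplex :: "nat \<Rightarrow> real \<Rightarrow> (nat \<Rightarrow> real) \<Rightarrow> bool" where
  "in_simplex N m x \<longleftrightarrow> (\<forall>j<N. 0 < x j) \<and> (\<Sum>j<N. x j) < m"

text \<open>Integrating out coordinate \<open>N\<close> against the remaining mass is one Beta
  integral, which merges the last two exponents; \<open>k'\<close> records the merged one.\<close>

lemma dirichlet:
  assumes "m > 0" "\<And>j. j \<le> N \<Longrightarrow> k j \<ge> 1"
  shows "(\<integral>\<^sup>+x. (if in_simplex N m x then ennreal ((\<Prod>j<N. pw (x j) (k j)) * pw (m - (\<Sum>j<N. x j)) (k N)) else 0)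
      \<partial>PiM {..<N} (\<lambda>_. lborel)) = ennreal (pw m (\<Sum>j\<le>N. k j))"
  using assms(2)
proof (induction N arbitrary: k)
  case 0
  interpret product_sigma_finite "\<lambda>_ :: nat. lborel :: real measure" by standard
  have "prob_space (PiM {} (\<lambda>_ :: nat. lborel :: real measure))"
    by (rule prob_spaceI) (simp add: PiM_empty)
  then have "emeasure (PiM {} (\<lambda>_ :: nat. lborel :: real measure)) (space (PiM {} (\<lambda>_. lborel))) = 1"
    by (rule prob_space.emeasure_space_1)
  then show ?case using assms(1) by (simp add: in_simplex_def)
next
  case (Suc N)
  interpret product_sigma_finite "\<lambda>_ :: nat. lborel :: real measure" by standard
  let ?P = "\<lambda>N. PiM {..<N} (\<lambda>_. lborel) :: (nat \<Rightarrow> real) measure"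
  define f where "f x = (if in_simplex (Suc N) m x
     then ennreal ((\<Prod>j<Suc N. pw (x j) (k j)) * pw (m - (\<Sum>j<Suc N. x j)) (k (Suc N))) else 0)" for x
  define k' where "k' = k(N := k N + k (Suc N))"
  have ins: "{..<Suc N} = insert N {..<N}" by auto
  have meas: "f \<in> borel_measurable (?P (Suc N))"
    unfolding f_def in_simplex_def by measurable
  have "(\<integral>\<^sup>+x. f x \<partial>?P (Suc N)) = (\<integral>\<^sup>+x. (\<integral>\<^sup>+y. f (x(N := y)) \<partial>lborel) \<partial>?P N)"
    unfolding ins by (rule product_nn_integral_insert) (use meas in \<open>auto simp: ins\<close>)
  also have "\<dots> = (\<integral>\<^sup>+x. (if in_simplex N m x then ennreal ((\<Prod>j<N. pw (x j) (k' j)) * pw (m - (\<Sum>j<N. x j)) (k' N)) else 0) \<partial>?P N)"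
  proof (rule nn_integral_cong)
    fix x :: "nat \<Rightarrow> real"
    let ?s = "\<Sum>j<N. x j" and ?p = "\<Prod>j<N. pw (x j) (k j)"
    have s: "(\<Sum>j<N. (x(N := y)) j) = ?s" and p: "(\<Prod>j<N. pw ((x(N := y)) j) (k j)) = ?p"
      and a: "(\<forall>j<N. 0 < (x(N := y)) j) \<longleftrightarrow> (\<forall>j<N. 0 < x j)" for y
      by (auto intro!: sum.cong prod.cong)
    have simp: "in_simplex (Suc N) m (x(N := y)) \<longleftrightarrow> (\<forall>j<N. 0 < x j) \<and> 0 < y \<and> y < m - ?s" for y
      unfolding in_simplex_def sum.lessThan_Suc s by (auto simp: less_Suc_eq)
    have fx: "f (x(N := y)) = (if (\<forall>j<N. 0 < x j) \<and> 0 < y \<and> y < m - ?s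
        then ennreal (?p * pw y (k N) * pw (m - (?s + y)) (k (Suc N))) else 0)" for y
      unfolding f_def simp sum.lessThan_Suc prod.lessThan_Suc s p by auto
    show "(\<integral>\<^sup>+y. f (x(N := y)) \<partial>lborel) = (if in_simplex N m x then ennreal ((\<Prod>j<N. pw (x j) (k' j)) * pw (m - ?s) (k' N)) else 0)"
    proof (cases "in_simplex N m x")
      case True
      then have pos: "\<forall>j<N. 0 < x j" and ms: "m - ?s > 0" by (auto simp: in_simplex_def)
      have p0: "?p \<ge> 0" using pos by (intro prod_nonneg ballI pw_nonneg) (simp add: less_imp_le)
      have "(\<integral>\<^sup>+y. f (x(N := y)) \<partial>lborel)
          = (\<integral>\<^sup>+y. ennreal ?p * (if 0 < y \<and> y < m - ?s then ennreal (pw y (k N) * pw (m - ?s - y) (k (Suc N))) else 0) \<partial>lborel)"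
        unfolding fx using pos p0 by (intro nn_integral_cong) (auto simp: ennreal_mult' mult.assoc diff_diff_eq)
      also have "\<dots> = ennreal ?p * ennreal (pw (m - ?s) (k N + k (Suc N)))"
        using Suc.prems beta_nn_integral[OF ms, of "k N" "k (Suc N)"] by (subst nn_integral_cmult) auto
      also have "\<dots> = ennreal (?p * pw (m - ?s) (k N + k (Suc N)))" using p0 by (simp add: ennreal_mult')
      also have "?p = (\<Prod>j<N. pw (x j) (k' j))" by (intro prod.cong) (auto simp: k'_def)
      also have "k N + k (Suc N) = k' N" by (simp add: k'_def)
      finally show ?thesis by (simp only: True if_True)
    next
      case False
      then have "f (x(N := y)) = 0" for y unfolding fx in_simplex_def by auto
      then show ?thesis using False by simp
    qed
  qed
  also have "\<dots> = ennreal (pw m (\<Sum>j\<le>N. k' j))"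
  proof (rule Suc.IH)
    fix j assume "j \<le> N"
    then show "k' j \<ge> 1" using Suc.prems[of j] by (auto simp: k'_def)
  qed
  also have "(\<Sum>j\<le>N. k' j) = (\<Sum>j\<le>Suc N. k j)"
    by (simp add: k'_def flip: lessThan_Suc_atMost)
  finally show ?case by (simp only: f_def)
qed

section \<open>The normalized integral over the simplex\<close>

lemma simplex_par_eq: "simplex_par R \<mu> = {x \<in> space (PiM {..<R-1} (\<lambda>_. lborel)). in_simplex (R - 1) \<mu> x}"
  by (simp add: simplex_par_def in_simplex_def)

lemma simplex_par_sets [measurable]: "simplex_par R \<mu> \<in> sets (PiM {..<R-1} (\<lambda>_. lborel))"
  unfolding simplex_par_eq in_simplex_def by measurable

lemma simplex_pt_measurable [measurable]:
  "j < R \<Longrightarrow> (\<lambda>x. simplex_pt R \<mu> x j) \<in> borel_measurable (PiM {..<R-1} (\<lambda>_. lborel))"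
  unfolding simplex_pt_def by (cases "j < R - 1") simp_all

lemma simplex_pt_pos: "x \<in> simplex_par R \<mu> \<Longrightarrow> 0 < simplex_pt R \<mu> x j"
  by (auto simp: simplex_par_def simplex_pt_def)

lemma simplex_pt_sum: "R \<ge> 1 \<Longrightarrow> (\<Sum>j<R. simplex_pt R \<mu> x j) = \<mu>"
proof -
  assume "R \<ge> 1"
  then obtain N where "R = Suc N" by (metis One_nat_def Suc_le_D)
  then show ?thesis by (simp add: simplex_pt_def)
qed

lemma simplex_dirichlet:
  assumes R: "R \<ge> 1" and \<mu>: "\<mu> > 0" and k: "\<And>j. j < R \<Longrightarrow> k j \<ge> 1"
  shows "(\<integral>\<^sup>+x. ennreal (\<Prod>j<R. pw (simplex_pt R \<mu> x j) (k j)) * indicator (simplex_par R \<mu>) x \<partial>PiM {..<R-1} (\<lambda>_. lborel))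
    = ennreal (pw \<mu> (\<Sum>j<R. k j))"
proof -
  obtain N where N: "R = Suc N" using R by (metis One_nat_def Suc_le_D)
  have "(\<integral>\<^sup>+x. ennreal (\<Prod>j<R. pw (simplex_pt R \<mu> x j) (k j)) * indicator (simplex_par R \<mu>) x \<partial>PiM {..<R-1} (\<lambda>_. lborel))
    = (\<integral>\<^sup>+x. (if in_simplex N \<mu> x then ennreal ((\<Prod>j<N. pw (x j) (k j)) * pw (\<mu> - (\<Sum>j<N. x j)) (k N)) else 0)
      \<partial>PiM {..<N} (\<lambda>_. lborel))"
    unfolding N by (simp, intro nn_integral_cong) (auto simp: simplex_par_eq indicator_def simplex_pt_def)
  also have "\<dots> = ennreal (pw \<mu> (\<Sum>j\<le>N. k j))" by (rule dirichlet[OF \<mu>]) (use k N in auto)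
  finally show ?thesis by (simp add: N lessThan_Suc_atMost)
qed

text \<open>All exponents equal to 1 give the volume. The same factor appears in the probability of
  the spine, which is why the conditional law is exactly the normalized mixture.\<close>

lemma emeasure_simplex:
  assumes "R \<ge> 1" "\<mu> > 0"
  shows "emeasure (PiM {..<R-1} (\<lambda>_. lborel)) (simplex_par R \<mu>) = ennreal (pw \<mu> R)"
proof -
  have "(\<integral>\<^sup>+x. ennreal (\<Prod>j<R. pw (simplex_pt R \<mu> x j) 1) * indicator (simplex_par R \<mu>) x \<partial>PiM {..<R-1} (\<lambda>_. lborel))
      = ennreal (pw \<mu> (\<Sum>j<R. 1))"
    by (rule simplex_dirichlet) (use assms in auto)
  moreover have "ennreal (\<Prod>j<R. pw (simplex_pt R \<mu> x j) 1) = 1" for x by (simp add: pw_def)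
  moreover have "(\<Sum>j<R. 1 :: nat) = R" by simp
  ultimately show ?thesis by (simp only: mult_1 nn_integral_indicator[OF simplex_par_sets])
qed

lemma simplex_integral_nn:
  assumes R: "R \<ge> 1" and \<mu>: "\<mu> > 0"
    and meas: "(\<lambda>x. indicator (simplex_par R \<mu>) x * f (simplex_pt R \<mu> x)) \<in> borel_measurable (PiM {..<R-1} (\<lambda>_. lborel))"
    and nonneg: "\<And>x. x \<in> simplex_par R \<mu> \<Longrightarrow> 0 \<le> f (simplex_pt R \<mu> x)"
    and c: "(\<integral>\<^sup>+x. ennreal (f (simplex_pt R \<mu> x)) * indicator (simplex_par R \<mu>) x \<partial>PiM {..<R-1} (\<lambda>_. lborel)) = ennreal c" "0 \<le> c"
  shows "simplex_integral R \<mu> f = c / pw \<mu> R"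
proof -
  let ?P = "PiM {..<R-1} (\<lambda>_. lborel) :: (nat \<Rightarrow> real) measure"
  let ?g = "\<lambda>x. indicator (simplex_par R \<mu>) x * f (simplex_pt R \<mu> x)"
  have pw: "pw \<mu> R > 0" using R \<mu> by (simp add: pw_def)
  have nn: "?g x \<ge> 0" for x using nonneg by (auto simp: indicator_def)
  have "simplex_integral R \<mu> f = enn2real (\<integral>\<^sup>+x. ennreal (?g x) \<partial>uniform_measure ?P (simplex_par R \<mu>))"
    unfolding simplex_integral_def by (rule integral_eq_nn_integral) (use meas nn in auto)
  also have "(\<integral>\<^sup>+x. ennreal (?g x) \<partial>uniform_measure ?P (simplex_par R \<mu>))
      = (\<integral>\<^sup>+x. ennreal (?g x) * indicator (simplex_par R \<mu>) x \<partial>?P) / ennreal (pw \<mu> R)"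
    unfolding emeasure_simplex[OF R \<mu>, symmetric]
    by (rule nn_integral_uniform_measure[OF _ simplex_par_sets]) (use meas in measurable)
  also have "(\<integral>\<^sup>+x. ennreal (?g x) * indicator (simplex_par R \<mu>) x \<partial>?P)
      = (\<integral>\<^sup>+x. ennreal (f (simplex_pt R \<mu> x)) * indicator (simplex_par R \<mu>) x \<partial>?P)"
    by (intro nn_integral_cong) (auto simp: indicator_def)
  finally show ?thesis using c pw by (simp add: divide_ennreal)
qed

section \<open>The law of the finite branches\<close>

lemma sum_rho: "(\<integral>\<^sup>+g. ennreal (2 * (1/4) ^ card g) \<partial>count_space fptrees) = 1"
proof -
  have "(\<integral>\<^sup>+g. ennreal (2 * (1/4) ^ card g) \<partial>count_space fptrees)
      = (\<integral>\<^sup>+g. 2 * ennreal ((1/4) ^ card g) \<partial>count_space fptrees)"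
    by (simp add: ennreal_mult)
  also have "\<dots> = ennreal 2 * ennreal (1/2)"
    by (simp only: nn_integral_cmult catalan_sum borel_measurable_count_space) simp
  also have "\<dots> = ennreal (2 * (1/2))" by (rule ennreal_mult[symmetric]) simp_all
  also have "\<dots> = 1" by simp
  finally show ?thesis .
qed

definition gw_pmf :: "nat list set pmf" where
  "gw_pmf = embed_pmf (\<lambda>g. if g \<in> fptrees then 2 * (1/4) ^ card g else 0)"

lemma pmf_gw: "pmf gw_pmf g = (if g \<in> fptrees then 2 * (1/4) ^ card g else 0)"
  unfolding gw_pmf_def
proof (rule pmf_embed_pmf)
  have "(\<integral>\<^sup>+g. ennreal (if g \<in> fptrees then 2 * (1/4) ^ card g else 0) \<partial>count_space UNIV)
      = (\<integral>\<^sup>+g. ennreal (2 * (1/4) ^ card g) \<partial>count_space fptrees)"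
    by (subst (2) nn_integral_count_space_indicator) (auto intro!: nn_integral_cong)
  then show "(\<integral>\<^sup>+g. ennreal (if g \<in> fptrees then 2 * (1/4) ^ card g else 0) \<partial>count_space UNIV) = 1"
    by (simp add: sum_rho)
qed simp

text \<open>Finite products of mass functions are again mass functions, so the sum over all families
  of sector trees in \<open>E_prob\<close> is 1 at once.\<close>

definition rho_pmf :: "tree pmf" where
  "rho_pmf = map_pmf plant gw_pmf"

lemma set_rho_pmf: "set_pmf rho_pmf = {T. is_tree T \<and> finite T}"
proof -
  have "set_pmf gw_pmf = fptrees" by (auto simp: set_pmf_eq pmf_gw)
  moreover have "plant ` fptrees = {T. is_tree T \<and> finite T}"
  proof (intro set_eqI iffI)
    fix T assume T: "T \<in> {T. is_tree T \<and> finite T}"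
    then have "[0] \<in> T" by (simp add: is_tree_root_edge)
    then have "subt T [0] \<in> fptrees" "T = plant (subt T [0])"
      using T ptree_subt[OF is_tree_ptree] plant_subt[of T] finite_plant[of "subt T [0]"] by (auto simp: fptrees_def)
    then show "T \<in> plant ` fptrees" by blast
  qed (auto simp: fptrees_def is_tree_plant)
  ultimately show ?thesis by (simp add: rho_pmf_def)
qed

lemma pmf_rho: "is_tree T \<Longrightarrow> finite T \<Longrightarrow> pmf rho_pmf T = rho T"
proof -
  assume T: "is_tree T" "finite T"
  then have "[0] \<in> T" by (simp add: is_tree_root_edge)
  then have g: "subt T [0] \<in> fptrees" and P: "T = plant (subt T [0])"
    using T ptree_subt[OF is_tree_ptree] plant_subt[of T] finite_plant[of "subt T [0]"] by (auto simp: fptrees_def)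
  have "pmf rho_pmf (plant (subt T [0])) = pmf gw_pmf (subt T [0])"
    unfolding rho_pmf_def by (rule pmf_map_inj') (rule injI, erule plant_inj)
  also have "\<dots> = rho (plant (subt T [0]))"
    using g by (simp add: pmf_gw rho_def edges_plant)
  finally show ?thesis by (simp only: P[symmetric])
qed

text \<open>No infinite child lies strictly between consecutive ones, so a sector holds finitely
  many children, each with a finite subtree. Hence the events \<open>Et t\<close> with
  \<open>good t\<close> exhaust \<open>E\<close>.\<close>

lemma sec_is_tree:
  assumes P: "ptree P" and n: "n \<le> card (ik P)"
  shows "is_tree (sec P (card (ik P)) n) \<and> finite (sec P (card (ik P)) n)"
proof -
  let ?k = "card (ik P)"
  note fin = finite_ik[OF P]
  define l where "l = (if n = 0 then 0 else kth (ik P) (n - 1) + 1)"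
  define Q where "Q = insert [] {q # w | q w. (l + q) # w \<in> P \<and> (n < ?k \<longrightarrow> l + q < kth (ik P) n)}"
  have Qmem: "[] \<in> Q" "q # w \<in> Q \<longleftrightarrow> (l + q) # w \<in> P \<and> (n < ?k \<longrightarrow> l + q < kth (ik P) n)" for q w
    by (auto simp: Q_def)
  have eq: "sec P ?k n = plant Q"
  proof (intro set_eqI iffI)
    fix w assume "w \<in> sec P ?k n"
    then consider "w = []" | "w = [0]" | p v where "w = 0 # (p - l) # v" "p # v \<in> P" "l \<le> p" "n < ?k \<longrightarrow> p < kth (ik P) n"
      unfolding sec_def Let_def l_def by blast
    then show "w \<in> plant Q"
    proof cases
      case 3
      then have "(p - l) # v \<in> Q" by (simp add: Qmem)
      then show ?thesis using 3 by (simp add: plant_def)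
    qed (auto simp: plant_def Q_def)
  next
    fix w assume "w \<in> plant Q"
    then consider "w = []" | "w = [0]" | q v where "w = 0 # q # v" "(l + q) # v \<in> P" "n < ?k \<longrightarrow> l + q < kth (ik P) n"
      unfolding plant_def Q_def by auto
    then show "w \<in> sec P ?k n"
    proof cases
      case 3
      then have "w = 0 # ((l + q) - l) # v" "l \<le> l + q" by simp_all
      then show ?thesis using 3 unfolding sec_def Let_def l_def[symmetric] by blast
    qed (auto simp: sec_def Let_def)
  qed
  have finite_part: "finite (subt P [l + q])" if "n < ?k \<longrightarrow> l + q < kth (ik P) n" for q
  proof (rule ccontr)
    assume "infinite (subt P [l + q])"
    then have a: "l + q \<in> ik P" by (simp add: ik_def)
    define m where "m = rank (ik P) (l + q)"
    have m: "m < ?k" "kth (ik P) m = l + q" using rank_less_card[OF fin a] kth_rank[OF a] by (auto simp: m_def)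
    show False
    proof (cases "n \<le> m")
      case True
      then have "kth (ik P) n \<le> kth (ik P) m" using kth_less[OF fin, of n m] m by (cases "n = m") auto
      then show ?thesis using that m True by simp
    next
      case False
      have "kth (ik P) m \<le> kth (ik P) (n - 1)"
      proof (cases "m = n - 1")
        case neq: False
        have "m < n - 1" "n - 1 < ?k" using False neq n by linarith+
        then show ?thesis using kth_less[OF fin] by (simp add: less_imp_le)
      qed simp
      then show ?thesis using m False by (simp add: l_def)
    qed
  qed
  have "finite Q"
  proof -
    let ?A = "{q. [] @ [l + q] \<in> P \<and> (n < ?k \<longrightarrow> l + q < kth (ik P) n)}"
    have "finite ?A"
      by (rule finite_subset[OF _ finite_imageI[OF ptree_finite_children[OF P, of "[]"], of "\<lambda>a. a - l"]]) force
    moreover have "Q \<subseteq> insert [] (\<Union>q\<in>?A. (#) q ` subt P [l + q])"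
    proof
      fix w assume w: "w \<in> Q"
      show "w \<in> insert [] (\<Union>q\<in>?A. (#) q ` subt P [l + q])"
      proof (cases w)
        case (Cons q v)
        then have "q \<in> ?A" "v \<in> subt P [l + q]"
          using w ptree_appendD[OF P, of "[l + q]" v] by (auto simp: Qmem)
        then show ?thesis using Cons by blast
      qed simp
    qed
    moreover have "finite (\<Union>q\<in>?A. (#) q ` subt P [l + q])" using calculation(1) finite_part by blast
    ultimately show ?thesis by (meson finite_insert finite_subset)
  qed
  moreover have "ptree Q"
  proof (rule ptreeI[OF Qmem(1)])
    show "w \<in> Q" if "w @ [a] \<in> Q" for w a
      using that ptree_snocD[OF P, of "(l + hd w) # tl w" a] by (cases w) (auto simp: Qmem)
    show "w @ [a] \<in> Q" if "w @ [b] \<in> Q" "a < b" for w a b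
    proof (cases w)
      case Nil
      then show ?thesis using that ptree_sibling[OF P, of "[]" "l + b" "l + a"] by (auto simp: Qmem)
    next
      case (Cons c v)
      then show ?thesis using that ptree_sibling[OF P, of "(l + c) # v" b a] by (auto simp: Qmem)
    qed
    show "finite {a. w @ [a] \<in> Q}" for w using \<open>finite Q\<close> by (rule finite_imp_finite_children)
  qed
  ultimately show ?thesis unfolding eq using is_tree_plant by simp
qed

section \<open>Balls of infinite trees\<close>

lemma infinite_tree_ball:
  assumes X: "is_tree X" "infinite X" and h: "1 \<le> h"
  shows "is_tree (Bball h X) \<and> finite (Bball h X) \<and> height (Bball h X) = h"
proof -
  note pX = is_tree_ptree[OF X(1)]
  have fin: "finite (Bball h X)" by (rule ptree_Bball_finite[OF pX])
  then obtain w where w: "w \<in> X" "w \<notin> Bball h X" using X(2) by (metis finite_subset subsetI)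
  then have u: "take h w \<in> Bball h X" "length (take h w) = h"
    using ptree_prefixD[OF pX take_is_prefix w(1)] by (auto simp: Bball_def)
  have "is_tree (Bball h X)"
    using X(1) ptree_Bball[OF pX] h unfolding is_tree_iff by (auto simp: Bball_def)
  moreover have "height (Bball h X) = h"
    by (rule height_eqI[OF fin _ u]) (simp add: Bball_def)
  ultimately show ?thesis using fin by blast
qed

text \<open>Balls and levels are finite, so infinitely many vertices must share an ancestor at level
  \<open>n\<close>.\<close>

lemma infinite_iff_level:
  assumes P: "ptree P"
  shows "infinite P \<longleftrightarrow> (\<exists>v\<in>Dlev n P. infinite (subt P v))"
proof
  assume inf: "infinite P"
  have "P \<subseteq> Bball n P \<union> (\<Union>v\<in>Dlev n P. (@) v ` subt P v)"
  proof
    fix w assume w: "w \<in> P"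
    show "w \<in> Bball n P \<union> (\<Union>v\<in>Dlev n P. (@) v ` subt P v)"
    proof (cases "length w \<le> n")
      case False
      then have "take n w \<in> Dlev n P" using ptree_prefixD[OF P take_is_prefix w] by (simp add: Dlev_def)
      moreover have "w = take n w @ drop n w" "drop n w \<in> subt P (take n w)" using w by simp_all
      ultimately show ?thesis by blast
    qed (use w in \<open>simp add: Bball_def\<close>)
  qed
  then show "\<exists>v\<in>Dlev n P. infinite (subt P v)"
    using inf ptree_Bball_finite[OF P, of n] finite_Dlev[OF P, of n]
    by (metis (no_types, lifting) finite_UN_I finite_UnI finite_imageI finite_subset)
next
  assume "\<exists>v\<in>Dlev n P. infinite (subt P v)"
  then obtain v where "infinite ((@) v ` subt P v)" by (auto simp: finite_image_iff inj_on_def)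
  moreover have "(@) v ` subt P v \<subseteq> P" by auto
  ultimately show "infinite P" using finite_subset by blast
qed

text \<open>Reads the binomial sum of the ball formula as a sum over the nonempty set
  \<open>W\<close> of top vertices that have infinitely many descendants.\<close>

lemma gs_subsets:
  assumes "finite D"
  shows "gs m (card D) 0 = (\<Sum>W\<in>{W. W \<subseteq> D \<and> W \<noteq> {}}. pw m (card W))"
proof -
  have "(\<Sum>W\<in>{W. W \<subseteq> D \<and> W \<noteq> {}}. pw m (card W)) = (\<Sum>W\<in>Pow D. pw m (card W))"
    using assms by (intro sum.mono_neutral_left) auto
  also have "\<dots> = (\<Sum>k\<le>card D. \<Sum>W\<in>{W \<in> Pow D. card W = k}. pw m (card W))"
    using assms by (intro sum.group[symmetric]) (auto intro: card_mono)
  also have "\<dots> = (\<Sum>k\<le>card D. real (card D choose k) * pw m k)"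
  proof (rule sum.cong[OF refl])
    fix k
    have "card {W \<in> Pow D. card W = k} = card D choose k"
      using n_subsets[OF assms, of k] by (simp add: Pow_def conj_commute)
    then show "(\<Sum>W\<in>{W \<in> Pow D. card W = k}. pw m (card W)) = real (card D choose k) * pw m k"
      by simp
  qed
  finally show ?thesis by (simp add: gs_def)
qed

lemma measurable_gs [measurable]: "(\<lambda>m. gs m a b) \<in> borel_measurable borel"
  unfolding gs_def by measurable

context nu_law
begin

lemma tball_null:
  assumes "\<not> (is_tree S \<and> finite S \<and> height S = s)" "\<not> (s = 0 \<and> S = {[]})"
  shows "measure M (tball s S) = 0"
proof (cases "tball s S = {}")
  case False
  then obtain X where X: "is_tree X" "Bball s X = S" by (auto simp: tball_def trees_def)
  note pX = is_tree_ptree[OF X(1)]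
  have s: "1 \<le> s"
  proof (rule ccontr)
    assume "\<not> 1 \<le> s"
    then have "s = 0" by simp
    then have "S = {[]}" using X(2) ptree_Nil[OF pX] by (auto simp: Bball_def)
    then show False using assms(2) \<open>s = 0\<close> by blast
  qed
  have S: "is_tree S" "finite S" using X ptree_Bball[OF pX] ptree_Bball_finite[OF pX] s
    unfolding is_tree_iff by (auto simp: Bball_def)
  have len: "length w \<le> s" if "w \<in> S" for w using that X(2) by (auto simp: Bball_def)
  have "Dlev s S = {}" using assms(1) S height_eqI[OF S(2) len] by (auto simp: Dlev_def)
  then have "tball s S = {S}" using pext_eq_tball[OF S(1) len] pext_empty[OF is_tree_ptree[OF S(1)]] by simp
  then show ?thesis using finite_null[OF S] by (simp add: measure_def)
qed simp

lemma tball_all: "tball 0 {[]} = space M"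
  using ptree_Nil[OF is_tree_ptree] by (auto simp: tball_def space_M trees_def Bball_def)

end

text \<open>A closed form for arbitrary arguments, visibly measurable in the parameter
  \<open>m\<close>, as integration over the simplex demands. The value 1 is for the ball of radius
  0, which is the whole space.\<close>

definition ball_prob_fun :: "nat \<Rightarrow> tree \<Rightarrow> real \<Rightarrow> real" where
  "ball_prob_fun s S m = (if is_tree S \<and> finite S \<and> height S = s
     then exp (- m * (real s - 1)) * (1/4) ^ edges S * 2 ^ (card (Dlev s S) + 1) * gs m (card (Dlev s S)) 0
     else if s = 0 \<and> S = {[]} then 1 else 0)"

lemma (in nu_law) tball_prob: "measure M (tball s S) = ball_prob_fun s S \<nu>"
  unfolding ball_prob_fun_def using ball_prob[of S] tball_null[of S s] tball_all prob_space by auto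

lemma measurable_ball_prob_fun [measurable]: "ball_prob_fun s S \<in> borel_measurable borel"
  unfolding ball_prob_fun_def by measurable

lemma is_nu_family_law: "is_nu_family nu \<Longrightarrow> m > 0 \<Longrightarrow> nu_law (nu m) m"
  unfolding is_nu_family_def nu_law_def nu_law_axioms_def Let_def gs_ball[symmetric] by blast

section \<open>The spine decomposition\<close>

lemma inf_branch_plant: "inf_branch T l = plant (subt T (spv T l))"
  by (auto simp: inf_branch_def plant_def)

lemma tball_refine:
  assumes "s \<le> h" shows "tball s S = (\<Union>S'\<in>{S'. finite S' \<and> Bball s S' = S}. tball h S')"
proof -
  have BB: "Bball s (Bball h T) = Bball s T" for T using assms by (auto simp: Bball_def)
  have "finite (Bball h T)" if "T \<in> trees" for T
    using that ptree_Bball_finite is_tree_ptree by (simp add: trees_def)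
  then show ?thesis using BB by (auto simp: tball_def)
qed

text \<open>An identity between closed forms, read off from the countable additivity of the
  law.\<close>

lemma ball_prob_refine:
  assumes law: "nu_law M m" and s: "s \<le> h"
  shows "ennreal (ball_prob_fun s S m) = (\<integral>\<^sup>+S'. ennreal (ball_prob_fun h S' m) \<partial>count_space {S'. finite S' \<and> Bball s S' = S})"
proof -
  interpret nu_law M m by (rule law)
  have "countable {S' :: tree. finite S' \<and> Bball s S' = S}"
    by (rule countable_subset[OF _ countable_Collect_finite]) auto
  moreover have "disjoint_family_on (tball h) {S'. finite S' \<and> Bball s S' = S}"
    by (auto simp: disjoint_family_on_def tball_def)
  ultimately have "emeasure M (tball s S) = (\<integral>\<^sup>+S'. emeasure M (tball h S') \<partial>count_space {S'. finite S' \<and> Bball s S' = S})"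
    unfolding tball_refine[OF s] by (intro emeasure_UN_countable tball_sets)
  then show ?thesis by (simp add: emeasure_eq_measure tball_prob)
qed

lemma power_quarter: "2 * a + s = r + 2 * b \<Longrightarrow> (1/4) ^ a * 2 ^ r = 2 ^ s * ((1/4) ^ b :: real)"
proof -
  assume *: "2 * a + s = r + 2 * b"
  have q: "(1/4 :: real) ^ n = 1 / 2 ^ (2 * n)" for n by (simp add: power_mult power_divide)
  have "(2 :: real) ^ r * 2 ^ (2 * b) = 2 ^ s * 2 ^ (2 * a)" using * by (simp add: add.commute flip: power_add)
  then show ?thesis unfolding q by (simp add: field_simps)
qed

section \<open>The event of a fixed spine, with its leaves numbered by \<open>e\<close>\<close>

locale spine_law =
  fixes nu :: "real \<Rightarrow> tree measure" and \<mu> :: real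
    and T0 :: tree and r R :: nat and e :: "nat \<Rightarrow> nat list"
  assumes nu: "is_nu_family nu" and mu: "\<mu> > 0"
    and T0: "is_tree T0" "finite T0" "height T0 = r"
    and lv: "\<forall>l\<in>leaves T0. length l = r"
    and R: "R = card (leaves T0)"
    and e: "bij_betw e {..<R} (leaves T0)"

sublocale spine_law \<subseteq> law: nu_law "nu \<mu>" \<mu>
  by (rule is_nu_family_law[OF nu mu])

context spine_law
begin

lemma r1: "1 \<le> r"
  using height_pos[OF T0(1,2)] T0(3) by simp

lemma len_T0: "w \<in> T0 \<Longrightarrow> length w \<le> r"
  using length_le_height[OF T0(2)] T0(3) by simp

lemma Bball_T0: "Bball r T0 = T0"
  using len_T0 by (auto simp: Bball_def)

lemma Dlev_T0: "Dlev r T0 = leaves T0"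
proof
  show "Dlev r T0 \<subseteq> leaves T0"
  proof
    fix w assume w: "w \<in> Dlev r T0"
    have "w @ [a] \<notin> T0" for a using len_T0[of "w @ [a]"] w by (auto simp: Dlev_def)
    then show "w \<in> leaves T0" using w r1 by (auto simp: leaves_def Dlev_def)
  qed
  show "leaves T0 \<subseteq> Dlev r T0" using lv by (auto simp: Dlev_def leaves_def)
qed

lemma R1: "1 \<le> R"
proof -
  have "height T0 \<in> length ` T0" unfolding height_def
    by (rule Max_in) (use T0 ptree_Nil[OF is_tree_ptree[OF T0(1)]] in auto)
  then have "leaves T0 \<noteq> {}" using T0(3) unfolding Dlev_T0[symmetric] by (auto simp: Dlev_def)
  moreover have "finite (leaves T0)" using T0(2) by (simp add: leaves_def)
  ultimately show ?thesis unfolding R by (simp add: Suc_le_eq card_gt_0_iff)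
qed

lemma pw_R: "pw \<mu> R > 0"
  using R1 mu by (simp add: pw_def)

lemma nch_T0:
  assumes "i \<in> T0" "1 \<le> length i" "length i < r" shows "nch T0 i \<ge> 1"
proof -
  have "i \<notin> leaves T0" using lv assms by auto
  then obtain a where "i @ [a] \<in> T0" using assms by (auto simp: leaves_def)
  then show ?thesis using ptree_child_iff[OF is_tree_ptree[OF T0(1)]] by (metis One_nat_def Suc_leI gr0I not_less0)
qed

abbreviation "sects \<equiv> sectors T0 r"

lemma finite_sects: "finite sects"
  by (rule finite_sectors[OF is_tree_ptree[OF T0(1)]])

definition E :: "tree set" where
  "E = {T \<in> trees. infinite T \<and> Bball r (chi T) = T0}"

definition Et :: "(nat list \<times> nat \<Rightarrow> tree) \<Rightarrow> tree set" where
  "Et t = {T \<in> trees. spine_event T0 r t T}"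

lemma Et_eq: "Et t = {T \<in> E. \<forall>(i, n)\<in>sects. sector_branch T0 T i n = t (i, n)}"
  by (auto simp: Et_def E_def spine_event_def Bball_T0)

definition good :: "(nat list \<times> nat \<Rightarrow> tree) \<Rightarrow> bool" where
  "good t \<longleftrightarrow> (\<forall>q\<in>sects. is_tree (t q) \<and> finite (t q))"

lemma core_exists: "good t \<Longrightarrow> \<exists>S \<phi>. spine_core T0 r t S \<phi>"
  by (rule spine_core_exists[OF T0(1) r1 nch_T0]) (auto simp: good_def)

text \<open>The probability of \<open>Et t\<close> without its factor \<open>pw \<mu> R\<close>; all
  dependence on the finite branches is here.\<close>

definition scale :: "(nat list \<times> nat \<Rightarrow> tree) \<Rightarrow> real" where
  "scale t = exp (- \<mu> * (real r - 1)) * (\<Prod>q\<in>sects. rho (t q))"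

lemma scale_nonneg: "scale t \<ge> 0"
  unfolding scale_def by (intro mult_nonneg_nonneg prod_nonneg) (auto simp: rho_def)

text \<open>The mixture of ball probabilities before division by the volume of the simplex,
  extended-real valued for the countable sums in \<open>fl_fr\<close>.\<close>

definition fr :: "(nat \<Rightarrow> nat) \<Rightarrow> (nat \<Rightarrow> tree) \<Rightarrow> ennreal" where
  "fr s S = (\<integral>\<^sup>+x. (\<Prod>j<R. ennreal (ball_prob_fun (s j) (S j) (simplex_pt R \<mu> x j))) * indicator (simplex_par R \<mu>) x
      \<partial>PiM {..<R-1} (\<lambda>_. lborel))"

definition fl :: "(nat list \<times> nat \<Rightarrow> tree) \<Rightarrow> (nat \<Rightarrow> nat) \<Rightarrow> (nat \<Rightarrow> tree) \<Rightarrow> tree set" where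
  "fl t s S = {T \<in> Et t. \<forall>j<R. inf_branch T (e j) \<in> tball (s j) (S j)}"

end

section \<open>One prescribed family of finite branches\<close>

locale spine_law_core = spine_law +
  fixes t :: "nat list \<times> nat \<Rightarrow> tree" and S :: tree and \<phi> :: "nat list \<Rightarrow> nat list"
  assumes good: "good t" and core: "spine_core T0 r t S \<phi>"
begin

definition u :: "nat \<Rightarrow> nat list" where
  "u j = \<phi> (e j)"

definition U :: "nat list set" where
  "U = u ` {..<R}"

lemma e_leaves: "e ` {..<R} = Dlev r T0"
  using e by (simp add: Dlev_T0 bij_betw_def)

lemma U_eq: "\<phi> ` Dlev r T0 = U"
  unfolding U_def u_def e_leaves[symmetric] by (simp add: image_image)

lemma S: "is_tree S" "finite S"
  using core by (auto simp: spine_core_def)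

lemma pS: "ptree S"
  using S is_tree_ptree by blast

lemma U_ends: "U \<subseteq> ends S"
  using core U_eq by (simp add: spine_core_def)

lemma inj_u: "inj_on u {..<R}"
proof -
  have "inj_on \<phi> (e ` {..<R})" using core e_leaves by (simp add: spine_core_def)
  then have "inj_on (\<phi> \<circ> e) {..<R}" using e by (intro comp_inj_on) (auto simp: bij_betw_def)
  then show ?thesis by (simp add: u_def comp_def inj_on_def)
qed

lemma e_mem: "j < R \<Longrightarrow> e j \<in> Dlev r T0"
  using e_leaves by blast

lemma length_u: "j < R \<Longrightarrow> length (u j) = r"
  using core e_mem by (simp add: spine_core_def u_def)

lemma Et_pext: "Et t = {T \<in> pext S U. \<forall>j<R. infinite (subt T (u j))}"
proof -
  have ev: "spine_event T0 r t T \<longleftrightarrow> T \<in> pext S U \<and> (\<forall>i\<in>Dlev r T0. infinite (subt T (\<phi> i)))" if "is_tree T" for T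
    using core that by (simp add: spine_core_def U_eq)
  have "(\<forall>i\<in>Dlev r T0. infinite (subt T (\<phi> i))) \<longleftrightarrow> (\<forall>j<R. infinite (subt T (u j)))" for T
    unfolding e_leaves[symmetric] u_def by auto
  then show ?thesis unfolding Et_def trees_def using ev pext_is_tree[OF S(1) U_ends] by blast
qed

lemma spv_e: "T \<in> Et t \<Longrightarrow> j < R \<Longrightarrow> spv T (e j) = u j"
  using core e_mem by (simp add: spine_core_def Et_def trees_def u_def)

lemma card_U: "card U = R"
  unfolding U_def by (simp add: card_image inj_u)

lemma finite_U: "finite U"
  by (simp add: U_def)

text \<open>Origin of the law \<open>rho\<close>: \<open>S\<close> has as many edges as
  \<open>T0\<close> plus |t q| - 1 for each sector, and the number of sectors is 2|T0| - R - 1, so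
  the powers of 2 combine to one factor 2 per sector.\<close>

lemma weight: "(1/4) ^ edges S * 2 ^ (R + 1) = (\<Prod>q\<in>sects. rho (t q))"
proof -
  have ct: "card (t q) = Suc (edges (t q))" if "q \<in> sects" for q
    using good that by (intro edges_Suc) (auto simp: good_def is_tree_def)
  have "(\<Sum>q\<in>sects. card (t q)) = (\<Sum>q\<in>sects. edges (t q)) + card sects"
    by (simp add: ct sum_Suc)
  moreover have "card S = Suc (edges S)" using S pS ptree_Nil by (intro edges_Suc) auto
  moreover have "card S + 2 * card sects = card T0 + (\<Sum>q\<in>sects. card (t q))"
    using core by (simp add: spine_core_def Bball_T0)
  moreover have "card sects + R + 3 = 2 * card T0"
    using card_sectors[OF T0(1) r1] by (simp add: Dlev_T0 Bball_T0 R)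
  ultimately have "2 * edges S + card sects = (R + 1) + 2 * (\<Sum>q\<in>sects. edges (t q))" by linarith
  then have "(1/4) ^ edges S * 2 ^ (R + 1) = 2 ^ card sects * ((1/4) ^ (\<Sum>q\<in>sects. edges (t q)) :: real)"
    by (rule power_quarter)
  also have "\<dots> = (\<Prod>q\<in>sects. rho (t q))"
    unfolding rho_def by (simp only: prod.distrib prod_constant power_sum)
  finally show ?thesis .
qed

lemma Et_ev: "Et t = law.ev S {} {} U"
  unfolding Et_pext law.ev_def by (auto simp: U_def)

lemma Et_sets: "Et t \<in> sets (nu \<mu>)"
  unfolding Et_ev by (rule law.ev_sets[OF S]) (use U_ends in simp)

text \<open>All \<open>R\<close> ends survive and none is free, which leaves x ^ R, that is
  \<open>pw \<mu> R\<close>.\<close>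

lemma Et_prob: "measure (nu \<mu>) (Et t) = scale t * pw \<mu> R"
proof -
  have "measure (nu \<mu>) (Et t) = exp (- \<mu> * (real r - 1)) * (1/4) ^ edges S * 2 ^ (card ({} :: nat list set) + card ({} :: nat list set) + card U + 1)
      * gs \<mu> (card ({} :: nat list set)) (card U)"
    unfolding Et_ev by (rule law.ev_prob[OF finite_U S]) (use U_ends length_u in \<open>auto simp: U_def\<close>)
  also have "\<dots> = exp (- \<mu> * (real r - 1)) * ((1/4) ^ edges S * 2 ^ (R + 1)) * pw \<mu> R"
    by (simp add: card_U gs_0)
  finally show ?thesis unfolding weight scale_def .
qed

lemma subt_u:
  assumes "T \<in> Et t" "j < R" shows "ptree (subt T (u j))" "infinite (subt T (u j))"
  using assms ptree_subt_infinite[of T "u j"] pextD(1)[of T S U] unfolding Et_pext by auto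

lemma inf_branch_u: "T \<in> Et t \<Longrightarrow> j < R \<Longrightarrow> inf_branch T (e j) = plant (subt T (u j))"
  by (simp add: inf_branch_plant spv_e)

lemma inf_branch_tree:
  assumes "T \<in> Et t" "j < R" shows "is_tree (inf_branch T (e j))" "infinite (inf_branch T (e j))"
  using subt_u[OF assms] is_tree_plant by (simp_all add: inf_branch_u[OF assms])

text \<open>The set \<open>W j\<close> records which vertices of the top level of the
  \<open>j\<close>-th ball have infinitely many descendants.\<close>

context
  fixes h n :: nat and Sb :: "nat \<Rightarrow> tree"
  assumes hn: "h = Suc n" and Sb: "\<And>j. j < R \<Longrightarrow> is_tree (Sb j) \<and> finite (Sb j) \<and> height (Sb j) = h"
begin

text \<open>The root edge of a branch is already the last edge of \<open>S\<close> at its end, so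
  the ball is grafted without it and loses one level: \<open>n = h - 1\<close>.\<close>

definition f :: "nat \<Rightarrow> nat list set" where
  "f j = subt (Sb j) [0]"

definition D :: "nat \<Rightarrow> nat list set" where
  "D j = Dlev n (f j)"

definition PW :: "(nat \<Rightarrow> nat list set) set" where
  "PW = PiE {..<R} (\<lambda>j. {W. W \<subseteq> D j \<and> W \<noteq> {}})"

definition BW :: "(nat \<Rightarrow> nat list set) \<Rightarrow> nat list set" where
  "BW W = (\<Union>j<R. (@) (u j) ` W j)"

definition Sh :: tree where
  "Sh = graft S U (\<lambda>x. f (the_inv_into {..<R} u x))"

lemma plant_f: "j < R \<Longrightarrow> plant (f j) = Sb j"
  using plant_subt Sb by (simp add: f_def)

lemma f_props:
  assumes "j < R"
  shows "ptree (f j)" "finite (f j)" "\<And>w. w \<in> f j \<Longrightarrow> length w \<le> n" "finite (D j)"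
proof -
  have "[0] \<in> Sb j" using Sb[OF assms] is_tree_root_edge by blast
  then show p: "ptree (f j)" unfolding f_def using Sb[OF assms] ptree_subt is_tree_ptree by blast
  show "finite (f j)" using plant_f[OF assms] Sb[OF assms] finite_plant by metis
  show "length w \<le> n" if "w \<in> f j" for w
    using that length_le_height[of "Sb j" "0 # w"] Sb[OF assms] hn by (simp add: f_def)
  show "finite (D j)" unfolding D_def using finite_Dlev[OF p] .
qed

lemma Dh: "j < R \<Longrightarrow> card (Dlev h (Sb j)) = card (D j)"
  using card_Dlev_plant[of n "f j"] plant_f by (simp add: D_def hn)

lemma edges_Sb: "j < R \<Longrightarrow> edges (Sb j) = card (f j)"
  using edges_plant[of "f j"] plant_f by simp

lemma inv_u: "j < R \<Longrightarrow> the_inv_into {..<R} u (u j) = j"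
  using the_inv_into_f_f[OF inj_u] by simp

lemma fu: "x \<in> U \<Longrightarrow> ptree (f (the_inv_into {..<R} u x))" "x \<in> U \<Longrightarrow> finite (f (the_inv_into {..<R} u x))"
  by (auto simp: U_def inv_u f_props)

lemma Sh_tree: "is_tree Sh" "finite Sh"
  unfolding Sh_def by (rule is_tree_graft[OF S(1) U_ends fu(1)], assumption)
    (rule finite_graft[OF S(2) finite_U fu(2)], assumption)

lemma port_set: "{x @ v | x v. x \<in> U \<and> v \<in> Dlev n (f (the_inv_into {..<R} u x))} = BW D"
proof (intro set_eqI iffI)
  fix y assume "y \<in> {x @ v | x v. x \<in> U \<and> v \<in> Dlev n (f (the_inv_into {..<R} u x))}"
  then obtain j v where j: "j < R" "v \<in> Dlev n (f (the_inv_into {..<R} u (u j)))" "y = u j @ v"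
    unfolding U_def by blast
  then have "v \<in> D j" by (simp add: inv_u D_def)
  then show "y \<in> BW D" using j unfolding BW_def by blast
next
  fix y assume "y \<in> BW D"
  then obtain j v where j: "j < R" "v \<in> D j" "y = u j @ v" unfolding BW_def by blast
  then have "v \<in> Dlev n (f (the_inv_into {..<R} u (u j)))" "u j \<in> U" by (simp_all add: inv_u D_def U_def)
  then show "y \<in> {x @ v | x v. x \<in> U \<and> v \<in> Dlev n (f (the_inv_into {..<R} u x))}" using j by blast
qed

lemma BW_ends: "BW D \<subseteq> ends Sh"
proof -
  have "(U - U) \<union> {x @ v | x v. x \<in> U \<and> v \<in> Dlev n (f (the_inv_into {..<R} u x))} \<subseteq> ends Sh"
    unfolding Sh_def
  proof (rule ends_graft[OF pS subset_refl U_ends fu(1)])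
    fix x assume "x \<in> U"
    then obtain j where "j < R" "x = u j" by (auto simp: U_def)
    then show "Dlev n (f (the_inv_into {..<R} u x)) \<subseteq> ends (f (the_inv_into {..<R} u x))"
      using Dlev_ends[OF f_props(3)] by (simp add: inv_u)
  qed
  then show ?thesis unfolding port_set by simp
qed

lemma pext_Sh: "pext Sh (BW D) = {T \<in> pext S U. \<forall>j<R. Bball n (subt T (u j)) = f j}"
proof -
  have "pext Sh ((U - U) \<union> {x @ v | x v. x \<in> U \<and> v \<in> Dlev n (f (the_inv_into {..<R} u x))})
      = {T \<in> pext S U. \<forall>x\<in>U. subt T x \<in> pext (f (the_inv_into {..<R} u x)) (Dlev n (f (the_inv_into {..<R} u x)))}"
    unfolding Sh_def by (rule pext_graft[OF pS subset_refl U_ends fu(1)])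
  then have 1: "pext Sh (BW D) = {T \<in> pext S U. \<forall>j<R. subt T (u j) \<in> pext (f j) (Dlev n (f j))}"
    unfolding port_set by (auto simp: U_def inv_u)
  have 2: "subt T (u j) \<in> pext (f j) (Dlev n (f j)) \<longleftrightarrow> Bball n (subt T (u j)) = f j"
    if T: "T \<in> pext S U" and j: "j < R" for T j
  proof -
    have "u j \<in> ends S" using U_ends j by (auto simp: U_def)
    then have "u j \<in> T" using pextD(2)[OF T] ends_subset by blast
    then show ?thesis using ptree_subt[OF pextD(1)[OF T]] pext_Dlev[OF f_props(1,3)[OF j]] by simp
  qed
  show ?thesis unfolding 1 using 2 by auto
qed

lemma BW_mem:
  assumes "j < R" shows "u j @ v \<in> BW W \<longleftrightarrow> v \<in> W j"
proof
  assume "u j @ v \<in> BW W"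
  then obtain i w where i: "i < R" "w \<in> W i" "u j @ v = u i @ w" unfolding BW_def by blast
  have "u i \<in> ends S" "u j \<in> ends S" using U_ends i assms by (auto simp: U_def)
  then have "u i = u j" using ends_antichain[OF pS, of "u i" "u j" "u j @ v"] i(3) by (metis prefixI)
  then show "v \<in> W j" using inj_u i assms by (auto dest: inj_onD)
qed (use assms in \<open>auto simp: BW_def\<close>)

lemma BW_subset: "W \<in> PW \<Longrightarrow> BW W \<subseteq> BW D"
  unfolding BW_def PW_def by (fastforce simp: PiE_def Pi_def)

lemma card_BW:
  assumes "\<And>j. j < R \<Longrightarrow> finite (W j)" shows "card (BW W) = (\<Sum>j<R. card (W j))"
proof -
  have "card (BW W) = (\<Sum>j<R. card ((@) (u j) ` W j))"
    unfolding BW_def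
  proof (rule card_UN_disjoint)
    show "\<forall>i\<in>{..<R}. \<forall>j\<in>{..<R}. i \<noteq> j \<longrightarrow> (@) (u i) ` W i \<inter> (@) (u j) ` W j = {}"
    proof (intro ballI impI equals0I)
      fix i j w assume ij: "i \<in> {..<R}" "j \<in> {..<R}" "i \<noteq> j" "w \<in> (@) (u i) ` W i \<inter> (@) (u j) ` W j"
      have "u i \<in> ends S" "u j \<in> ends S" using U_ends ij by (auto simp: U_def)
      moreover have "prefix (u i) w" "prefix (u j) w" using ij(4) by (auto intro: prefixI)
      ultimately have "u i = u j" using ends_antichain[OF pS] by blast
      then show False using inj_u ij by (auto dest: inj_onD)
    qed
  qed (use assms in auto)
  also have "\<dots> = (\<Sum>j<R. card (W j))" by (intro sum.cong refl card_image) (auto simp: inj_on_def)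
  finally show ?thesis .
qed

lemma PW_D:
  assumes "W \<in> PW" "j < R" shows "W j \<subseteq> D j" "W j \<noteq> {}" "finite (W j)" "card (W j) \<ge> 1"
proof -
  show 1: "W j \<subseteq> D j" "W j \<noteq> {}" using assms by (auto simp: PW_def PiE_def Pi_def)
  show 2: "finite (W j)" using 1(1) f_props(4)[OF assms(2)] finite_subset by blast
  show "card (W j) \<ge> 1" using 1(2) 2 by (simp add: Suc_le_eq card_gt_0_iff)
qed

lemma finite_PW: "finite PW"
  unfolding PW_def using f_props(4) by (intro finite_PiE) auto

text \<open>An infinite branch has an infinite subtree at some vertex of level \<open>n\<close>, so
  each \<open>W j\<close> is nonempty; conversely any nonempty choice makes the branch
  infinite.\<close>

lemma fl_decomposition:
  "fl t (\<lambda>_. h) Sb = (\<Union>W\<in>PW. law.ev Sh {} (BW D - BW W) (BW W))"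
proof (intro set_eqI iffI)
  fix T assume T: "T \<in> fl t (\<lambda>_. h) Sb"
  then have TE: "T \<in> Et t" and br: "\<And>j. j < R \<Longrightarrow> inf_branch T (e j) \<in> tball h (Sb j)" by (auto simp: fl_def)
  have B: "Bball n (subt T (u j)) = f j" if j: "j < R" for j
  proof -
    have "Bball h (plant (subt T (u j))) = plant (f j)"
      using br[OF j] inf_branch_u[OF TE j] plant_f[OF j] by (simp add: tball_def)
    then show ?thesis unfolding hn Bball_plant by (rule plant_inj)
  qed
  then have TS: "T \<in> pext Sh (BW D)" using TE unfolding pext_Sh Et_pext by simp
  define W where "W = restrict (\<lambda>j. {v \<in> D j. infinite (subt T (u j @ v))}) {..<R}"
  have Wj: "W j = {v \<in> D j. infinite (subt T (u j @ v))}" if "j < R" for j using that by (simp add: W_def)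
  have "W \<in> PW"
    unfolding PW_def
  proof (rule PiE_I)
    fix j assume "j \<in> {..<R}"
    then have j: "j < R" by simp
    have "Dlev n (subt T (u j)) = D j" using B[OF j] unfolding D_def by (auto simp: Dlev_def Bball_def)
    then have "W j \<noteq> {}"
      using infinite_iff_level[OF subt_u(1)[OF TE j], of n] subt_u(2)[OF TE j] by (auto simp: Wj[OF j] subt_subt)
    then show "W j \<in> {W. W \<subseteq> D j \<and> W \<noteq> {}}" by (auto simp: Wj[OF j])
  qed (simp add: W_def)
  moreover have "T \<in> law.ev Sh {} (BW D - BW W) (BW W)"
  proof -
    have "BW D - BW W \<union> BW W = BW D" using BW_subset[OF \<open>W \<in> PW\<close>] by blast
    moreover have "infinite (subt T y) \<longleftrightarrow> y \<in> BW W" if y: "y \<in> BW D" for y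
    proof -
      obtain j v where "j < R" "v \<in> D j" "y = u j @ v" using y unfolding BW_def by blast
      then show ?thesis by (simp add: BW_mem Wj)
    qed
    ultimately show ?thesis using TS BW_subset[OF \<open>W \<in> PW\<close>] by (auto simp: law.ev_def)
  qed
  ultimately show "T \<in> (\<Union>W\<in>PW. law.ev Sh {} (BW D - BW W) (BW W))" by blast
next
  fix T assume "T \<in> (\<Union>W\<in>PW. law.ev Sh {} (BW D - BW W) (BW W))"
  then obtain W where W: "W \<in> PW" and T: "T \<in> law.ev Sh {} (BW D - BW W) (BW W)" by blast
  have "BW D - BW W \<union> BW W = BW D" using BW_subset[OF W] by blast
  then have TS: "T \<in> pext Sh (BW D)" and inf: "\<And>y. y \<in> BW W \<Longrightarrow> infinite (subt T y)"
    using T by (auto simp: law.ev_def)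
  have TU: "T \<in> pext S U" and B: "\<And>j. j < R \<Longrightarrow> Bball n (subt T (u j)) = f j" using TS unfolding pext_Sh by auto
  have "infinite (subt T (u j))" if j: "j < R" for j
  proof -
    obtain v where v: "v \<in> W j" using PW_D(2)[OF W j] by blast
    then have "infinite ((@) v ` subt T (u j @ v))"
      using inf[of "u j @ v"] BW_mem[OF j] by (simp add: finite_image_iff inj_on_def)
    moreover have "(@) v ` subt T (u j @ v) \<subseteq> subt T (u j)" by auto
    ultimately show ?thesis using finite_subset by blast
  qed
  then have TE: "T \<in> Et t" using TU by (simp add: Et_pext)
  moreover have "inf_branch T (e j) \<in> tball h (Sb j)" if j: "j < R" for j
    using inf_branch_tree(1)[OF TE j] B[OF j] plant_f[OF j]
    by (simp add: tball_def trees_def inf_branch_u[OF TE j] hn Bball_plant)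
  ultimately show "T \<in> fl t (\<lambda>_. h) Sb" by (simp add: fl_def)
qed

lemma ev_W_prob:
  assumes W: "W \<in> PW"
  shows "law.ev Sh {} (BW D - BW W) (BW W) \<in> sets (nu \<mu>)"
    "measure (nu \<mu>) (law.ev Sh {} (BW D - BW W) (BW W))
      = exp (- \<mu> * (real (r + n) - 1)) * (1/4) ^ edges Sh * 2 ^ ((\<Sum>j<R. card (D j)) + 1) * pw \<mu> (\<Sum>j<R. card (W j))"
proof -
  note sub = BW_subset[OF W]
  have un: "{} \<union> (BW D - BW W) \<union> BW W = BW D" using sub by blast
  show "law.ev Sh {} (BW D - BW W) (BW W) \<in> sets (nu \<mu>)"
    by (rule law.ev_sets[OF Sh_tree]) (use un BW_ends in simp)
  have finB: "finite (BW D)" unfolding BW_def using f_props(4) by simp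
  have len: "\<forall>y\<in>BW D. length y = r + n"
    unfolding BW_def D_def by (auto simp: length_u Dlev_def)
  have "card (BW D - BW W) + card (BW W) = card (BW D)"
    using card_Diff_subset[OF finite_subset[OF sub finB] sub] card_mono[OF finB sub] by simp
  then have c: "card ({} :: nat list set) + card (BW D - BW W) + card (BW W) = (\<Sum>j<R. card (D j))"
    using card_BW[of D] f_props(4) by simp
  have "measure (nu \<mu>) (law.ev Sh {} (BW D - BW W) (BW W))
      = exp (- \<mu> * (real (r + n) - 1)) * (1/4) ^ edges Sh
        * 2 ^ (card ({} :: nat list set) + card (BW D - BW W) + card (BW W) + 1) * gs \<mu> (card ({} :: nat list set)) (card (BW W))"
    by (rule law.ev_prob[OF finite_subset[OF sub finB] Sh_tree]) (use un BW_ends len in auto)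
  then show "measure (nu \<mu>) (law.ev Sh {} (BW D - BW W) (BW W))
      = exp (- \<mu> * (real (r + n) - 1)) * (1/4) ^ edges Sh * 2 ^ ((\<Sum>j<R. card (D j)) + 1) * pw \<mu> (\<Sum>j<R. card (W j))"
    unfolding c using card_BW[of W] PW_D(3)[OF W] by (simp add: gs_0)
qed

lemma edges_Sh: "edges Sh + R = edges S + (\<Sum>j<R. edges (Sb j))"
proof -
  have "card Sh + card U = card S + (\<Sum>x\<in>U. card (f (the_inv_into {..<R} u x)))"
    unfolding Sh_def by (rule card_graft[OF pS U_ends fu(1) S(2) fu(2)])
  moreover have "(\<Sum>x\<in>U. card (f (the_inv_into {..<R} u x))) = (\<Sum>j<R. edges (Sb j))"
    unfolding U_def by (simp add: sum.reindex[OF inj_u] inv_u edges_Sb)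
  moreover have "card S = Suc (edges S)" "card Sh = Suc (edges Sh)"
    using S Sh_tree is_tree_ptree ptree_Nil by (auto intro!: edges_Suc)
  ultimately show ?thesis by (simp add: card_U)
qed

definition Kb :: real where
  "Kb = exp (- \<mu> * real n) * (1/4) ^ (\<Sum>j<R. edges (Sb j)) * 2 ^ ((\<Sum>j<R. card (D j)) + R)"

text \<open>The \<open>R\<close> shared root edges give a factor 4 ^ R. One 2 ^ R of it goes to
  \<open>weight\<close>, the other to \<open>Kb\<close>, where it matches the additional 2 in the
  ball formula of each branch.\<close>

lemma Kb_scale: "exp (- \<mu> * (real (r + n) - 1)) * (1/4) ^ edges Sh * 2 ^ ((\<Sum>j<R. card (D j)) + 1) = scale t * Kb"
proof -
  let ?L = "\<Sum>j<R. card (D j)" and ?e = "\<Sum>j<R. edges (Sb j)"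
  have "(1/4 :: real) ^ edges Sh * (1/4) ^ R = (1/4) ^ edges S * (1/4) ^ ?e"
    using edges_Sh by (metis power_add)
  then have e: "(1/4 :: real) ^ edges Sh = (1/4) ^ edges S * (1/4) ^ ?e * 4 ^ R"
    by (simp add: power_divide field_simps)
  have "(4 :: real) ^ R = 2 ^ R * 2 ^ R" by (simp flip: power_mult_distrib)
  moreover have "exp (- \<mu> * (real (r + n) - 1)) = exp (- \<mu> * (real r - 1)) * exp (- \<mu> * real n)"
    by (simp add: algebra_simps flip: exp_add)
  ultimately show ?thesis unfolding e scale_def Kb_def weight[symmetric] by (simp add: power_add)
qed

lemma fl_uniform: "emeasure (nu \<mu>) (fl t (\<lambda>_. h) Sb) = ennreal (scale t * (Kb * (\<Sum>W\<in>PW. pw \<mu> (\<Sum>j<R. card (W j)))))"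
proof -
  let ?A = "\<lambda>W. law.ev Sh {} (BW D - BW W) (BW W)"
  have "disjoint_family_on ?A PW"
  proof (unfold disjoint_family_on_def, intro ballI impI equals0I)
    fix W W' T assume W: "W \<in> PW" "W' \<in> PW" "W \<noteq> W'" and T: "T \<in> ?A W \<inter> ?A W'"
    have iff: "y \<in> BW V \<longleftrightarrow> infinite (subt T y)" if "T \<in> ?A V" "y \<in> BW D" for V y
      using that by (auto simp: law.ev_def)
    have "W j = W' j" if j: "j < R" for j
    proof -
      have "v \<in> W j \<longleftrightarrow> v \<in> W' j" if "v \<in> D j" for v
        using iff[of W "u j @ v"] iff[of W' "u j @ v"] T BW_mem[OF j] that by blast
      then show ?thesis using PW_D(1)[OF W(1) j] PW_D(1)[OF W(2) j] by blast
    qed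
    then have "W = W'" using W(1,2) unfolding PW_def by (intro PiE_ext) auto
    then show False using W(3) by blast
  qed
  then have "measure (nu \<mu>) (fl t (\<lambda>_. h) Sb) = (\<Sum>W\<in>PW. measure (nu \<mu>) (?A W))"
    unfolding fl_decomposition by (intro law.finite_measure_finite_Union finite_PW) (use ev_W_prob(1) in auto)
  also have "\<dots> = (\<Sum>W\<in>PW. scale t * Kb * pw \<mu> (\<Sum>j<R. card (W j)))"
    by (intro sum.cong refl) (simp only: ev_W_prob(2) Kb_scale)
  also have "\<dots> = scale t * (Kb * (\<Sum>W\<in>PW. pw \<mu> (\<Sum>j<R. card (W j))))"
    by (simp only: sum_distrib_left mult.assoc)
  finally show ?thesis by (simp add: law.emeasure_eq_measure)
qed

text \<open>The product of the binomial sums of the branches is a sum over families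
  \<open>W\<close>. The exponentials multiply to exp (- \<mu> n) because the coordinates sum to
  \<mu>, and the Dirichlet integral merges the exponents. The outcome is the sum in
  \<open>fl_uniform\<close>, in which \<open>t\<close> enters only through \<open>scale t\<close>:
  this is the independence of finite and infinite branches.\<close>

lemma fr_uniform: "fr (\<lambda>_. h) Sb = ennreal (Kb * (\<Sum>W\<in>PW. pw \<mu> (\<Sum>j<R. card (W j))))"
proof -
  let ?P = "PiM {..<R-1} (\<lambda>_. lborel) :: (nat \<Rightarrow> real) measure"
  have K0: "Kb \<ge> 0" by (simp add: Kb_def)
  have pt: "(\<Prod>j<R. ennreal (ball_prob_fun h (Sb j) (simplex_pt R \<mu> x j)))
      = (\<Sum>W\<in>PW. ennreal Kb * ennreal (\<Prod>j<R. pw (simplex_pt R \<mu> x j) (card (W j))))"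
    if x: "x \<in> simplex_par R \<mu>" for x
  proof -
    let ?m = "simplex_pt R \<mu> x"
    have m: "?m j \<ge> 0" for j using simplex_pt_pos[OF x, of j] by simp
    have b: "ball_prob_fun h (Sb j) (?m j) = exp (- ?m j * real n) * (1/4) ^ edges (Sb j) * 2 ^ (card (D j) + 1)
        * (\<Sum>W\<in>{W. W \<subseteq> D j \<and> W \<noteq> {}}. pw (?m j) (card W))" if "j < R" for j
      using Sb[OF that] gs_subsets[OF f_props(4)[OF that]] by (simp add: ball_prob_fun_def Dh[OF that, unfolded hn] hn)
    have "(\<Prod>j<R. ennreal (ball_prob_fun h (Sb j) (?m j))) = ennreal (\<Prod>j<R. ball_prob_fun h (Sb j) (?m j))"
      using m by (intro prod_ennreal) (simp add: b sum_nonneg pw_nonneg)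
    also have "(\<Prod>j<R. ball_prob_fun h (Sb j) (?m j))
        = (\<Prod>j<R. exp (- ?m j * real n)) * (\<Prod>j<R. (1/4) ^ edges (Sb j)) * (\<Prod>j<R. 2 ^ (card (D j) + 1))
          * (\<Prod>j<R. \<Sum>W\<in>{W. W \<subseteq> D j \<and> W \<noteq> {}}. pw (?m j) (card W))"
      by (simp add: b prod.distrib)
    also have "(\<Prod>j<R. exp (- ?m j * real n)) = exp (- \<mu> * real n)"
    proof -
      have "(\<Sum>j<R. - ?m j * real n) = - \<mu> * real n"
        unfolding sum_distrib_right[symmetric] sum_negf simplex_pt_sum[OF R1] ..
      then show ?thesis by (simp add: exp_sum[symmetric])
    qed
    also have "(\<Prod>j<R. (1/4 :: real) ^ edges (Sb j)) = (1/4) ^ (\<Sum>j<R. edges (Sb j))" by (simp add: power_sum)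
    also have "(\<Prod>j<R. (2 :: real) ^ (card (D j) + 1)) = 2 ^ ((\<Sum>j<R. card (D j)) + R)"
    proof -
      have "(\<Sum>j<R. card (D j) + 1) = (\<Sum>j<R. card (D j)) + R" by (simp add: sum_Suc)
      then show ?thesis by (simp only: power_sum[symmetric])
    qed
    also have "(\<Prod>j<R. \<Sum>W\<in>{W. W \<subseteq> D j \<and> W \<noteq> {}}. pw (?m j) (card W)) = (\<Sum>W\<in>PW. \<Prod>j<R. pw (?m j) (card (W j)))"
      unfolding PW_def using f_props(4) by (intro prod_sum_PiE) auto
    finally have "(\<Prod>j<R. ennreal (ball_prob_fun h (Sb j) (?m j)))
        = ennreal (\<Sum>W\<in>PW. Kb * (\<Prod>j<R. pw (?m j) (card (W j))))"
      by (simp add: Kb_def sum_distrib_left)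
    also have "\<dots> = (\<Sum>W\<in>PW. ennreal Kb * ennreal (\<Prod>j<R. pw (?m j) (card (W j))))"
      using K0 m by (subst sum_ennreal[symmetric]) (auto intro!: sum.cong ennreal_mult mult_nonneg_nonneg prod_nonneg pw_nonneg)
    finally show ?thesis .
  qed
  have "fr (\<lambda>_. h) Sb = (\<integral>\<^sup>+x. (\<Sum>W\<in>PW. ennreal Kb * (ennreal (\<Prod>j<R. pw (simplex_pt R \<mu> x j) (card (W j))) * indicator (simplex_par R \<mu>) x)) \<partial>?P)"
    unfolding fr_def by (intro nn_integral_cong) (auto simp: indicator_def pt)
  also have "\<dots> = (\<Sum>W\<in>PW. \<integral>\<^sup>+x. ennreal Kb * (ennreal (\<Prod>j<R. pw (simplex_pt R \<mu> x j) (card (W j))) * indicator (simplex_par R \<mu>) x) \<partial>?P)"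
    by (rule nn_integral_sum) measurable
  also have "\<dots> = (\<Sum>W\<in>PW. ennreal Kb * (\<integral>\<^sup>+x. ennreal (\<Prod>j<R. pw (simplex_pt R \<mu> x j) (card (W j))) * indicator (simplex_par R \<mu>) x \<partial>?P))"
    by (intro sum.cong refl nn_integral_cmult) measurable
  also have "\<dots> = (\<Sum>W\<in>PW. ennreal Kb * ennreal (pw \<mu> (\<Sum>j<R. card (W j))))"
    by (intro sum.cong refl arg_cong2[where f = "(*)"] simplex_dirichlet[OF R1 mu]) (rule PW_D(4))
  also have "\<dots> = ennreal (\<Sum>W\<in>PW. Kb * pw \<mu> (\<Sum>j<R. card (W j)))"
    using K0 mu by (subst sum_ennreal[symmetric]) (auto intro!: sum.cong mult_nonneg_nonneg pw_nonneg simp: ennreal_mult pw_nonneg)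
  finally show ?thesis by (simp add: sum_distrib_left)
qed

end

text \<open>If some \<open>Sb j\<close> is not a finite tree of height \<open>h\<close>, both sides
  vanish, since the branches are infinite.\<close>

lemma fl_fr_uniform:
  assumes h: "1 \<le> h"
  shows "emeasure (nu \<mu>) (fl t (\<lambda>_. h) Sb) = ennreal (scale t) * fr (\<lambda>_. h) Sb"
proof (cases "\<forall>j<R. is_tree (Sb j) \<and> finite (Sb j) \<and> height (Sb j) = h")
  case True
  obtain n where n: "h = Suc n" using h by (metis One_nat_def Suc_le_D)
  have Sb: "is_tree (Sb j) \<and> finite (Sb j) \<and> height (Sb j) = h" if "j < R" for j using True that by blast
  show ?thesis
    using fl_uniform[OF n Sb] fr_uniform[OF n Sb] by (simp add: ennreal_mult' scale_nonneg)
next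
  case False
  then obtain j where j: "j < R" "\<not> (is_tree (Sb j) \<and> finite (Sb j) \<and> height (Sb j) = h)" by blast
  have "fl t (\<lambda>_. h) Sb = {}"
  proof (rule equals0I)
    fix T assume T: "T \<in> fl t (\<lambda>_. h) Sb"
    then have TE: "T \<in> Et t" and B: "Bball h (inf_branch T (e j)) = Sb j" using j by (auto simp: fl_def tball_def)
    show False using infinite_tree_ball[OF inf_branch_tree[OF TE j(1)] h] j(2) unfolding B by blast
  qed
  moreover have "fr (\<lambda>_. h) Sb = 0"
  proof -
    have "ball_prob_fun h (Sb j) m = 0" for m using j(2) h by (auto simp: ball_prob_fun_def)
    then have "(\<Prod>j<R. ennreal (ball_prob_fun h (Sb j) (simplex_pt R \<mu> x j))) = 0" for x
      using j(1) by (intro prod_zero) (auto intro!: bexI[of _ j])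
    then have "fr (\<lambda>_. h) Sb = (\<integral>\<^sup>+(x :: nat \<Rightarrow> real). 0 \<partial>PiM {..<R-1} (\<lambda>_. lborel))"
      unfolding fr_def by (simp only: mult_zero_left)
    then show ?thesis by simp
  qed
  ultimately show ?thesis by simp
qed

text \<open>On \<open>Et t\<close> the word \<open>spv T (e j)\<close> is the constant
  \<open>u j\<close>, so the branches are read off from the membership of fixed words in
  \<open>T\<close>.\<close>

lemma fl_sets: "fl t s Sb \<in> sets (nu \<mu>)"
proof -
  have "Measurable.pred (nu \<mu>) (\<lambda>T. T \<in> fl t s Sb)"
  proof -
    have 1: "T \<in> fl t s Sb \<longleftrightarrow> T \<in> Et t \<and> (\<forall>j\<in>{..<R}. \<forall>w. (w \<in> Sb j \<longleftrightarrow> (w = [] \<or> (hd w = 0 \<and> u j @ tl w \<in> T)) \<and> length w \<le> s j))" for T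
    proof -
      have "inf_branch T (e j) \<in> tball (s j) (Sb j) \<longleftrightarrow> (\<forall>w. (w \<in> Sb j \<longleftrightarrow> (w = [] \<or> (hd w = 0 \<and> u j @ tl w \<in> T)) \<and> length w \<le> s j))"
        if TE: "T \<in> Et t" and j: "j < R" for j
      proof -
        have "w \<in> plant (subt T (u j)) \<longleftrightarrow> w = [] \<or> (hd w = 0 \<and> u j @ tl w \<in> T)" for w
          by (cases w) (auto simp: plant_def)
        then have "Bball (s j) (plant (subt T (u j))) = Sb j \<longleftrightarrow> (\<forall>w. (w \<in> Sb j \<longleftrightarrow> (w = [] \<or> (hd w = 0 \<and> u j @ tl w \<in> T)) \<and> length w \<le> s j))"
          unfolding Bball_def set_eq_iff by auto
        then show ?thesis using inf_branch_tree(1)[OF TE j] by (simp add: tball_def trees_def inf_branch_u[OF TE j])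
      qed
      then show ?thesis by (auto simp: fl_def)
    qed
    have [measurable]: "Et t \<in> sets (nu \<mu>)" by (rule Et_sets)
    show ?thesis unfolding 1 by measurable
  qed
  then have "{T \<in> space (nu \<mu>). T \<in> fl t s Sb} \<in> sets (nu \<mu>)" by (simp add: pred_def)
  moreover have "fl t s Sb \<subseteq> space (nu \<mu>)" by (auto simp: fl_def Et_def law.space_M)
  then have "{T \<in> space (nu \<mu>). T \<in> fl t s Sb} = fl t s Sb" by blast
  ultimately show ?thesis by (simp only:)
qed

text \<open>A ball of radius \<open>s j\<close> is a countable disjoint union of balls of the larger radius \<open>h\<close>, and both
  sides are countably additive in each coordinate.\<close>

lemma fl_fr:
  assumes "finite X" "X \<subseteq> {..<R}" "1 \<le> h" "\<And>j. j < R \<Longrightarrow> s j \<le> h" "\<And>j. j < R \<Longrightarrow> j \<notin> X \<Longrightarrow> s j = h"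
  shows "emeasure (nu \<mu>) (fl t s Sb) = ennreal (scale t) * fr s Sb"
  using assms(1,2,4,5)
proof (induction X arbitrary: s Sb rule: finite_induct)
  case empty
  then have s: "s j = h" if "j < R" for j using that by blast
  have "fl t s Sb = fl t (\<lambda>_. h) Sb" using s by (auto simp: fl_def)
  moreover have "fr s Sb = fr (\<lambda>_. h) Sb" unfolding fr_def using s by (intro nn_integral_cong) simp
  ultimately show ?case using fl_fr_uniform[OF assms(3)] by simp
next
  case (insert i X)
  have i: "i < R" using insert.prems(1) by simp
  define K where "K = {S' :: tree. finite S' \<and> Bball (s i) S' = Sb i}"
  have cK: "countable K"
    unfolding K_def by (rule countable_subset[OF _ countable_Collect_finite]) auto
  let ?s = "s(i := h)" and ?S = "\<lambda>S'. Sb(i := S')"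
  have IH: "emeasure (nu \<mu>) (fl t ?s (?S S')) = ennreal (scale t) * fr ?s (?S S')" for S'
    by (rule insert.IH) (use insert.prems in auto)
  have "fl t s Sb = (\<Union>S'\<in>K. fl t ?s (?S S'))"
  proof -
    have "inf_branch T (e i) \<in> tball (s i) (Sb i) \<longleftrightarrow> (\<exists>S'\<in>K. inf_branch T (e i) \<in> tball h S')" for T
      unfolding tball_refine[OF insert.prems(2)[OF i]] K_def by blast
    then show ?thesis unfolding fl_def using i by (auto simp: fun_upd_apply split: if_splits) blast+
  qed
  moreover have "disjoint_family_on (\<lambda>S'. fl t ?s (?S S')) K"
    using i by (auto simp: disjoint_family_on_def fl_def tball_def)
  ultimately have "emeasure (nu \<mu>) (fl t s Sb) = (\<integral>\<^sup>+S'. emeasure (nu \<mu>) (fl t ?s (?S S')) \<partial>count_space K)"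
    using fl_sets cK by (simp add: emeasure_UN_countable)
  also have "\<dots> = ennreal (scale t) * (\<integral>\<^sup>+S'. fr ?s (?S S') \<partial>count_space K)"
    unfolding IH by (rule nn_integral_cmult) simp
  also have "(\<integral>\<^sup>+S'. fr ?s (?S S') \<partial>count_space K) = fr s Sb"
  proof -
    let ?P = "PiM {..<R-1} (\<lambda>_. lborel) :: (nat \<Rightarrow> real) measure"
    let ?b = "\<lambda>s Sb x. (\<Prod>j<R. ennreal (ball_prob_fun (s j) (Sb j) (simplex_pt R \<mu> x j))) * indicator (simplex_par R \<mu>) x"
    have "(\<integral>\<^sup>+S'. fr ?s (?S S') \<partial>count_space K) = (\<integral>\<^sup>+x. (\<integral>\<^sup>+S'. ?b ?s (?S S') x \<partial>count_space K) \<partial>?P)"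
      unfolding fr_def by (rule nn_integral_count_space_nn_integral[OF cK, symmetric]) measurable
    also have "\<dots> = (\<integral>\<^sup>+x. ?b s Sb x \<partial>?P)"
    proof (rule nn_integral_cong)
      fix x :: "nat \<Rightarrow> real"
      show "(\<integral>\<^sup>+S'. ?b ?s (?S S') x \<partial>count_space K) = ?b s Sb x"
      proof (cases "x \<in> simplex_par R \<mu>")
        case True
        let ?m = "simplex_pt R \<mu> x"
        let ?q = "\<Prod>j\<in>{..<R} - {i}. ennreal (ball_prob_fun (s j) (Sb j) (?m j))"
        have split: "(\<Prod>j<R. g j) = g i * (\<Prod>j\<in>{..<R} - {i}. g j)" for g :: "nat \<Rightarrow> ennreal"
          using i by (simp add: prod.remove)
        have "(\<integral>\<^sup>+S'. ?b ?s (?S S') x \<partial>count_space K) = (\<integral>\<^sup>+S'. ennreal (ball_prob_fun h S' (?m i)) * ?q \<partial>count_space K)"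
          using True by (intro nn_integral_cong) (simp add: split)
        also have "\<dots> = ennreal (ball_prob_fun (s i) (Sb i) (?m i)) * ?q"
          unfolding ball_prob_refine[OF is_nu_family_law[OF nu simplex_pt_pos[OF True]] insert.prems(2)[OF i]] K_def
          by (rule nn_integral_multc) simp
        also have "\<dots> = ?b s Sb x" using True by (simp add: split)
        finally show ?thesis .
      qed simp
    qed
    finally show ?thesis by (simp only: fr_def)
  qed
  finally show ?case .
qed

end

section \<open>Summation over the finite branches, and conditioning\<close>

context spine_law
begin

lemma fl_fr_all:
  assumes "good t" shows "emeasure (nu \<mu>) (fl t s Sb) = ennreal (scale t) * fr s Sb"
proof -
  obtain S \<phi> where core: "spine_core T0 r t S \<phi>" using core_exists[OF assms] by blast
  interpret spine_law_core nu \<mu> T0 r R e t S \<phi> by unfold_locales (rule assms, rule core)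
  show ?thesis
    \<comment> \<open>The 1 is inserted because the common radius must be positive even if every
      \<open>s j\<close> is 0.\<close>
    by (rule fl_fr[of "{..<R}" "Max (insert 1 (s ` {..<R}))"]) (auto intro: Max_ge)
qed

lemma Et_good:
  assumes "good t"
  shows "Et t \<in> sets (nu \<mu>)" "emeasure (nu \<mu>) (Et t) = ennreal (scale t * pw \<mu> R)"
proof -
  obtain S \<phi> where core: "spine_core T0 r t S \<phi>" using core_exists[OF assms] by blast
  interpret spine_law_core nu \<mu> T0 r R e t S \<phi> by unfold_locales (rule assms, rule core)
  show "Et t \<in> sets (nu \<mu>)" by (rule Et_sets)
  show "emeasure (nu \<mu>) (Et t) = ennreal (scale t * pw \<mu> R)"
    by (simp add: law.emeasure_eq_measure Et_prob)
qed

lemma E_sector_branch: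
  assumes T: "T \<in> E" and q: "(i, n) \<in> sects"
  shows "is_tree (sector_branch T0 T i n) \<and> finite (sector_branch T0 T i n)"
proof -
  have tr: "is_tree T" "infinite T" "Bball r (chi T) = T0" using T by (auto simp: E_def trees_def)
  note pT = is_tree_ptree[OF tr(1)] and pT0 = is_tree_ptree[OF T0(1)]
  have i: "i \<in> T0" "length i < r" "n \<le> nch T0 i" using q by (auto simp: sectors_def)
  have "i \<in> chi T" using i tr(3) by (auto simp: Bball_def)
  then have inf: "infinite (subt T (spv T i))" using in_chi_iff[OF pT] by blast
  have "Bball (Suc (length i)) (chi T) = Bball (Suc (length i)) T0"
    using i(2) unfolding tr(3)[symmetric] by (auto simp: Bball_def)
  then have "card (ik (subt T (spv T i))) = nch T0 i"
    unfolding Bball_chi_Suc[OF pT pT0] using i(1) by (auto simp: Dlev_def)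
  then show ?thesis
    using sec_is_tree[OF ptree_subt_infinite[OF pT inf], of n] i(3) by (simp add: sector_branch_sec[OF pT])
qed

text \<open>\<open>E\<close> is the disjoint union of the \<open>Et t\<close>, whose masses are a
  constant times the product of the \<open>rho (t q)\<close>. These products sum to 1, so the
  constant is the probability.\<close>

lemma E_prob: "measure (nu \<mu>) E = exp (- (real r - 1) * \<mu>) * pw \<mu> R"
proof -
  \<comment> \<open>The default \<open>{}\<close> makes a family determined by its values on the
    sectors, so that different families give disjoint events.\<close>
  define Q where "Q = Pi_pmf sects {} (\<lambda>_. rho_pmf)"
  define a where "a = exp (- \<mu> * (real r - 1)) * pw \<mu> R"
  have a0: "a \<ge> 0" using pw_R by (simp add: a_def)
  have setQ: "t \<in> set_pmf Q \<longleftrightarrow> good t \<and> (\<forall>q. q \<notin> sects \<longrightarrow> t q = {})" for t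
    unfolding Q_def set_Pi_pmf[OF finite_sects] by (auto simp: PiE_dflt_def set_rho_pmf good_def)
  have pmfQ: "ennreal (scale t * pw \<mu> R) = ennreal a * ennreal (pmf Q t)" if t: "t \<in> set_pmf Q" for t
  proof -
    have g: "good t" "\<And>q. q \<notin> sects \<Longrightarrow> t q = {}" using iffD1[OF setQ t] by blast+
    have "pmf Q t = (\<Prod>q\<in>sects. pmf rho_pmf (t q))"
      unfolding Q_def by (rule pmf_Pi'[OF finite_sects g(2)])
    also have "\<dots> = (\<Prod>q\<in>sects. rho (t q))"
      by (intro prod.cong refl pmf_rho) (use g(1) in \<open>auto simp: good_def\<close>)
    finally have "scale t * pw \<mu> R = a * pmf Q t" by (simp add: scale_def a_def)
    then show ?thesis using a0 by (simp add: ennreal_mult)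
  qed
  have UN: "E = (\<Union>t\<in>set_pmf Q. Et t)"
  proof (intro set_eqI iffI)
    fix T assume T: "T \<in> E"
    define t where "t q = (if q \<in> sects then sector_branch T0 T (fst q) (snd q) else {})" for q
    have "good t" unfolding good_def t_def using E_sector_branch[OF T] by auto
    then have "t \<in> set_pmf Q" by (simp add: setQ t_def)
    moreover have "T \<in> Et t" using T by (auto simp: Et_eq t_def)
    ultimately show "T \<in> (\<Union>t\<in>set_pmf Q. Et t)" by blast
  qed (auto simp: Et_eq)
  have disj: "disjoint_family_on Et (set_pmf Q)"
  proof (unfold disjoint_family_on_def, intro ballI impI equals0I)
    fix t t' T assume t: "t \<in> set_pmf Q" "t' \<in> set_pmf Q" "t \<noteq> t'" and T: "T \<in> Et t \<inter> Et t'"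
    have "t q = t' q" for q
    proof (cases "q \<in> sects")
      case True
      have "\<forall>(i, n)\<in>sects. sector_branch T0 T i n = t (i, n)" "\<forall>(i, n)\<in>sects. sector_branch T0 T i n = t' (i, n)"
        using T by (simp_all add: Et_eq)
      from bspec[OF this(1) True] bspec[OF this(2) True] show ?thesis by (cases q) simp
    next
      case False then show ?thesis using t setQ by metis
    qed
    then show False using t(3) by blast
  qed
  have goodQ: "good t" if "t \<in> set_pmf Q" for t using iffD1[OF setQ that] by blast
  have "emeasure (nu \<mu>) E = (\<integral>\<^sup>+t. emeasure (nu \<mu>) (Et t) \<partial>count_space (set_pmf Q))"
    unfolding UN by (rule emeasure_UN_countable[OF Et_good(1)[OF goodQ] countable_set_pmf disj])
  also have "\<dots> = (\<integral>\<^sup>+t. ennreal a * ennreal (pmf Q t) \<partial>count_space (set_pmf Q))"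
    by (intro nn_integral_cong) (simp add: Et_good(2)[OF goodQ] pmfQ)
  also have "\<dots> = ennreal a * emeasure (measure_pmf Q) (set_pmf Q)"
    by (simp only: nn_integral_cmult borel_measurable_count_space nn_integral_pmf)
  also have "emeasure (measure_pmf Q) (set_pmf Q) = 1"
    by (rule measure_pmf.emeasure_eq_1_AE) (simp_all add: AE_measure_pmf)
  finally have "measure (nu \<mu>) E = a" using a0 by (simp add: measure_def)
  moreover have "exp (- (real r - 1) * \<mu>) = exp (- \<mu> * (real r - 1))"
    by (rule arg_cong[where f = exp]) (simp add: algebra_simps)
  ultimately show ?thesis by (simp only: a_def)
qed

text \<open>Products of probabilities are at most 1, so \<open>fr\<close> is bounded by the volume
  of the simplex and can be passed to a real integral.\<close>

lemma simplex_integral_fr: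
  obtains v where "fr s Sb = ennreal v" "0 \<le> v"
    "simplex_integral R \<mu> (\<lambda>m. \<Prod>j<R. measure (nu (m j)) (tball (s j) (Sb j))) = v / pw \<mu> R"
proof -
  let ?P = "PiM {..<R-1} (\<lambda>_. lborel) :: (nat \<Rightarrow> real) measure"
  let ?f = "\<lambda>m. \<Prod>j<R. measure (nu (m j)) (tball (s j) (Sb j))"
  have b: "measure (nu (simplex_pt R \<mu> x j)) (tball (s j) (Sb j)) = ball_prob_fun (s j) (Sb j) (simplex_pt R \<mu> x j)"
    if "x \<in> simplex_par R \<mu>" for x j
    using nu_law.tball_prob[OF is_nu_family_law[OF nu simplex_pt_pos[OF that]]] .
  have le1: "measure (nu (simplex_pt R \<mu> x j)) (tball (s j) (Sb j)) \<le> 1" if "x \<in> simplex_par R \<mu>" for x j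
    using nu_law.axioms(1)[OF is_nu_family_law[OF nu simplex_pt_pos[OF that, of j]]] by (rule prob_space.prob_le_1)
  have fr_eq: "fr s Sb = (\<integral>\<^sup>+x. ennreal (?f (simplex_pt R \<mu> x)) * indicator (simplex_par R \<mu>) x \<partial>?P)"
    unfolding fr_def
    by (intro nn_integral_cong) (auto simp: indicator_def b[symmetric] prod_ennreal)
  also have "\<dots> \<le> (\<integral>\<^sup>+x. 1 * indicator (simplex_par R \<mu>) x \<partial>?P)"
  proof (rule nn_integral_mono)
    fix x
    show "ennreal (?f (simplex_pt R \<mu> x)) * indicator (simplex_par R \<mu>) x \<le> 1 * indicator (simplex_par R \<mu>) x"
      using le1[of x] prod_le_1[of "{..<R}" "\<lambda>j. measure (nu (simplex_pt R \<mu> x j)) (tball (s j) (Sb j))"]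
      by (auto simp: indicator_def)
  qed
  also have "\<dots> = ennreal (pw \<mu> R)"
    by (simp only: mult_1 nn_integral_indicator[OF simplex_par_sets] emeasure_simplex[OF R1 mu])
  finally have "fr s Sb < top" using ennreal_less_top order_le_less_trans by blast
  then obtain v where v: "fr s Sb = ennreal v" "0 \<le> v" by (cases "fr s Sb" rule: ennreal_cases) auto
  moreover have "simplex_integral R \<mu> ?f = v / pw \<mu> R"
  proof (rule simplex_integral_nn[OF R1 mu _ _ _ v(2)])
    have "indicator (simplex_par R \<mu>) x * ?f (simplex_pt R \<mu> x)
        = indicator (simplex_par R \<mu>) x * (\<Prod>j<R. ball_prob_fun (s j) (Sb j) (simplex_pt R \<mu> x j))" for x
      by (auto simp: indicator_def b)
    then have eq: "(\<lambda>x. indicator (simplex_par R \<mu>) x * ?f (simplex_pt R \<mu> x))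
        = (\<lambda>x. indicator (simplex_par R \<mu>) x * (\<Prod>j<R. ball_prob_fun (s j) (Sb j) (simplex_pt R \<mu> x j)))"
      by (rule ext)
    show "(\<lambda>x. indicator (simplex_par R \<mu>) x * ?f (simplex_pt R \<mu> x)) \<in> borel_measurable ?P"
      unfolding eq by measurable
    show "(\<integral>\<^sup>+x. ennreal (?f (simplex_pt R \<mu> x)) * indicator (simplex_par R \<mu>) x \<partial>?P) = ennreal v"
      using fr_eq v(1) by simp
  qed (auto intro: prod_nonneg)
  ultimately show ?thesis using that by blast
qed

lemma conditional_law:
  assumes t: "good t"
  shows "measure (nu \<mu>) (fl t s Sb) / measure (nu \<mu>) E
    = simplex_integral R \<mu> (\<lambda>m. \<Prod>j<R. measure (nu (m j)) (tball (s j) (Sb j))) * (\<Prod>q\<in>sects. rho (t q))"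
proof -
  obtain v where v: "fr s Sb = ennreal v" "0 \<le> v"
    "simplex_integral R \<mu> (\<lambda>m. \<Prod>j<R. measure (nu (m j)) (tball (s j) (Sb j))) = v / pw \<mu> R"
    by (rule simplex_integral_fr)
  have "emeasure (nu \<mu>) (fl t s Sb) = ennreal (scale t * v)"
    using fl_fr_all[OF t, of s Sb] v scale_nonneg by (simp add: ennreal_mult)
  then have "measure (nu \<mu>) (fl t s Sb) = scale t * v"
    using v scale_nonneg by (simp add: measure_def)
  moreover have "x * p * v / (x * w) = v / w * p" if "x \<noteq> 0" for x p w :: real using that by simp
  moreover have "exp (- (real r - 1) * \<mu>) = exp (- \<mu> * (real r - 1))" by (rule arg_cong[where f = exp]) (simp add: algebra_simps)
  ultimately show ?thesis unfolding v(3) E_prob scale_def by (simp only: exp_not_eq_zero not_False_eq_True)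
qed

end

text \<open>Part (ii) is expressed on balls for the infinite branches and on points for the finite
  ones. Two balls are nested or disjoint and finite trees are countably many, so these events form
  an intersection-stable generator and determine the conditional law.\<close>

theorem mainTheorem15:
  fixes nu :: "real \<Rightarrow> tree measure" and \<mu> :: real
    and T0 :: tree and r R :: nat and e :: "nat \<Rightarrow> nat list"
  assumes nu: "is_nu_family nu"
    and mu: "\<mu> > 0"
    and T0: "is_tree T0" "finite T0" "height T0 = r"
    and lv: "\<forall>l\<in>leaves T0. length l = r"
    and R: "R = card (leaves T0)"
    and e: "bij_betw e {..<R} (leaves T0)"
  defines "E \<equiv> {T \<in> trees. infinite T \<and> Bball r (chi T) = T0}"
  shows "measure (nu \<mu>) E = exp (- (real r - 1) * \<mu>) * \<mu> ^ (R - 1) / fact (R - 1)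
    \<and> (\<forall>(s :: nat \<Rightarrow> nat) (S :: nat \<Rightarrow> tree) (t :: nat list \<times> nat \<Rightarrow> tree).
           (\<forall>q\<in>sectors T0 r. is_tree (t q) \<and> finite (t q)) \<longrightarrow>
           measure (nu \<mu>) {T \<in> E. (\<forall>j<R. inf_branch T (e j) \<in> tball (s j) (S j))
                               \<and> (\<forall>(i, n)\<in>sectors T0 r. sector_branch T0 T i n = t (i, n))}
             / measure (nu \<mu>) E
           = simplex_integral R \<mu> (\<lambda>m. \<Prod>j<R. measure (nu (m j)) (tball (s j) (S j)))
             * (\<Prod>q\<in>sectors T0 r. rho (t q)))"
proof -
  interpret S: spine_law nu \<mu> T0 r R e
    by unfold_locales (fact nu mu T0 lv R e)+
  have E: "E = S.E" by (simp add: E_def S.E_def)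
  have fl: "{T \<in> E. (\<forall>j<R. inf_branch T (e j) \<in> tball (s j) (S j))
      \<and> (\<forall>(i, n)\<in>sectors T0 r. sector_branch T0 T i n = t (i, n))} = S.fl t s S" for s S t
    unfolding S.fl_def S.Et_eq E by auto
  have "pw \<mu> R = \<mu> ^ (R - 1) / fact (R - 1)" using S.R1 by (simp add: pw_def)
  then show ?thesis
    unfolding fl unfolding E using S.E_prob S.conditional_law by (simp add: S.good_def)
qed

end
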